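(* Let $n\ge2$, $\Omega_n=\mathbb C\times\mathbb C^{(n-1)\times n}\times\mathcal U_{n-1}\times\mathbb C^{n-1}$ with the probability density \[ \theta_n(z,M,U,w)=C_n\frac{2n^3}{\pi^{n^2}\mathrm{Vol}(\mathcal U_{n-1})}e^{-2n^3|z|^2-\|M\|_F^2-\|w\|^2}\chi_{\{n|z|\,\|M^\dagger\|_F\le1\}}, \] $C_n$ the normalizing constant, and $\varphi_n:\Omega_n\to\mathcal V_n$, \[ \varphi_n(z,M,U,w)=\Big(\begin{pmatrix} z& w^*\\ 0& MQ_MU\end{pmatrix},\,z,\,e_1\Big). \] Then for every measurable, a.e. continuous $\phi:\mathcal V_n\to[0,\infty]$ which is unitarily invariant ($\phi(UAU^{-1},\lambda,Uv)=\phi(A,\lambda,v)$ for all $U\in\mathcal U_n$) and projective ($\phi(sA,s\lambda,v)=\phi(A,\lambda,v)$ for nonzero scalars $s$), \[ \mathbb E_{\omega\sim\theta_n}\big(\phi(\varphi_n(\omega))\big)\le 22\,n^3\,\mathbb E_{A_0\sim\mathcal G(n)}\Big(\sum_{(\lambda_0,v_0):A_0v_0=\lambda_0v_0}\phi(A_0,\lambda_0,v_0)\Big). \]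
   Context: $\mathcal V_n=\{(A,\lambda,v)\in\mathbb C^{n\times n}\times\mathbb C\times\mathbb P(\mathbb C^n):(\lambda I_n-A)v=0\}$. $\mathcal U_k$ is the unitary group with its Haar (Riemannian) volume; $M^\dagger$ is the Moore–Penrose pseudoinverse; $\chi$ an indicator. $M\mapsto Q_M\in\mathbb C^{n\times(n-1)}$ is a fixed almost-everywhere defined and continuous map (e.g. given by Householder QR) sending a full-rank $M$ to the $Q$ factor of a reduced QR decomposition $M^*=Q_MR$ ($Q_M$ with orthonormal columns, $R$ upper triangular). $\mathcal G(n)$: independent entries with density $\frac1\pi e^{-|z|^2}$. $e_1$ first canonical basis vector. *)

theory Defs
  imports "HOL-Analysis.Analysis"
begin

text \<open>Complex matrices are rendered with the HOL-Analysis Cartesian types.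
  The dimension n is encoded by an index type 'm option, with n - 1 = CARD('m);
  the index None plays the role of the first coordinate.\<close>

definition cadj :: "complex^'n^'m \<Rightarrow> complex^'m^'n" where
  "cadj A = (\<chi> i j. cnj (A $ j $ i))"

definition cscale :: "complex \<Rightarrow> complex^'n^'m \<Rightarrow> complex^'n^'m" where
  "cscale s A = (\<chi> i j. s * A $ i $ j)"

definition unitary_mats :: "(complex^'k^'k) set" where
  "unitary_mats = {U. cadj U ** U = mat 1}"

definition mp_pinv :: "complex^'n^'m \<Rightarrow> complex^'m^'n" where
  "mp_pinv M = (THE X. M ** X ** M = M \<and> X ** M ** X = X \<and>
                       cadj (M ** X) = M ** X \<and> cadj (X ** M) = X ** M)"

definition upper_tri :: "complex^('k::{finite,linorder})^('k::{finite,linorder}) \<Rightarrow> bool" where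
  "upper_tri R \<longleftrightarrow> (\<forall>i j. j < i \<longrightarrow> R $ i $ j = 0)"

definition is_reduced_QR_Q ::
    "complex^'n^('k::{finite,linorder}) \<Rightarrow> complex^('k::{finite,linorder})^'n \<Rightarrow> bool" where
  "is_reduced_QR_Q M Q \<longleftrightarrow> cadj Q ** Q = mat 1 \<and> (\<exists>R. upper_tri R \<and> cadj M = Q ** R)"

definition is_haar_unitary :: "(complex^'k^'k) measure \<Rightarrow> bool" where
  "is_haar_unitary \<mu> \<longleftrightarrow> sets \<mu> = sets borel \<and> emeasure \<mu> UNIV = 1 \<and>
     emeasure \<mu> (- unitary_mats) = 0 \<and>
     (\<forall>V\<in>unitary_mats. distr \<mu> borel (\<lambda>X. V ** X) = \<mu>)"

text \<open>The solution variety, with projective points represented by nonzero vectors.\<close>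
definition Vn :: "((complex^'n^'n) \<times> complex \<times> (complex^'n)) set" where
  "Vn = {(A, l, v). v \<noteq> 0 \<and> (cscale l (mat 1) - A) *v v = 0}"

definition proj_pt :: "complex^'n \<Rightarrow> (complex^'n) set" where
  "proj_pt v = {c *s v | c. c \<noteq> 0}"

definition eigpairs :: "complex^'n^'n \<Rightarrow> (complex \<times> ((complex^'n) set)) set" where
  "eigpairs A = {(l, proj_pt v) | l v. (A, l, v) \<in> Vn}"

definition eig_sum ::
    "(complex^'n^'n \<Rightarrow> complex \<Rightarrow> complex^'n \<Rightarrow> ennreal) \<Rightarrow> complex^'n^'n \<Rightarrow> ennreal" where
  "eig_sum \<phi> A = (\<integral>\<^sup>+ p. \<phi> A (fst p) (SOME v. v \<in> snd p) \<partial>count_space (eigpairs A))"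

definition gauss_density :: "complex^'n^'n \<Rightarrow> real" where
  "gauss_density A = exp (- ((norm A) ^ 2)) / pi ^ (CARD('n) * CARD('n))"

definition block_mat ::
    "complex \<Rightarrow> complex^'m \<Rightarrow> complex^'m^'m \<Rightarrow> complex^('m option)^('m option)" where
  "block_mat z w B = (\<chi> i j. case i of
       None \<Rightarrow> (case j of None \<Rightarrow> z | Some j' \<Rightarrow> cnj (w $ j'))
     | Some i' \<Rightarrow> (case j of None \<Rightarrow> 0 | Some j' \<Rightarrow> B $ i' $ j'))"

definition phi_n ::
    "(complex^('m option)^'m \<Rightarrow> complex^'m^('m option)) \<Rightarrow>
     complex \<times> (complex^('m option)^'m) \<times> (complex^'m^'m) \<times> (complex^'m) \<Rightarrow>
     (complex^('m option)^('m option)) \<times> complex \<times> (complex^('m option))" where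
  "phi_n Q \<omega> = (case \<omega> of (z, M, U, w) \<Rightarrow>
       (block_mat z w (M ** Q M ** U), z, axis None 1))"

text \<open>Unnormalized density of theta_n w.r.t. Lebesgue x Lebesgue x (normalized Haar) x Lebesgue
  (the factor 1/Vol(U_{n-1}) is absorbed by using the normalized Haar measure).\<close>
definition theta_dens ::
    "complex \<times> (complex^('m option)^'m) \<times> (complex^'m^'m) \<times> (complex^'m) \<Rightarrow> real" where
  "theta_dens \<omega> = (case \<omega> of (z, M, U, w) \<Rightarrow>
     let n = real CARD('m option) in
       2 * n^3 / pi ^ (CARD('m option) * CARD('m option))
       * exp (- 2 * n^3 * (cmod z)^2 - (norm M)^2 - (norm w)^2)
       * (if n * cmod z * norm (mp_pinv M) \<le> 1 then 1 else 0))"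

definition theta_base ::
    "(complex^'m^'m) measure \<Rightarrow>
     (complex \<times> (complex^('m option)^'m) \<times> (complex^'m^'m) \<times> (complex^'m)) measure" where
  "theta_base \<mu> = lborel \<Otimes>\<^sub>M lborel \<Otimes>\<^sub>M \<mu> \<Otimes>\<^sub>M lborel"

definition theta_n ::
    "(complex^'m^'m) measure \<Rightarrow>
     (complex \<times> (complex^('m option)^'m) \<times> (complex^'m^'m) \<times> (complex^'m)) measure" where
  "theta_n \<mu> = (let C = inverse (\<integral>\<^sup>+ \<omega>. ennreal (theta_dens \<omega>) \<partial>theta_base \<mu>) in
      density (theta_base \<mu>) (\<lambda>\<omega>. C * ennreal (theta_dens \<omega>)))"

end

theory Submission
  imports Defs "HOL-Probability.Probability"
begin

text \<open>
  Parametrise eigenpairs of a block matrix by \<open>v = (1, u)\<close>: with \<open>w\<close> and the lower right block \<open>D\<close>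
  fixed, \<open>(\<lambda>, u)\<close> determines the first column, and the Jacobian of this chart is \<open>|det (\<lambda> - D + u w\<^sup>*)|\<^sup>2\<close>.
  An area formula (only the inequality obtained from countably many pieces on which the chart is
  injective is needed) followed by the substitution \<open>A = P\<^sub>u T P\<^sub>u\<^sup>*\<close> with an explicit unitary \<open>P\<^sub>u\<close> bounds
  the right-hand side from below by \<open>\<kappa>\<close> times an integral over Schur forms \<open>T = (\<lambda>, w; 0, B)\<close> with
  weight \<open>|det (\<lambda> - B)|\<^sup>2\<close>, where \<open>\<kappa> = \<integral> (1 + |u|\<^sup>2)\<^bsup>-n\<^esup> du\<close>.
  Writing \<open>M = (N y | N)\<close>, the square matrix \<open>M Q\<^sub>M U\<close> has density proportional to
  \<open>|det B|\<^sup>2 exp (-|B|\<^sup>2)\<close>, with the same constant \<open>\<kappa>\<close>, which therefore cancels and is never evaluated.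
  On the support of the density \<open>|det B|\<^sup>2 \<le> 11/2 |det (z - B)|\<^sup>2\<close>, and Chebyshev's inequality
  together with \<open>E |M\<^sup>\<dagger>|\<^sup>2 = n - 1\<close> shows that the normalising constant is at most \<open>2\<close>.
\<close>

section \<open>Jacobians of linear endomorphisms of Euclidean spaces\<close>

text \<open>The sum over eigenpairs stands on the large side, so losses are allowed in one
  direction: the chart misses eigenvectors whose first coordinate is zero, and its critical points
  are dropped because the Jacobian vanishes there. For the same reason measurability of
  \<open>eig_sum\<close> is never discussed; the area formula returns a measurable minorant, which
  is carried to the end. The two sides meet in integrals over square matrices B, and the link is an
  invariance: averaging over U with Haar measure makes a function of M Q_M U depend on M M^H alone
  (^H is the adjoint), so the unknown Q_M disappears. The factor |det B|^2 produced by passing from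
  M to B then has the place that |det (z - B)|^2 has on the side of the eigenpairs, and the support
  condition compares the two. The Jacobians belong to linear maps of large real dimension; they are
  found from multiplicativity, isometries and Gaussian integrals, not by expanding determinants. The
  constant is 2 from the normalisation times 2 n^3 from the density times 11/2 from the
  determinants, which is 22 n^3.\<close>

typedef (overloaded) 'a basis_index = "Basis :: 'a::euclidean_space set"
  using nonempty_Basis by (simp add: ex_in_conv)

instance basis_index :: (euclidean_space) finite
proof
  have "(UNIV :: 'a basis_index set) = Abs_basis_index ` Basis"
    using type_definition.Abs_image[OF type_definition_basis_index] by metis
  then show "finite (UNIV :: 'a basis_index set)" by (metis finite_Basis finite_imageI)
qed

text \<open>The change of variables theorem for \<open>real ^ 'n\<close> asks for a well-ordered
  index type. The order is an arbitrary enumeration of the basis and carries no further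
  meaning.\<close>

instantiation basis_index :: (euclidean_space) wellorder
begin

definition less_eq_basis_index :: "'a basis_index \<Rightarrow> 'a basis_index \<Rightarrow> bool" where
  "less_eq_basis_index i j \<longleftrightarrow>
     to_nat_on (Basis :: 'a set) (Rep_basis_index i) \<le> to_nat_on (Basis :: 'a set) (Rep_basis_index j)"

definition less_basis_index :: "'a basis_index \<Rightarrow> 'a basis_index \<Rightarrow> bool" where
  "less_basis_index i j \<longleftrightarrow>
     to_nat_on (Basis :: 'a set) (Rep_basis_index i) < to_nat_on (Basis :: 'a set) (Rep_basis_index j)"

instance
proof
  fix x y z :: "'a basis_index" and P :: "'a basis_index \<Rightarrow> bool"
  show "x < y \<longleftrightarrow> x \<le> y \<and> \<not> y \<le> x" "x \<le> x" "x \<le> y \<Longrightarrow> y \<le> z \<Longrightarrow> x \<le> z" "x \<le> y \<or> y \<le> x"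
    by (auto simp: less_eq_basis_index_def less_basis_index_def)
  have "inj_on (to_nat_on (Basis :: 'a set)) Basis"
    by (intro inj_on_to_nat_on countable_finite finite_Basis)
  then show "x \<le> y \<Longrightarrow> y \<le> x \<Longrightarrow> x = y"
    unfolding less_eq_basis_index_def
    by (metis Rep_basis_index Rep_basis_index_inject inj_onD order_antisym)
  assume step: "\<And>x. (\<And>y. y < x \<Longrightarrow> P y) \<Longrightarrow> P x"
  show "P x"
    by (induction x rule: measure_induct_rule[where f = "\<lambda>i. to_nat_on (Basis :: 'a set) (Rep_basis_index i)"])
       (rule step, simp add: less_basis_index_def)
qed

end

lemma bij_betw_Rep_basis_index: "bij_betw Rep_basis_index UNIV (Basis :: 'a::euclidean_space set)"
  using Rep_basis_index type_definition.Rep_range[OF type_definition_basis_index]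
  by (auto simp: bij_betw_def inj_on_def Rep_basis_index_inject)

definition to_cart :: "'a::euclidean_space \<Rightarrow> real ^ 'a basis_index" where
  "to_cart x = (\<chi> i. x \<bullet> Rep_basis_index i)"

definition of_cart :: "real ^ 'a basis_index \<Rightarrow> 'a::euclidean_space" where
  "of_cart v = (\<Sum>i\<in>UNIV. (v $ i) *\<^sub>R Rep_basis_index i)"

lemma linear_to_cart: "linear to_cart"
  by (rule linearI) (auto simp: to_cart_def vec_eq_iff inner_add_left)

lemma linear_of_cart: "linear of_cart"
  by (rule linearI) (auto simp: of_cart_def algebra_simps sum.distrib scaleR_sum_right)

lemma of_cart_to_cart [simp]: "of_cart (to_cart x) = x"
proof -
  have "of_cart (to_cart x) = (\<Sum>b\<in>Basis. (x \<bullet> b) *\<^sub>R b)"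
    unfolding of_cart_def to_cart_def using sum.reindex_bij_betw[OF bij_betw_Rep_basis_index] by simp
  then show ?thesis by (simp add: euclidean_representation)
qed

lemma to_cart_of_cart [simp]: "to_cart (of_cart v) = v"
proof -
  have "(\<Sum>j\<in>UNIV. v $ j * (Rep_basis_index j \<bullet> Rep_basis_index i)) = v $ i" for i :: "'a basis_index"
  proof -
    have "(\<Sum>j\<in>UNIV. v $ j * (Rep_basis_index j \<bullet> Rep_basis_index i)) = (\<Sum>j\<in>UNIV. if j = i then v $ j else 0)"
      by (intro sum.cong refl) (simp add: inner_Basis Rep_basis_index Rep_basis_index_inject)
    then show ?thesis by simp
  qed
  then show ?thesis by (simp add: to_cart_def of_cart_def vec_eq_iff inner_sum_left)
qed

lemma linear_borel_measurable:
  fixes f :: "'a::euclidean_space \<Rightarrow> 'b::euclidean_space"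
  shows "linear f \<Longrightarrow> f \<in> borel_measurable borel"
  by (intro borel_measurable_continuous_onI linear_continuous_on linear_conv_bounded_linear[THEN iffD1])

text \<open>Lebesgue measure is determined by its values on boxes, and the preimage of a box is a
  box with the same side lengths in another order.\<close>

lemma distr_lborel_Basis_bij:
  fixes f :: "'a::euclidean_space \<Rightarrow> 'b::euclidean_space"
  assumes f: "linear f" and bij: "bij_betw f Basis Basis"
  shows "distr lborel borel f = lborel"
proof (rule lborel_eqI[symmetric])
  note [measurable] = linear_borel_measurable[OF f]
  fix l u :: 'b assume lu: "\<And>b. b \<in> Basis \<Longrightarrow> l \<bullet> b \<le> u \<bullet> b"
  have fB: "f b \<in> Basis" if "b \<in> Basis" for b using bij that by (auto simp: bij_betw_def)
  have inj: "f b = f c \<longleftrightarrow> b = c" if "b \<in> Basis" "c \<in> Basis" for b c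
    using bij that by (auto simp: bij_betw_def inj_on_def)
  have coord: "f x \<bullet> f b = x \<bullet> b" if b: "b \<in> Basis" for x b
  proof -
    have "f x = f (\<Sum>c\<in>Basis. (x \<bullet> c) *\<^sub>R c)" by (simp add: euclidean_representation)
    also have "\<dots> = (\<Sum>c\<in>Basis. (x \<bullet> c) *\<^sub>R f c)"
      using f by (simp add: linear_sum linear_cmul)
    finally have "f x \<bullet> f b = (\<Sum>c\<in>Basis. (x \<bullet> c) * (f c \<bullet> f b))" by (simp add: inner_sum_left)
    also have "\<dots> = (\<Sum>c\<in>Basis. if c = b then x \<bullet> c else 0)"
      by (intro sum.cong refl) (auto simp: inner_Basis fB inj b)
    finally show ?thesis using b by simp
  qed
  define bk :: "'b \<Rightarrow> 'a" where "bk y = (\<Sum>b\<in>Basis. (y \<bullet> f b) *\<^sub>R b)" for y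
  have bk: "bk y \<bullet> b = y \<bullet> f b" if "b \<in> Basis" for y b
    using that by (simp add: bk_def)
  have "f -` box l u = box (bk l) (bk u)"
  proof -
    have "(\<forall>c\<in>Basis. l \<bullet> c < f x \<bullet> c \<and> f x \<bullet> c < u \<bullet> c) \<longleftrightarrow>
          (\<forall>b\<in>Basis. l \<bullet> f b < f x \<bullet> f b \<and> f x \<bullet> f b < u \<bullet> f b)" for x
      using bij unfolding bij_betw_def by (metis (no_types, lifting) imageE image_eqI)
    then show ?thesis by (auto simp: mem_box bk coord)
  qed
  then have "emeasure (distr lborel borel f) (box l u) = emeasure lborel (box (bk l) (bk u))"
    by (simp add: emeasure_distr)
  also have "\<dots> = (\<Prod>b\<in>Basis. (bk u - bk l) \<bullet> b)"
    using lu fB by (intro emeasure_lborel_box) (auto simp: bk)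
  also have "(\<Prod>b\<in>Basis. (bk u - bk l) \<bullet> b) = (\<Prod>b\<in>Basis. (u - l) \<bullet> f b)"
    by (intro prod.cong refl) (simp add: bk inner_diff_left)
  also have "\<dots> = (\<Prod>b\<in>Basis. (u - l) \<bullet> b)"
    by (rule prod.reindex_bij_betw[OF bij])
  finally show "emeasure (distr lborel borel f) (box l u) = (\<Prod>b\<in>Basis. (u - l) \<bullet> b)" .
qed simp

lemma distr_to_cart: "distr lborel borel (to_cart :: 'a::euclidean_space \<Rightarrow> _) = lborel"
proof (rule distr_lborel_Basis_bij[OF linear_to_cart])
  have ax: "to_cart (Rep_basis_index i) = axis i (1::real)" for i :: "'a basis_index"
    by (auto simp: to_cart_def vec_eq_iff axis_def inner_Basis Rep_basis_index Rep_basis_index_inject)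
  have "bij_betw (to_cart \<circ> Rep_basis_index) UNIV (Basis :: (real ^ 'a basis_index) set)"
    by (auto simp: bij_betw_def inj_on_def ax Basis_vec_def axis_eq_axis)
  then show "bij_betw to_cart (Basis :: 'a set) Basis"
    by (metis bij_betw_Rep_basis_index bij_betw_comp_iff)
qed

lemma distr_of_cart: "distr lborel borel (of_cart :: _ \<Rightarrow> 'a::euclidean_space) = lborel"
proof -
  note [measurable] = linear_borel_measurable[OF linear_to_cart] linear_borel_measurable[OF linear_of_cart]
  have "distr lborel borel (of_cart :: _ \<Rightarrow> 'a) = distr (distr lborel borel to_cart) borel of_cart"
    by (simp add: distr_to_cart)
  also have "\<dots> = distr lborel borel (of_cart \<circ> to_cart)"
    by (rule distr_distr) auto
  also have "of_cart \<circ> to_cart = (id :: 'a \<Rightarrow> 'a)" by auto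
  finally show ?thesis by (simp add: distr_id2 id_def)
qed

text \<open>The absolute determinant, made available for products and complex matrices by passing to
  real orthonormal coordinates. It is meaningful for linear \<open>f\<close>.\<close>

definition jac :: "('a::euclidean_space \<Rightarrow> 'a) \<Rightarrow> real" where
  "jac f = \<bar>det (matrix (to_cart \<circ> f \<circ> of_cart))\<bar>"

lemma jac_nonneg [simp]: "0 \<le> jac f"
  by (simp add: jac_def)

lemma jac_compose:
  assumes "linear f" "linear g" shows "jac (f \<circ> g) = jac f * jac g"
proof -
  have "to_cart \<circ> (f \<circ> g) \<circ> of_cart = (to_cart \<circ> f \<circ> of_cart) \<circ> (to_cart \<circ> g \<circ> of_cart)"
    by (auto simp: fun_eq_iff)
  then show ?thesis unfolding jac_def
    by (subst matrix_compose[symmetric] | simp add: abs_mult[symmetric] det_mul[symmetric] matrix_compose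
        linear_compose linear_to_cart linear_of_cart assms)+
qed

lemma jac_id [simp]: "jac (\<lambda>x. x) = 1"
proof -
  have "to_cart \<circ> (\<lambda>x. x) \<circ> of_cart = (id :: real ^ 'a basis_index \<Rightarrow> _)" by (auto simp: fun_eq_iff)
  then show ?thesis by (simp add: jac_def matrix_id_mat_1)
qed

text \<open>Injective change of variables, transported through the measure preserving coordinate
  maps. Stating an inequality disposes of images of infinite measure at once; otherwise the image is
  \<open>lmeasurable\<close>, as the Cartesian theorem requires.\<close>

lemma integral_jac_le_image:
  fixes f :: "'a::euclidean_space \<Rightarrow> 'a"
  assumes S [measurable]: "S \<in> sets borel" and fS: "f ` S \<in> sets borel" and inj: "inj_on f S"
    and der: "\<And>x. x \<in> S \<Longrightarrow> (f has_derivative f' x) (at x)"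
    and meas: "(\<lambda>x. jac (f' x) * indicator S x) \<in> borel_measurable borel"
  shows "(\<integral>\<^sup>+x. jac (f' x) * indicator S x \<partial>lborel) \<le> emeasure lborel (f ` S)"
proof (cases "emeasure lborel (f ` S) = \<infinity>")
  case False
  note [measurable] = linear_borel_measurable[OF linear_to_cart] linear_borel_measurable[OF linear_of_cart]
  let ?f = "to_cart \<circ> f \<circ> of_cart" and ?S = "of_cart -` S"
  let ?f' = "\<lambda>v. to_cart \<circ> f' (of_cart v) \<circ> of_cart"
  have S': "?S \<in> sets borel" using measurable_sets[OF linear_borel_measurable[OF linear_of_cart] S] by simp
  have img: "?f ` ?S = of_cart -` (f ` S)"
  proof (intro equalityI subsetI)
    fix v assume "v \<in> of_cart -` (f ` S)"
    then obtain x where x: "x \<in> S" "of_cart v = f x" by auto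
    then have "v = ?f (to_cart x)" by (simp flip: x(2))
    with x(1) show "v \<in> ?f ` ?S" by (intro image_eqI[of _ _ "to_cart x"]) auto
  qed auto
  have img': "?f ` ?S \<in> sets borel"
    unfolding img using measurable_sets[OF linear_borel_measurable[OF linear_of_cart] fS] by simp
  have eq: "emeasure lborel (?f ` ?S) = emeasure lborel (f ` S)"
  proof -
    have "emeasure lborel (f ` S) = emeasure (distr lborel borel of_cart) (f ` S)"
      by (simp add: distr_of_cart)
    also have "\<dots> = emeasure lborel (of_cart -` (f ` S))"
      using fS by (subst emeasure_distr) auto
    finally show ?thesis unfolding img by simp
  qed
  have lm: "?f ` ?S \<in> lmeasurable"
    using img' eq False by (auto simp: fmeasurable_def less_top[symmetric])
  have d: "(?f has_derivative ?f' v) (at v within ?S)" if "v \<in> ?S" for v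
  proof -
    have "(of_cart has_derivative of_cart) (at v within ?S)"
      by (intro linear_imp_has_derivative linear_of_cart)
    moreover have "(f has_derivative f' (of_cart v)) (at (of_cart v))"
      using der that by auto
    ultimately have "(f \<circ> of_cart has_derivative f' (of_cart v) \<circ> of_cart) (at v within ?S)"
      using diff_chain_within has_derivative_at_withinI by blast
    then have "(to_cart \<circ> (f \<circ> of_cart) has_derivative to_cart \<circ> (f' (of_cart v) \<circ> of_cart)) (at v within ?S)"
      by (rule diff_chain_within[OF _ linear_imp_has_derivative[OF linear_to_cart]])
    then show ?thesis by (simp add: o_assoc)
  qed
  have i: "inj_on ?f ?S"
    using inj by (auto simp: inj_on_def) (metis of_cart_to_cart to_cart_of_cart)
  have "((\<lambda>v. jac (f' (of_cart v))) has_integral measure lebesgue (?f ` ?S)) ?S"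
    using has_measure_differentiable_image[OF _ d i, of "measure lebesgue (?f ` ?S)"] lm S'
    by (simp add: jac_def)
  then have "integral\<^sup>N lborel (\<lambda>v. indicator ?S v * jac (f' (of_cart v))) = measure lebesgue (?f ` ?S)"
    by (intro nn_integral_has_integral_lebesgue) auto
  also have "ennreal (measure lebesgue (?f ` ?S)) = emeasure lborel (f ` S)"
  proof -
    have "ennreal (measure lebesgue (?f ` ?S)) = emeasure lebesgue (?f ` ?S)"
      using lm by (rule emeasure_eq_measure2[symmetric])
    also have "\<dots> = emeasure lborel (?f ` ?S)"
      using img' by simp
    finally show ?thesis using eq by simp
  qed
  also have "integral\<^sup>N lborel (\<lambda>v. indicator ?S v * jac (f' (of_cart v))) =
      integral\<^sup>N lborel (\<lambda>v. (\<lambda>x. ennreal (jac (f' x) * indicator S x)) (of_cart v))"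
    by (intro nn_integral_cong) (auto simp: indicator_def)
  also have "\<dots> = integral\<^sup>N (distr lborel borel of_cart) (\<lambda>x. jac (f' x) * indicator S x)"
    using meas by (subst nn_integral_distr) auto
  finally show ?thesis by (simp add: distr_of_cart)
qed simp

section \<open>Change of variables and the area formula\<close>

text \<open>A comparison of measures: the measure with density \<open>jac (f' x)\<close> on
  \<open>S\<close> is dominated, set by set, by the image under \<open>g\<close> of Lebesgue measure
  on the image of \<open>S\<close>. Integrating \<open>\<psi>\<close> against both gives the
  claim.\<close>

lemma nn_integral_jac_le_inverse:
  fixes f g :: "'a::euclidean_space \<Rightarrow> 'a" and \<psi> :: "'a \<Rightarrow> ennreal"
  assumes S [measurable]: "S \<in> sets borel" and fS [measurable]: "f ` S \<in> sets borel"
    and g [measurable]: "g \<in> borel_measurable borel" and gf: "\<And>x. x \<in> S \<Longrightarrow> g (f x) = x"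
    and der: "\<And>x. x \<in> S \<Longrightarrow> (f has_derivative f' x) (at x)"
    and meas: "(\<lambda>x. jac (f' x) * indicator S x) \<in> borel_measurable borel"
    and \<psi> [measurable]: "\<psi> \<in> borel_measurable borel"
  shows "(\<integral>\<^sup>+x. \<psi> x * (jac (f' x) * indicator S x) \<partial>lborel) \<le> (\<integral>\<^sup>+y. \<psi> (g y) * indicator (f ` S) y \<partial>lborel)"
proof -
  note [measurable] = meas
  have inj: "inj_on f S" using gf by (metis inj_onI)
  let ?M = "density lborel (\<lambda>x. ennreal (jac (f' x) * indicator S x))"
  let ?N = "distr (density lborel (indicator (f ` S))) borel g"
  have "emeasure ?M A \<le> emeasure ?N A" if A [measurable]: "A \<in> sets borel" for A
  proof -
    \<comment> \<open>The inverse \<open>g\<close> shows that the image of a Borel part of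
      \<open>S\<close> is Borel: it is a preimage under \<open>g\<close>, cut down to the image of
      \<open>S\<close>.\<close>
    have img: "f ` (S \<inter> A) = f ` S \<inter> g -` A" using gf by auto
    have [measurable]: "f ` (S \<inter> A) \<in> sets borel"
      unfolding img using measurable_sets[OF g A] by auto
    have "(\<lambda>x. jac (f' x) * indicator S x * indicator A x) \<in> borel_measurable borel" by measurable
    then have m2: "(\<lambda>x. jac (f' x) * indicator (S \<inter> A) x) \<in> borel_measurable borel"
      by (simp add: indicator_inter_arith mult.assoc)
    have "emeasure ?M A = (\<integral>\<^sup>+x. ennreal (jac (f' x) * indicator S x) * indicator A x \<partial>lborel)"
      by (simp add: emeasure_density)
    also have "\<dots> = (\<integral>\<^sup>+x. ennreal (jac (f' x) * indicator (S \<inter> A) x) \<partial>lborel)"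
      by (intro nn_integral_cong) (auto simp: indicator_def)
    also have "\<dots> \<le> emeasure lborel (f ` (S \<inter> A))"
      using m2 inj der by (intro integral_jac_le_image) (auto intro: inj_on_subset)
    also have "\<dots> = (\<integral>\<^sup>+y. indicator (f ` S) y * indicator (g -` A) y \<partial>lborel)"
    proof -
      have "(\<integral>\<^sup>+y. indicator (f ` S) y * indicator (g -` A) y \<partial>lborel) =
          (\<integral>\<^sup>+y. indicator (f ` (S \<inter> A)) y \<partial>lborel)"
        unfolding img by (intro nn_integral_cong) (auto simp: indicator_def)
      then show ?thesis by simp
    qed
    also have "\<dots> = emeasure ?N A"
      using measurable_sets[OF g A] by (simp add: emeasure_distr emeasure_density)
    finally show ?thesis .
  qed
  then have "?M \<le> ?N"
    by (subst le_measure) (auto simp: le_fun_def)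
  then have "nn_integral ?M \<psi> \<le> nn_integral ?N \<psi>"
    by (intro nn_integral_mono_measure) auto
  moreover have "nn_integral ?M \<psi> = (\<integral>\<^sup>+x. ennreal (jac (f' x) * indicator S x) * \<psi> x \<partial>lborel)"
    using meas by (intro nn_integral_density) simp_all
  moreover have "nn_integral ?N \<psi> = (\<integral>\<^sup>+y. indicator (f ` S) y * \<psi> (g y) \<partial>lborel)"
    by (simp add: nn_integral_distr nn_integral_density)
  ultimately show ?thesis
    by (simp only: mult.commute[of _ "\<psi> _"] mult.commute[of "indicator (f ` S) _"])
qed

lemma jac_inverse:
  assumes "linear f" "linear g" "\<And>x. f (g x) = x"
  shows "jac f * jac g = 1"
proof -
  have "f \<circ> g = (\<lambda>x. x)" using assms(3) by auto
  then show ?thesis using jac_compose[OF assms(1,2)] by simp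
qed

lemma linear_inj_inverse:
  fixes f :: "'a::euclidean_space \<Rightarrow> 'a"
  assumes "linear f" "inj f"
  shows "\<exists>g. linear g \<and> (\<forall>x. f (g x) = x) \<and> (\<forall>x. g (f x) = x)"
proof -
  obtain g where g: "linear g" "g \<circ> f = id"
    using linear_injective_left_inverse[OF assms] by blast
  moreover have "f \<circ> g = id"
    using linear_inverse_left[OF assms(1) g(1)] g(2) by simp
  ultimately show ?thesis by (metis comp_apply id_apply)
qed

lemma jac_pos: "linear f \<Longrightarrow> inj f \<Longrightarrow> 0 < jac f"
proof -
  assume f: "linear f" "inj f"
  obtain g where "linear g" "\<And>x. f (g x) = x" using linear_inj_inverse[OF f] by auto
  then have "jac f * jac g = 1" using f by (intro jac_inverse)
  then have "jac f \<noteq> 0" by auto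
  then show ?thesis using jac_nonneg[of f] by linarith
qed

text \<open>Equality follows from the inequality for \<open>f\<close> together with the inequality
  for its inverse, because the two Jacobians are reciprocal.\<close>

lemma nn_integral_linear:
  fixes f :: "'a::euclidean_space \<Rightarrow> 'a" and h :: "'a \<Rightarrow> ennreal"
  assumes f: "linear f" "inj f" and [measurable]: "h \<in> borel_measurable borel"
  shows "(\<integral>\<^sup>+x. h x \<partial>lborel) = ennreal (jac f) * (\<integral>\<^sup>+x. h (f x) \<partial>lborel)"
proof -
  obtain g where g: "linear g" "\<And>x. f (g x) = x" "\<And>x. g (f x) = x"
    using linear_inj_inverse[OF f] by auto
  note [measurable] = linear_borel_measurable[OF f(1)] linear_borel_measurable[OF g(1)]
  have le: "ennreal (jac f) * (\<integral>\<^sup>+x. h (f x) \<partial>lborel) \<le> (\<integral>\<^sup>+x. h x \<partial>lborel)"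
    if f: "linear f" "f \<in> borel_measurable borel" and g: "g \<in> borel_measurable borel" 
      "\<And>x. f (g x) = x" "\<And>x. g (f x) = x"
      and [measurable]: "h \<in> borel_measurable borel" for f g :: "'a \<Rightarrow> 'a" and h :: "'a \<Rightarrow> ennreal"
  proof -
    note [measurable] = f(2) g(1)
    have "range f = UNIV" using g by (metis surjI)
    then show ?thesis
      using nn_integral_jac_le_inverse[of UNIV f g "\<lambda>_. f" "\<lambda>x. h (f x)"] g linear_imp_has_derivative[OF f(1)]
      by (simp add: nn_integral_cmult mult.commute)
  qed
  have J: "ennreal (jac f) * ennreal (jac g) = 1"
    using jac_inverse[OF f(1) g(1,2)] by (simp add: ennreal_mult[symmetric])
  have "(\<integral>\<^sup>+x. h x \<partial>lborel) = ennreal (jac f) * (ennreal (jac g) * (\<integral>\<^sup>+x. h (f (g x)) \<partial>lborel))"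
    using J g by (simp add: mult.assoc[symmetric])
  also have "\<dots> \<le> ennreal (jac f) * (\<integral>\<^sup>+x. h (f x) \<partial>lborel)"
    using g by (intro mult_left_mono le[of g f "\<lambda>x. h (f x)"]) auto
  finally show ?thesis using le[of f g h] f g by (intro antisym) auto
qed

text \<open>By the Leibniz formula the Jacobian is the absolute value of a polynomial in matrix
  entries, so continuity of \<open>f'\<close> at each fixed vector suffices.\<close>

lemma continuous_on_jac:
  fixes f' :: "'b::topological_space \<Rightarrow> 'a::euclidean_space \<Rightarrow> 'a"
  assumes lin: "\<And>x. x \<in> S \<Longrightarrow> linear (f' x)" and cont: "\<And>v. continuous_on S (\<lambda>x. f' x v)"
  shows "continuous_on S (\<lambda>x. jac (f' x))"
proof -
  have eq: "jac (f' x) = \<bar>\<Sum>p | p permutes (UNIV :: 'a basis_index set). of_int (sign p) *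
      (\<Prod>i\<in>UNIV. f' x (of_cart (axis (p i) 1)) \<bullet> Rep_basis_index i)\<bar>" for x
    by (simp add: jac_def det_def matrix_def to_cart_def)
  show ?thesis unfolding eq
    by (intro continuous_on_rabs continuous_on_sum continuous_on_mult continuous_on_const
        continuous_on_prod continuous_on_inner cont)
qed

lemma nn_integral_count_space_subset_mono:
  assumes "A \<subseteq> B"
  shows "(\<integral>\<^sup>+x. f x \<partial>count_space A) \<le> (\<integral>\<^sup>+x. f x \<partial>count_space B)"
proof -
  have "(\<integral>\<^sup>+x. f x \<partial>count_space C) = (\<integral>\<^sup>+x. f x * indicator C x \<partial>count_space UNIV)" for C
    by (simp add: nn_integral_count_space_indicator)
  then show ?thesis using assms by (auto intro!: nn_integral_mono simp: indicator_def)
qed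

text \<open>The statement exhibits a measurable \<open>h\<close> below the fibre sum, so that no
  measurability of the fibre sum itself is involved. \<open>h\<close> adds up the values of
  \<open>\<psi>\<close> at the local preimages of \<open>y\<close>, one for each piece of a
  countable partition of \<open>U\<close>.\<close>

lemma area_formula_le:
  fixes f :: "'a::euclidean_space \<Rightarrow> 'a" and \<psi> :: "'a \<Rightarrow> ennreal"
  assumes U: "open U"
    and der: "\<And>x. x \<in> U \<Longrightarrow> (f has_derivative f' x) (at x)"
    and cont: "\<And>v. continuous_on U (\<lambda>x. f' x v)"
    and inj: "\<And>x. x \<in> U \<Longrightarrow> inj (f' x)"
    and \<psi> [measurable]: "\<psi> \<in> borel_measurable borel"
  shows "\<exists>h \<in> borel_measurable borel. (\<forall>y. h y \<le> (\<integral>\<^sup>+x. \<psi> x \<partial>count_space {x\<in>U. f x = y})) \<and>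
           (\<integral>\<^sup>+x. \<psi> x * (jac (f' x) * indicator U x) \<partial>lborel) \<le> (\<integral>\<^sup>+y. h y \<partial>lborel)"
proof -
  have lin: "linear (f' x)" if "x \<in> U" for x using der[OF that] has_derivative_linear by blast
  have contf: "continuous_on U f"
    using der by (meson continuous_at_imp_continuous_on has_derivative_continuous)
  have "\<exists>r>0. ball x r \<subseteq> U \<and> inj_on f (ball x r)" if x: "x \<in> U" for x
  proof -
    obtain g where g: "linear g" "\<And>v. f' x (g v) = v" "\<And>v. g (f' x v) = v"
      using linear_inj_inverse[OF lin[OF x] inj[OF x]] by auto
    \<comment> \<open>The operator norm is at most the sum of the norms on basis vectors, so
      continuity of \<open>f'\<close> at each fixed vector gives continuity in operator norm, which
      local injectivity needs.\<close>
    have small: "\<exists>d>0. \<forall>y. dist x y < d \<longrightarrow> onorm (\<lambda>v. f' y v - f' x v) < e" if e: "e > 0" for e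
    proof -
      define s where "s y = (\<Sum>b\<in>Basis. norm (f' y b - f' x b))" for y
      have "continuous_on U s" unfolding s_def by (intro continuous_intros cont)
      then have "isCont s x" using U x by (simp add: continuous_on_eq_continuous_at)
      moreover have "s x = 0" by (simp add: s_def)
      ultimately obtain d1 where d1: "d1 > 0" "\<And>y. dist y x < d1 \<Longrightarrow> s y < e"
        using e by (auto simp: continuous_at_eps_delta dist_norm abs_less_iff)
      obtain d2 where d2: "d2 > 0" "ball x d2 \<subseteq> U" using U x open_contains_ball by blast
      have "onorm (\<lambda>v. f' y v - f' x v) < e" if y: "dist x y < min d1 d2" for y
      proof -
        have "y \<in> U" using d2 y by auto
        then have l: "linear (\<lambda>v. f' y v - f' x v)" using lin x by (intro linear_compose_sub) auto
        have "norm (f' y v - f' x v) \<le> s y * norm v" for v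
        proof -
          have "f' y v - f' x v = (\<lambda>v. f' y v - f' x v) (\<Sum>b\<in>Basis. (v \<bullet> b) *\<^sub>R b)"
            by (simp add: euclidean_representation)
          also have "\<dots> = (\<Sum>b\<in>Basis. (v \<bullet> b) *\<^sub>R (f' y b - f' x b))"
            by (simp only: linear_sum[OF l] linear_cmul[OF l])
          also have "norm \<dots> \<le> (\<Sum>b\<in>Basis. \<bar>v \<bullet> b\<bar> * norm (f' y b - f' x b))"
            by (rule order_trans[OF norm_sum]) simp
          also have "\<dots> \<le> (\<Sum>b\<in>Basis. norm v * norm (f' y b - f' x b))"
            by (intro sum_mono mult_right_mono Basis_le_norm) auto
          finally show ?thesis by (simp add: s_def sum_distrib_left mult.commute)
        qed
        then have "onorm (\<lambda>v. f' y v - f' x v) \<le> s y" by (rule onorm_le)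
        also have "s y < e" using d1(2) y by (simp add: dist_commute)
        finally show ?thesis .
      qed
      then show ?thesis using d1(1) d2(1) by (intro exI[of _ "min d1 d2"]) auto
    qed
    show ?thesis
      by (rule has_derivative_locally_injective[OF x U, of g f' f])
         (use g der small in \<open>auto simp: linear_conv_bounded_linear fun_eq_iff\<close>)
  qed
  then obtain r where r: "\<And>x. x \<in> U \<Longrightarrow> r x > 0 \<and> ball x (r x) \<subseteq> U \<and> inj_on f (ball x (r x))"
    by metis
  obtain F where F: "F \<subseteq> (\<lambda>x. ball x (r x)) ` U" "countable F" "\<Union>F = \<Union>((\<lambda>x. ball x (r x)) ` U)"
    using Lindelof[of "(\<lambda>x. ball x (r x)) ` U"] by auto
  have "\<Union>F = U" using F(3) r by fastforce
  \<comment> \<open>Inserting the empty set keeps the enumeration meaningful when \<open>F\<close>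
    is empty.\<close>
  define B where "B = from_nat_into (insert {} F)"
  have B_range: "range B = insert {} F"
    unfolding B_def using F(2) by (intro range_from_nat_into) auto
  have B_F: "B k = {} \<or> B k \<in> F" for k using B_range by blast
  have B_open: "open (B k)" and B_U: "B k \<subseteq> U" and B_inj: "inj_on f (B k)" for k
    using B_F[of k] F(1) r by auto
  have UB: "(\<Union>k. B k) = U" using B_range \<open>\<Union>F = U\<close> by auto
  \<comment> \<open>The value 0 off the image makes the local inverse a total Borel
    function.\<close>
  define g where "g k y = (if y \<in> f ` B k then inv_into (B k) f y else 0)" for k y
  \<comment> \<open>Invariance of domain: images of open sets are open, so each local inverse is
    continuous on an open set.\<close>
  have fB_open: "open (f ` T)" if "open T" "T \<subseteq> B k" for T k
    using that B_U contf B_inj by (intro invariance_of_domain) (blast intro: continuous_on_subset inj_on_subset)+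
  have g_meas [measurable]: "g k \<in> borel_measurable borel" for k
  proof -
    have "continuous_on (f ` B k) (inv_into (B k) f)"
      using continuous_on_subset[OF contf B_U[of k]] B_open B_inj by (intro continuous_on_inverse_open) auto
    then show ?thesis unfolding g_def
      using fB_open[OF B_open order_refl] by (intro borel_measurable_continuous_on_if) auto
  qed
  have gf: "g k (f x) = x" if "x \<in> B k" for k x
    using that B_inj by (simp add: g_def)
  define E where "E = disjointed B"
  have E_sub: "E k \<subseteq> B k" for k by (simp add: E_def disjointed_subset)
  have E_meas [measurable]: "E k \<in> sets borel" for k
    unfolding E_def using B_open by (intro sets.range_disjointed_sets[THEN subsetD, of B borel]) auto
  have E_disj: "i = j" if "x \<in> E i" "x \<in> E j" for i j x
    using disjoint_family_disjointed[of B] that by (auto simp: E_def disjoint_family_on_def)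
  have UE: "(\<Union>k. E k) = U" by (simp add: E_def UN_disjointed_eq UB)
  have fE: "f ` E k = f ` B k \<inter> g k -` E k" for k
  proof (intro equalityI subsetI)
    fix y assume "y \<in> f ` B k \<inter> g k -` E k"
    then obtain x where "x \<in> B k" "y = f x" "g k y \<in> E k" by auto
    then show "y \<in> f ` E k" using gf by simp
  next
    fix y assume "y \<in> f ` E k"
    then obtain x where "x \<in> E k" "y = f x" by auto
    then show "y \<in> f ` B k \<inter> g k -` E k" using gf E_sub[of k] by auto
  qed
  have fE_meas [measurable]: "f ` E k \<in> sets borel" for k
    unfolding fE using measurable_sets[OF g_meas E_meas, of k k] fB_open[OF B_open order_refl, of k] by auto
  have jmeas: "(\<lambda>x. jac (f' x) * indicator T x) \<in> borel_measurable borel" if T: "T \<in> sets borel" "T \<subseteq> U" for T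
  proof -
    have "(\<lambda>x. if x \<in> U then jac (f' x) else 0) \<in> borel_measurable borel"
      using U by (intro borel_measurable_continuous_on_if continuous_on_jac cont lin) auto
    then have "(\<lambda>x. (if x \<in> U then jac (f' x) else 0) * indicator T x) \<in> borel_measurable borel"
      using T(1) by measurable
    also have "(\<lambda>x. (if x \<in> U then jac (f' x) else 0) * indicator T x) = (\<lambda>x. jac (f' x) * indicator T x)"
      using T(2) by (auto simp: indicator_def fun_eq_iff)
    finally show ?thesis .
  qed
  have EU: "E k \<subseteq> U" for k using UE by auto
  have gE: "g k (f x) = x" if "x \<in> E k" for k x using gf that E_sub by blast
  have split: "ennreal (jac (f' x) * indicator U x) = (\<Sum>k. ennreal (jac (f' x) * indicator (E k) x))" for x
  proof (cases "x \<in> U")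
    case True
    then obtain k where k: "x \<in> E k" using UE by blast
    have "(\<Sum>j. ennreal (jac (f' x) * indicator (E j) x)) = (\<Sum>j\<in>{k}. ennreal (jac (f' x) * indicator (E j) x))"
      using E_disj k by (intro suminf_finite) (auto simp: indicator_def)
    then show ?thesis using True k by simp
  next
    case False
    then have "x \<notin> E k" for k using EU by auto
    then show ?thesis using False by simp
  qed
  have "(\<integral>\<^sup>+x. \<psi> x * (jac (f' x) * indicator U x) \<partial>lborel)
      = (\<integral>\<^sup>+x. (\<Sum>k. \<psi> x * ennreal (jac (f' x) * indicator (E k) x)) \<partial>lborel)"
    by (simp add: split ennreal_suminf_cmult)
  also have "\<dots> = (\<Sum>k. \<integral>\<^sup>+x. \<psi> x * ennreal (jac (f' x) * indicator (E k) x) \<partial>lborel)"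
    using jmeas[OF E_meas EU]
    by (intro nn_integral_suminf borel_measurable_times_ennreal measurable_compose[OF _ measurable_ennreal]) auto
  also have "\<dots> \<le> (\<Sum>k. \<integral>\<^sup>+y. \<psi> (g k y) * indicator (f ` E k) y \<partial>lborel)"
    using EU der gE jmeas[OF E_meas EU]
    by (intro suminf_le nn_integral_jac_le_inverse) (auto dest!: subsetD)
  also have "\<dots> = (\<integral>\<^sup>+y. (\<Sum>k. \<psi> (g k y) * indicator (f ` E k) y) \<partial>lborel)"
    by (intro nn_integral_suminf[symmetric]) measurable
  finally have le: "(\<integral>\<^sup>+x. \<psi> x * (jac (f' x) * indicator U x) \<partial>lborel)
    \<le> (\<integral>\<^sup>+y. (\<Sum>k. \<psi> (g k y) * indicator (f ` E k) y) \<partial>lborel)" .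
  \<comment> \<open>A piece that meets the fibre over \<open>y\<close> contributes one point of it.
    The pieces are disjoint, so these points are distinct and the series is a sum over a subset of
    the fibre.\<close>
  have fibre: "(\<Sum>k. \<psi> (g k y) * indicator (f ` E k) y) \<le> (\<integral>\<^sup>+x. \<psi> x \<partial>count_space {x\<in>U. f x = y})" for y
  proof -
    define K where "K = {k. y \<in> f ` E k}"
    have gK: "g k y \<in> E k \<and> f (g k y) = y" if "k \<in> K" for k
    proof -
      obtain x where "x \<in> E k" "y = f x" using \<open>k \<in> K\<close> by (auto simp: K_def)
      then show ?thesis using gf[of x k] E_sub[of k] by auto
    qed
    have injK: "inj_on (\<lambda>k. g k y) K"
    proof (rule inj_onI)
      fix i j assume "i \<in> K" "j \<in> K" "g i y = g j y"
      then show "i = j" using gK[of i] gK[of j] E_disj[of "g i y" i j] by simp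
    qed
    have "(\<Sum>k. \<psi> (g k y) * indicator (f ` E k) y) = (\<integral>\<^sup>+k. \<psi> (g k y) * indicator K k \<partial>count_space UNIV)"
      by (simp add: nn_integral_count_space_nat K_def indicator_def)
    also have "\<dots> = (\<integral>\<^sup>+k. \<psi> (g k y) \<partial>count_space K)"
      by (simp add: nn_integral_count_space_indicator)
    also have "\<dots> = (\<integral>\<^sup>+x. \<psi> x \<partial>count_space ((\<lambda>k. g k y) ` K))"
      using injK by (intro nn_integral_bij_count_space) (simp add: bij_betw_def)
    also have "\<dots> \<le> (\<integral>\<^sup>+x. \<psi> x \<partial>count_space {x\<in>U. f x = y})"
      by (intro nn_integral_count_space_subset_mono) (use gK EU in fastforce)
    finally show ?thesis .
  qed
  have "(\<lambda>y. \<Sum>k. \<psi> (g k y) * indicator (f ` E k) y) \<in> borel_measurable borel" by measurable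
  then show ?thesis using le fibre by (intro bexI[of _ "\<lambda>y. \<Sum>k. \<psi> (g k y) * indicator (f ` E k) y"]) auto
qed

section \<open>Multiplicative functions of matrices\<close>

text \<open>The identity with one column replaced. This single family contains the dilations of a
  coordinate (\<open>c = axis j d\<close>) and the transvections, and it is closed under products
  with the same \<open>j\<close>.\<close>

definition col_mat :: "'n \<Rightarrow> 'a::field ^ 'n \<Rightarrow> 'a ^ 'n ^ 'n" where
  "col_mat j c = (\<chi> i k. if k = j then c $ i else of_bool (i = k))"

lemma col_mat_vec: "col_mat j c *v x = x + x $ j *s (c - axis j 1)"
proof (simp only: vec_eq_iff, intro allI)
  fix i
  have "(col_mat j c *v x) $ i
      = (\<Sum>k\<in>UNIV. (if k = i then x $ k else 0) + (if k = j then (c $ i - of_bool (i = j)) * x $ k else 0))"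
    unfolding col_mat_def matrix_vector_mult_def by (auto intro!: sum.cong simp: algebra_simps)
  also have "\<dots> = x $ i + (c $ i - of_bool (i = j)) * x $ j"
    by (simp add: sum.distrib)
  finally show "(col_mat j c *v x) $ i = (x + x $ j *s (c - axis j 1)) $ i"
    by (simp add: axis_def mult.commute of_bool_def algebra_simps)
qed

lemma matrix_eqI_vec:
  fixes A B :: "'a::field ^ 'n ^ 'm"
  shows "(\<And>x. A *v x = B *v x) \<Longrightarrow> A = B"
  using arg_cong[of "(*v) A" "(*v) B" matrix] by (auto simp: fun_eq_iff matrix_of_matrix_vector_mul)

lemma axis_nth: "axis k x $ i = (if i = k then x else 0)"
  by (simp add: axis_def)

lemma matrix_vector_mult_axis:
  fixes A :: "'a::field ^ 'n ^ 'm"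
  shows "A *v axis k 1 = column k A"
proof (simp only: vec_eq_iff, intro allI)
  fix i
  have "(A *v axis k 1) $ i = (\<Sum>j\<in>UNIV. if j = k then A $ i $ j else 0)"
    by (simp add: matrix_vector_mult_def axis_nth if_distrib[of "\<lambda>t. _ * t"] cong: if_cong)
  then show "(A *v axis k 1) $ i = column k A $ i" by (simp add: column_def)
qed

lemma col_mat_mult: "col_mat j c ** col_mat j d = col_mat j (col_mat j c *v d)"
  by (rule matrix_eqI_vec)
     (auto simp: matrix_vector_mul_assoc[symmetric] col_mat_vec vec_eq_iff axis_def algebra_simps)

lemma col_mat_axis: "col_mat j (axis j 1) = mat 1"
  by (auto simp: col_mat_def mat_def axis_def vec_eq_iff)

text \<open>On invertible matrices such an \<open>F\<close> is \<open>\<rho>\<close> of the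
  determinant. This evaluates Jacobians of maps given by a complex matrix without expanding a real
  determinant: only the effect of scaling one row has to be found.\<close>

locale multiplicative_matrix_fun =
  fixes F :: "'a::{field_char_0} ^ 'n ^ 'n \<Rightarrow> 'b::field" and \<rho> :: "'a \<Rightarrow> 'b"
  assumes mult: "F (A ** B) = F A * F B" and one: "F (mat 1) = 1"
    and diag: "d \<noteq> 0 \<Longrightarrow> F (col_mat j (axis j d)) = \<rho> d"
    and \<rho>_mult: "a \<noteq> 0 \<Longrightarrow> b \<noteq> 0 \<Longrightarrow> \<rho> (a * b) = \<rho> a * \<rho> b"
begin

text \<open>The square of a unipotent column matrix is conjugate to it by a diagonal matrix, so \<open>F\<close> is idempotent there.\<close>
lemma col_mat_unipotent:
  assumes "c $ j = 1" shows "F (col_mat j c) = 1"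
proof -
  have "\<rho> 2 * \<rho> (1/2) = 1"
    using \<rho>_mult[of 2 "1/2"] diag[of 1] one by (simp add: col_mat_axis)
  moreover have "col_mat j c ** col_mat j c = col_mat j (axis j (1/2)) ** (col_mat j c ** col_mat j (axis j 2))"
  proof -
    have "col_mat j c *v c = col_mat j (axis j (1/2)) *v (col_mat j c *v axis j 2)"
      using assms by (simp add: col_mat_vec vec_eq_iff axis_nth)
    then show ?thesis by (simp add: col_mat_mult)
  qed
  then have "F (col_mat j c ** col_mat j c) = F (col_mat j (axis j (1/2)) ** (col_mat j c ** col_mat j (axis j 2)))"
    by (rule arg_cong)
  then have "F (col_mat j c) * F (col_mat j c) = \<rho> (1/2) * (F (col_mat j c) * \<rho> 2)"
    using diag[of "1/2" j] diag[of 2 j] by (simp add: mult)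
  ultimately have "F (col_mat j c) * F (col_mat j c) = F (col_mat j c)"
    by (simp add: mult_ac)
  moreover have "col_mat j c ** col_mat j (2 *s axis j 1 - c) = mat 1"
  proof -
    have "col_mat j c *v (2 *s axis j 1 - c) = axis j 1"
      using assms by (simp add: col_mat_vec vec_eq_iff axis_nth)
    then show ?thesis by (simp add: col_mat_mult col_mat_axis)
  qed
  then have "F (col_mat j c) \<noteq> 0" using mult[of "col_mat j c"] one by (metis mult_zero_left zero_neq_one)
  ultimately show ?thesis by simp
qed

lemma col_mat:
  assumes "c $ j \<noteq> 0" shows "F (col_mat j c) = \<rho> (c $ j)"
proof -
  define c' where "c' = (1 / c $ j) *s c"
  have "col_mat j c = col_mat j c' ** col_mat j (axis j (c $ j))"
  proof -
    have "c = col_mat j c' *v axis j (c $ j)"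
      using assms by (simp add: col_mat_vec c'_def vec_eq_iff axis_nth)
    then show ?thesis by (simp add: col_mat_mult)
  qed
  then show ?thesis using mult diag assms col_mat_unipotent[of c' j] by (simp add: c'_def)
qed

end

text \<open>The determinant is an instance itself. This yields the determinants of column matrices,
  which the elimination in \<open>eq_det\<close> keeps track of.\<close>

interpretation det: multiplicative_matrix_fun "det :: 'a::field_char_0 ^ 'n ^ 'n \<Rightarrow> 'a" "\<lambda>d. d"
proof
  fix j :: 'n and d :: 'a
  have "det (col_mat j (axis j d)) = (\<Prod>i\<in>UNIV. if i = j then d else 1)"
  proof (subst det_diagonal)
    show "(\<Prod>i\<in>UNIV. col_mat j (axis j d) $ i $ i) = (\<Prod>i\<in>UNIV. if i = j then d else 1)"
      by (intro prod.cong refl) (simp add: col_mat_def axis_nth)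
  qed (auto simp: col_mat_def axis_nth)
  then show "det (col_mat j (axis j d)) = d" by simp
qed (auto simp: det_mul)

text \<open>Gaussian elimination, by induction on a set \<open>L\<close> of columns outside of which
  \<open>A\<close> agrees with the identity. A nonzero pivot lets column \<open>j\<close> be split
  off as a \<open>col_mat\<close> factor. A zero pivot is repaired by a transvection adding row
  \<open>i\<close> to row \<open>j\<close>, at which both \<open>F\<close> and the determinant equal
  1.\<close>

lemma (in multiplicative_matrix_fun) eq_det:
  assumes "det A \<noteq> 0" shows "F A = \<rho> (det A)"
proof -
  have "F A = \<rho> (det A)"
    if "finite L" "det A \<noteq> 0" "\<And>k. k \<notin> L \<Longrightarrow> A *v axis k 1 = axis k 1" for L and A :: "'a ^ 'n ^ 'n"
    using that
  proof (induction L arbitrary: A rule: finite_induct)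
    case empty
    have "A $ i $ k = (mat 1 :: 'a ^ 'n ^ 'n) $ i $ k" for i k
    proof -
      have "A $ i $ k = (A *v axis k 1) $ i" by (simp add: matrix_vector_mult_axis column_def)
      then show ?thesis using empty by (simp add: axis_nth mat_def)
    qed
    then have "A = mat 1" by (simp add: vec_eq_iff)
    then show ?case using diag[of 1] one by (simp add: col_mat_axis)
  next
    case (insert j L)
    have pivot: "F A = \<rho> (det A)" if det: "det A \<noteq> 0" and jj: "A $ j $ j \<noteq> 0"
      and std: "\<And>k. k \<notin> insert j L \<Longrightarrow> A *v axis k 1 = axis k 1" for A :: "'a ^ 'n ^ 'n"
    proof -
      define C where "C = col_mat j (A *v axis j 1)"
      have C: "F C = \<rho> (A $ j $ j)" "det C = A $ j $ j"
        unfolding C_def using jj col_mat[of "A *v axis j 1" j] det.col_mat[of "A *v axis j 1" j]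
        by (auto simp: matrix_vector_mult_axis column_def)
      obtain C' where C': "C' ** C = mat 1" "C ** C' = mat 1"
        using C(2) jj invertible_det_nz[of C] by (auto simp: invertible_def)
      define A' where "A' = C' ** A"
      have A: "A = C ** A'" by (simp add: A'_def matrix_mul_assoc C')
      have "det A' \<noteq> 0" using det A by (auto simp: det_mul)
      moreover have "A' *v axis k 1 = axis k 1" if "k \<notin> L" for k
      proof -
        have "A *v axis k 1 = C *v axis k 1"
          using that std[of k] by (cases "k = j") (auto simp: C_def col_mat_vec axis_def vec_eq_iff)
        then show ?thesis by (simp add: A'_def matrix_vector_mul_assoc[symmetric])
          (simp add: matrix_vector_mul_assoc C')
      qed
      ultimately have "F A' = \<rho> (det A')" by (intro insert.IH) auto
      then show ?thesis using C jj \<open>det A' \<noteq> 0\<close> unfolding A by (simp add: mult det_mul \<rho>_mult)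
    qed
    show ?case
    proof (cases "A $ j $ j = 0")
      case True
      have "\<exists>i\<in>L. A $ i $ j \<noteq> 0"
      proof (rule ccontr)
        assume "\<not> (\<exists>i\<in>L. A $ i $ j \<noteq> 0)"
        then have z: "A $ i $ j = 0" if "i \<in> insert j L" for i using that True by auto
        \<comment> \<open>Column \<open>j\<close> would be supported outside
          \<open>insert j L\<close>, where the columns of \<open>A\<close> are standard basis
          vectors. \<open>x\<close> records this linear dependence as a kernel vector.\<close>
        define x where "x = axis j 1 - (\<chi> i. of_bool (i \<notin> insert j L) * A $ i $ j)"
        have "A *v x = 0"
        proof (simp only: vec_eq_iff, intro allI)
          fix i
          have e: "A $ i $ k = of_bool (i = k)" if "k \<notin> insert j L" for k
            using insert.prems(2)[OF that] matrix_vector_mult_axis[of A k]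
            by (simp add: column_def vec_eq_iff axis_nth)
          have "(A *v x) $ i = A $ i $ j - (\<Sum>k\<in>UNIV. A $ i $ k * (of_bool (k \<notin> insert j L) * A $ k $ j))"
            unfolding x_def matrix_vector_mult_diff_distrib matrix_vector_mult_axis
            by (simp add: column_def matrix_vector_mult_def)
          also have "(\<Sum>k\<in>UNIV. A $ i $ k * (of_bool (k \<notin> insert j L) * A $ k $ j))
              = (\<Sum>k\<in>UNIV. if k = i then of_bool (k \<notin> insert j L) * A $ k $ j else 0)"
          proof (intro sum.cong refl)
            fix k show "A $ i $ k * (of_bool (k \<notin> insert j L) * A $ k $ j)
                = (if k = i then of_bool (k \<notin> insert j L) * A $ k $ j else 0)"
              using e[of k] by (cases "k \<in> insert j L") auto
          qed
          finally show "(A *v x) $ i = 0 $ i" using z by (auto simp: of_bool_def)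
        qed
        moreover have "x $ j = 1" by (simp add: x_def)
        ultimately show False
        proof -
          obtain A' where "A' ** A = mat 1"
            using insert.prems(1) invertible_det_nz[of A] by (auto simp: invertible_def)
          then have "x = A' *v (A *v x)" by (simp add: matrix_vector_mul_assoc)
          then have "x = 0" using \<open>A *v x = 0\<close> by simp
          then show False using \<open>x $ j = 1\<close> by simp
        qed
      qed
      then obtain i where i: "i \<in> L" "A $ i $ j \<noteq> 0" by blast
      then have ij: "i \<noteq> j" using True by auto
      define T where "T = col_mat i (axis i 1 + axis j (1::'a))"
      have T: "F T = 1" "det T = 1"
        unfolding T_def using ij by (auto intro!: col_mat_unipotent det.col_mat_unipotent simp: axis_def)
      have TA: "(T ** A) *v x = A *v x + (A *v x) $ i *s axis j 1" for x
        by (simp add: matrix_vector_mul_assoc[symmetric] T_def col_mat_vec)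
      have "(T ** A) $ j $ j = ((T ** A) *v axis j 1) $ j"
        by (simp add: matrix_vector_mult_axis column_def)
      also have "\<dots> = A $ i $ j"
        unfolding TA using True by (simp add: matrix_vector_mult_axis column_def)
      finally have "(T ** A) $ j $ j \<noteq> 0" using i by simp
      moreover have "(T ** A) *v axis k 1 = axis k 1" if "k \<notin> insert j L" for k
        using insert.prems(2)[OF that] that i unfolding TA by (auto simp: axis_def vec_eq_iff)
      ultimately have "F (T ** A) = \<rho> (det (T ** A))"
        using T insert.prems(1) by (intro pivot) (auto simp: det_mul)
      then show ?thesis using T by (simp add: mult det_mul)
    qed (use pivot insert.prems in blast)
  qed
  from this[of UNIV A] show ?thesis using assms by simp
qed

section \<open>Gaussian integrals\<close>

lemma nn_integral_gaussian_real:
  assumes "c > 0"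
  shows "(\<integral>\<^sup>+x. ennreal (exp (- (c * x\<^sup>2))) \<partial>lborel) = ennreal (sqrt (pi / c))"
proof -
  define \<sigma> where "\<sigma> = sqrt (1 / (2 * c))"
  have \<sigma>: "\<sigma> > 0" "\<sigma>\<^sup>2 = 1 / (2 * c)" using assms by (auto simp: \<sigma>_def)
  have e: "exp (- (c * x\<^sup>2)) = sqrt (pi / c) * normal_density 0 \<sigma> x" for x
    using assms by (simp add: normal_density_def \<sigma>(2))
  have "(\<integral>\<^sup>+x. ennreal (normal_density 0 \<sigma> x) \<partial>lborel) = 1"
    using prob_space.emeasure_space_1[OF prob_space_normal_density[OF \<sigma>(1), of 0]]
    by (simp add: emeasure_density)
  then show ?thesis
    unfolding e using assms by (simp add: ennreal_mult nn_integral_cmult)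
qed

lemma norm_power2_Basis: "(norm x)\<^sup>2 = (\<Sum>b\<in>Basis. (x \<bullet> b)\<^sup>2)" for x :: "'a::euclidean_space"
  unfolding power2_norm_eq_inner by (subst euclidean_inner) (simp add: power2_eq_square)

lemma bij_betw_axis_Basis:
  "bij_betw (\<lambda>(i, u). axis i u) (UNIV \<times> Basis) (Basis :: ('a::euclidean_space ^ 'n) set)"
  by (auto simp: bij_betw_def inj_on_def Basis_vec_def axis_eq_axis)

text \<open>Separate weights for the entries are what \<open>jac_row_scale\<close> needs, where the
  Jacobian of a scaling is read off from a Gaussian integral.\<close>

lemma nn_integral_gaussian_vec:
  fixes w :: "'n::finite \<Rightarrow> real"
  assumes w: "\<And>i. w i > 0"
  shows "(\<integral>\<^sup>+x. ennreal (exp (- (\<Sum>i\<in>UNIV. w i * (norm (x $ i))\<^sup>2))) \<partial>(lborel :: ('a::euclidean_space ^ 'n) measure))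
    = ennreal (\<Prod>i\<in>UNIV. sqrt (pi / w i) ^ DIM('a))"
proof -
  let ?ax = "\<lambda>(i, u). axis i u :: 'a ^ 'n"
  define W where "W b = w (fst (inv_into (UNIV \<times> Basis) ?ax b))" for b
  have W: "W (axis i u) = w i" if "u \<in> Basis" for i u
    using inv_into_f_f[OF bij_betw_imp_inj_on[OF bij_betw_axis_Basis], of "(i, u)"] that by (simp add: W_def)
  have W_pos: "W b > 0" for b using w by (simp add: W_def)
  have reindex: "(\<Prod>b\<in>Basis. F b) = (\<Prod>i\<in>UNIV. \<Prod>u\<in>Basis. F (axis i u))" for F :: "'a ^ 'n \<Rightarrow> real"
    using prod.reindex_bij_betw[OF bij_betw_axis_Basis, of F]
    by (simp add: prod.cartesian_product case_prod_unfold)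
  have e: "exp (- (\<Sum>i\<in>UNIV. w i * (norm (x $ i))\<^sup>2)) = (\<Prod>b\<in>Basis. exp (- (W b * (x \<bullet> b)\<^sup>2)))" for x :: "'a ^ 'n"
  proof -
    have "(norm (x $ i))\<^sup>2 = (\<Sum>u\<in>Basis. (x $ i \<bullet> u)\<^sup>2)" for i
      by (rule norm_power2_Basis)
    then show ?thesis
      by (simp add: reindex W exp_sum[symmetric] sum_negf sum_distrib_left inner_axis)
  qed
  have "(\<integral>\<^sup>+x. ennreal (exp (- (\<Sum>i\<in>UNIV. w i * (norm (x $ i))\<^sup>2))) \<partial>(lborel :: ('a ^ 'n) measure))
    = (\<integral>\<^sup>+x. (\<Prod>b\<in>Basis. ennreal (exp (- (W b * (x \<bullet> b)\<^sup>2)))) \<partial>(lborel :: ('a ^ 'n) measure))"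
    by (simp add: e prod_ennreal)
  also have "\<dots> = (\<Prod>b\<in>Basis. \<integral>\<^sup>+t. ennreal (exp (- (W b * t\<^sup>2))) \<partial>lborel)"
    by (rule nn_integral_lborel_prod) auto
  also have "\<dots> = (\<Prod>b\<in>(Basis :: ('a ^ 'n) set). ennreal (sqrt (pi / W b)))"
    using w by (intro prod.cong refl nn_integral_gaussian_real) (auto simp: W_def)
  also have "\<dots> = ennreal (\<Prod>i\<in>UNIV. sqrt (pi / w i) ^ DIM('a))"
    using less_imp_le[OF W_pos] by (subst prod_ennreal) (auto simp: reindex W)
  finally show ?thesis .
qed

lemma nn_integral_gaussian_euclidean:
  assumes "c > 0"
  shows "(\<integral>\<^sup>+x. ennreal (exp (- (c * (norm x)\<^sup>2))) \<partial>(lborel :: 'a::euclidean_space measure))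
    = ennreal (sqrt (pi / c) ^ DIM('a))"
proof -
  have e: "exp (- (c * (norm x)\<^sup>2)) = (\<Prod>b\<in>Basis. exp (- (c * (x \<bullet> b)\<^sup>2)))" for x :: 'a
    by (simp add: norm_power2_Basis
        exp_sum[symmetric] sum_negf sum_distrib_left)
  have "(\<integral>\<^sup>+x. ennreal (exp (- (c * (norm x)\<^sup>2))) \<partial>(lborel :: 'a measure))
    = (\<integral>\<^sup>+x. (\<Prod>b\<in>Basis. ennreal (exp (- (c * (x \<bullet> b)\<^sup>2)))) \<partial>(lborel :: 'a measure))"
    by (simp add: e prod_ennreal)
  also have "\<dots> = (\<Prod>b\<in>(Basis :: 'a set). \<integral>\<^sup>+t. ennreal (exp (- (c * t\<^sup>2))) \<partial>lborel)"
    by (rule nn_integral_lborel_prod) auto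
  finally show ?thesis using assms by (simp add: nn_integral_gaussian_real ennreal_power)
qed

lemma nn_integral_gaussian_moment_real:
  "(\<integral>\<^sup>+x. ennreal (x\<^sup>2 * exp (- x\<^sup>2)) \<partial>lborel) = ennreal (sqrt pi / 2)"
proof -
  have "has_bochner_integral lborel (\<lambda>x. std_normal_density x * x ^ (2 * 1)) (fact (2 * 1) / (2 ^ 1 * fact 1))"
    by (rule std_normal_moment_even)
  then have m: "(\<integral>\<^sup>+x. ennreal (std_normal_density x * x\<^sup>2) \<partial>lborel) = 1"
    by (subst nn_integral_eq_integral) (auto simp: has_bochner_integral_iff)
  have "(\<integral>\<^sup>+x. ennreal (std_normal_density x * x\<^sup>2) \<partial>lborel)
      = ennreal (sqrt 2) * (\<integral>\<^sup>+x. ennreal (std_normal_density (sqrt 2 * x) * (sqrt 2 * x)\<^sup>2) \<partial>lborel)"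
    by (subst nn_integral_real_affine[where c = "sqrt 2" and t = 0]) auto
  also have "(\<integral>\<^sup>+x. ennreal (std_normal_density (sqrt 2 * x) * (sqrt 2 * x)\<^sup>2) \<partial>lborel)
      = (\<integral>\<^sup>+x. ennreal (2 / sqrt (2 * pi)) * ennreal (x\<^sup>2 * exp (- x\<^sup>2)) \<partial>lborel)"
    by (intro nn_integral_cong)
       (simp add: std_normal_density_def power_mult_distrib ennreal_mult[symmetric] mult_ac)
  also have "\<dots> = ennreal (2 / sqrt (2 * pi)) * (\<integral>\<^sup>+x. ennreal (x\<^sup>2 * exp (- x\<^sup>2)) \<partial>lborel)"
    by (intro nn_integral_cmult) auto
  finally have "ennreal (2 / sqrt pi) * (\<integral>\<^sup>+x. ennreal (x\<^sup>2 * exp (- x\<^sup>2)) \<partial>lborel) = 1"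
    using m by (simp add: mult.assoc[symmetric] ennreal_mult[symmetric] real_sqrt_mult)
  then have "ennreal (sqrt pi / 2) * (ennreal (2 / sqrt pi) * (\<integral>\<^sup>+x. ennreal (x\<^sup>2 * exp (- x\<^sup>2)) \<partial>lborel))
      = ennreal (sqrt pi / 2)" by simp
  then show ?thesis by (simp add: mult.assoc[symmetric] ennreal_mult[symmetric])
qed

lemma nn_integral_gaussian_moment:
  fixes b :: "'a::euclidean_space"
  assumes b: "b \<in> Basis"
  shows "(\<integral>\<^sup>+x. ennreal ((x \<bullet> b)\<^sup>2 * exp (- (norm x)\<^sup>2)) \<partial>lborel) = ennreal (sqrt pi ^ DIM('a) / 2)"
proof -
  have e: "(x \<bullet> b)\<^sup>2 * exp (- (norm x)\<^sup>2) = (\<Prod>c\<in>Basis. (if c = b then (x \<bullet> c)\<^sup>2 else 1) * exp (- (x \<bullet> c)\<^sup>2))" for x :: 'a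
    using b by (simp add: norm_power2_Basis
        exp_sum[symmetric] sum_negf prod.distrib)
  have "(\<integral>\<^sup>+x. ennreal ((x \<bullet> b)\<^sup>2 * exp (- (norm x)\<^sup>2)) \<partial>lborel)
    = (\<integral>\<^sup>+x. (\<Prod>c\<in>Basis. ennreal ((if c = b then (x \<bullet> c)\<^sup>2 else 1) * exp (- (x \<bullet> c)\<^sup>2))) \<partial>lborel)"
    by (simp add: e prod_ennreal)
  also have "\<dots> = (\<Prod>c\<in>(Basis :: 'a set). \<integral>\<^sup>+t. ennreal ((if c = b then t\<^sup>2 else 1) * exp (- t\<^sup>2)) \<partial>lborel)"
    by (rule nn_integral_lborel_prod) auto
  also have "\<dots> = (\<Prod>c\<in>(Basis :: 'a set). ennreal (sqrt pi * (if c = b then 1 / 2 else 1)))"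
    using nn_integral_gaussian_real[of 1] by (intro prod.cong refl) (auto simp: nn_integral_gaussian_moment_real)
  also have "\<dots> = ennreal (sqrt pi ^ DIM('a) / 2)"
    using b by (subst prod_ennreal) (auto simp: prod.distrib)
  finally show ?thesis .
qed

section \<open>Jacobians of matrix maps\<close>

lemma nn_integral_gaussian_pos_finite:
  "0 < (\<integral>\<^sup>+x. ennreal (exp (- (norm x)\<^sup>2)) \<partial>(lborel :: 'a::euclidean_space measure))"
  "(\<integral>\<^sup>+x. ennreal (exp (- (norm x)\<^sup>2)) \<partial>(lborel :: 'a::euclidean_space measure)) < \<infinity>"
  using nn_integral_gaussian_euclidean[of 1, where 'a = 'a] by (auto simp: ennreal_zero_less_one)

text \<open>One test function with positive finite integral fixes the factor in the change of
  variables, and the Gaussian is such a function. Finiteness is what permits cancellation in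
  \<open>ennreal\<close>.\<close>

lemma jac_eqI:
  fixes f :: "'a::euclidean_space \<Rightarrow> 'a"
  assumes f: "linear f" "inj f" and c: "c \<ge> 0"
    and eq: "\<And>h. h \<in> borel_measurable borel \<Longrightarrow>
      (\<integral>\<^sup>+x. h x \<partial>lborel) = ennreal c * (\<integral>\<^sup>+x. h (f x) \<partial>lborel)"
  shows "jac f = c"
proof -
  let ?h = "\<lambda>x :: 'a. ennreal (exp (- (norm x)\<^sup>2))"
  let ?I = "\<integral>\<^sup>+x. ?h (f x) \<partial>lborel"
  have I: "(\<integral>\<^sup>+x. ?h x \<partial>lborel) = ennreal (jac f) * ?I"
    using nn_integral_linear[OF f, of ?h] by simp
  have J: "ennreal (jac f) * ?I = ennreal c * ?I"
    using eq[of ?h] I by simp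
  have "?I \<noteq> 0" "?I \<noteq> \<top>"
    using I nn_integral_gaussian_pos_finite[where 'a = 'a] jac_pos[OF f] by (auto simp: ennreal_mult_top)
  then obtain r where "?I = ennreal r" "r > 0"
    by (cases "?I") (auto simp: less_le)
  then show ?thesis using J c by (simp add: ennreal_mult[symmetric])
qed

text \<open>The Gaussian weight depends on the norm only, so its integral is unchanged, and being
  positive and finite it can be cancelled.\<close>

lemma jac_isometry:
  fixes f :: "'a::euclidean_space \<Rightarrow> 'a"
  assumes f: "linear f" and n: "\<And>x. norm (f x) = norm x"
  shows "jac f = 1"
proof -
  have i: "inj f" using n linear_injective_0[OF f] by (metis norm_eq_zero)
  let ?h = "\<lambda>x :: 'a. ennreal (exp (- (norm x)\<^sup>2))"
  let ?I = "\<integral>\<^sup>+x. ?h x \<partial>(lborel :: 'a measure)"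
  have "?I = ennreal (jac f) * ?I"
    using nn_integral_linear[OF f i, of ?h] n by simp
  moreover obtain r where "?I = ennreal r" "r > 0"
    using nn_integral_gaussian_pos_finite[where 'a = 'a] by (cases ?I) auto
  ultimately show ?thesis by (simp add: ennreal_mult[symmetric])
qed

lemma nn_integral_isometry:
  fixes f :: "'a::euclidean_space \<Rightarrow> 'a" and h :: "'a \<Rightarrow> ennreal"
  assumes f: "linear f" and n: "\<And>x. norm (f x) = norm x" and h: "h \<in> borel_measurable borel"
  shows "(\<integral>\<^sup>+x. h (f x) \<partial>lborel) = (\<integral>\<^sup>+x. h x \<partial>lborel)"
proof -
  have "inj f" using n linear_injective_0[OF f] by (metis norm_eq_zero)
  then show ?thesis using nn_integral_linear[OF f _ h] jac_isometry[OF f n] by simp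
qed

lemma nn_integral_translate:
  fixes h :: "'a::euclidean_space \<Rightarrow> ennreal"
  assumes [measurable]: "h \<in> borel_measurable borel"
  shows "(\<integral>\<^sup>+x. h (x + a) \<partial>lborel) = (\<integral>\<^sup>+x. h x \<partial>lborel)"
proof -
  have "(\<integral>\<^sup>+x. h x \<partial>lborel) = (\<integral>\<^sup>+x. h x \<partial>(distr lborel borel ((+) a)))"
    using lborel_distr_plus[of a] by simp
  then show ?thesis by (simp add: nn_integral_distr add.commute)
qed

lemma nn_integral_affine:
  fixes f :: "'a::euclidean_space \<Rightarrow> 'a" and h :: "'a \<Rightarrow> ennreal"
  assumes f: "linear f" "inj f" and h [measurable]: "h \<in> borel_measurable borel"
  shows "(\<integral>\<^sup>+x. h x \<partial>lborel) = ennreal (jac f) * (\<integral>\<^sup>+x. h (f x + a) \<partial>lborel)"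
  using nn_integral_linear[OF f, of "\<lambda>x. h (x + a)"] nn_integral_translate[OF h, of a] by simp

lemma nn_integral_lborel_prod_iter:
  fixes h :: "'a::euclidean_space \<times> 'b::euclidean_space \<Rightarrow> ennreal"
  assumes [measurable]: "h \<in> borel_measurable borel"
  shows "(\<integral>\<^sup>+p. h p \<partial>lborel) = (\<integral>\<^sup>+y. \<integral>\<^sup>+x. h (x, y) \<partial>lborel \<partial>lborel)"
    and "(\<integral>\<^sup>+p. h p \<partial>lborel) = (\<integral>\<^sup>+x. \<integral>\<^sup>+y. h (x, y) \<partial>lborel \<partial>lborel)"
proof -
  have m: "h \<in> borel_measurable (lborel \<Otimes>\<^sub>M lborel)" by (simp add: lborel_prod)
  show "(\<integral>\<^sup>+p. h p \<partial>lborel) = (\<integral>\<^sup>+y. \<integral>\<^sup>+x. h (x, y) \<partial>lborel \<partial>lborel)"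
    using lborel_pair.nn_integral_snd[OF m] by (simp add: lborel_prod)
  show "(\<integral>\<^sup>+p. h p \<partial>lborel) = (\<integral>\<^sup>+x. \<integral>\<^sup>+y. h (x, y) \<partial>lborel \<partial>lborel)"
    using lborel.nn_integral_fst[OF m] by (simp add: lborel_prod)
qed

text \<open>Fubini: for fixed \<open>x\<close> the term \<open>q x\<close> merely translates the
  inner variable.\<close>

lemma jac_triangular:
  fixes p :: "'a::euclidean_space \<Rightarrow> 'a" and g :: "'b::euclidean_space \<Rightarrow> 'b"
  assumes p: "linear p" "inj p" and g: "linear g" "inj g" and q: "linear q"
  shows "jac (\<lambda>(a, x). (p a + q x, g x)) = jac p * jac g" (is "jac ?F = _")
proof (rule jac_eqI)
  note [measurable] = linear_borel_measurable[OF p(1)] linear_borel_measurable[OF g(1)] linear_borel_measurable[OF q]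
  show lin: "linear ?F"
    by (rule linearI) (auto simp: linear_add[OF p(1)] linear_add[OF g(1)] linear_add[OF q]
        linear_cmul[OF p(1)] linear_cmul[OF g(1)] linear_cmul[OF q] algebra_simps)
  show "inj ?F" by (rule injI) (auto dest!: injD[OF p(2)] injD[OF g(2)])
  fix h :: "'a \<times> 'b \<Rightarrow> ennreal" assume h [measurable]: "h \<in> borel_measurable borel"
  have h' [measurable]: "h \<in> borel_measurable (borel \<Otimes>\<^sub>M borel)" by (simp add: borel_prod)
  have Fm: "?F \<in> borel \<rightarrow>\<^sub>M borel" by (rule linear_borel_measurable[OF lin])
  have "(\<integral>\<^sup>+x. h (?F x) \<partial>lborel) = (\<integral>\<^sup>+x. \<integral>\<^sup>+a. h (p a + q x, g x) \<partial>lborel \<partial>lborel)"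
    using measurable_compose[OF Fm h] by (subst nn_integral_lborel_prod_iter(1)) (auto simp: case_prod_unfold)
  then have "ennreal (jac p * jac g) * (\<integral>\<^sup>+x. h (?F x) \<partial>lborel)
      = ennreal (jac g) * (\<integral>\<^sup>+x. ennreal (jac p) * (\<integral>\<^sup>+a. h (p a + q x, g x) \<partial>lborel) \<partial>lborel)"
    by (subst nn_integral_cmult) (auto simp: ennreal_mult mult_ac)
  also have "\<dots> = ennreal (jac g) * (\<integral>\<^sup>+x. \<integral>\<^sup>+a. h (a, g x) \<partial>lborel \<partial>lborel)"
    using nn_integral_affine[OF p, of "\<lambda>a. h (a, g _)" "q _"] by simp
  also have "\<dots> = (\<integral>\<^sup>+x. \<integral>\<^sup>+a. h (a, x) \<partial>lborel \<partial>lborel)"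
    by (subst nn_integral_linear[OF g, of "\<lambda>x. \<integral>\<^sup>+a. h (a, x) \<partial>lborel"]) auto
  also have "\<dots> = (\<integral>\<^sup>+x. h x \<partial>lborel)"
    by (subst nn_integral_lborel_prod_iter(1)) auto
  finally show "(\<integral>\<^sup>+x. h x \<partial>lborel) = ennreal (jac p * jac g) * (\<integral>\<^sup>+x. h (?F x) \<partial>lborel)" by simp
qed simp

lemma jac_triangular':
  fixes p :: "'a::euclidean_space \<Rightarrow> 'a" and g :: "'b::euclidean_space \<Rightarrow> 'b"
  assumes p: "linear p" "inj p" and g: "linear g" "inj g" and q: "linear q"
  shows "jac (\<lambda>(a, x). (p a, g x + q a)) = jac p * jac g" (is "jac ?F = _")
proof (rule jac_eqI)
  note [measurable] = linear_borel_measurable[OF p(1)] linear_borel_measurable[OF g(1)] linear_borel_measurable[OF q]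
  show lin: "linear ?F"
    by (rule linearI) (auto simp: linear_add[OF p(1)] linear_add[OF g(1)] linear_add[OF q]
        linear_cmul[OF p(1)] linear_cmul[OF g(1)] linear_cmul[OF q] algebra_simps)
  show "inj ?F" by (rule injI) (auto dest!: injD[OF p(2)] injD[OF g(2)])
  fix h :: "'a \<times> 'b \<Rightarrow> ennreal" assume h [measurable]: "h \<in> borel_measurable borel"
  have h' [measurable]: "h \<in> borel_measurable (borel \<Otimes>\<^sub>M borel)" by (simp add: borel_prod)
  have Fm: "?F \<in> borel \<rightarrow>\<^sub>M borel" by (rule linear_borel_measurable[OF lin])
  have "(\<integral>\<^sup>+x. h (?F x) \<partial>lborel) = (\<integral>\<^sup>+a. \<integral>\<^sup>+x. h (p a, g x + q a) \<partial>lborel \<partial>lborel)"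
    using measurable_compose[OF Fm h] by (subst nn_integral_lborel_prod_iter(2)) (auto simp: case_prod_unfold)
  then have "ennreal (jac p * jac g) * (\<integral>\<^sup>+x. h (?F x) \<partial>lborel)
      = ennreal (jac p) * (\<integral>\<^sup>+a. ennreal (jac g) * (\<integral>\<^sup>+x. h (p a, g x + q a) \<partial>lborel) \<partial>lborel)"
    by (subst nn_integral_cmult) (auto simp: ennreal_mult mult_ac)
  also have "\<dots> = ennreal (jac p) * (\<integral>\<^sup>+a. \<integral>\<^sup>+x. h (p a, x) \<partial>lborel \<partial>lborel)"
    using nn_integral_affine[OF g, of "\<lambda>x. h (p _, x)" "q _"] by simp
  also have "\<dots> = (\<integral>\<^sup>+a. \<integral>\<^sup>+x. h (a, x) \<partial>lborel \<partial>lborel)"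
    by (subst nn_integral_linear[OF p, of "\<lambda>a. \<integral>\<^sup>+x. h (a, x) \<partial>lborel"]) auto
  also have "\<dots> = (\<integral>\<^sup>+x. h x \<partial>lborel)"
    by (subst nn_integral_lborel_prod_iter(2)) auto
  finally show "(\<integral>\<^sup>+x. h x \<partial>lborel) = ennreal (jac p * jac g) * (\<integral>\<^sup>+x. h (?F x) \<partial>lborel)" by simp
qed simp

section \<open>Jacobians of multiplication by a complex matrix\<close>

lemma linear_matrix_mult_left: "linear (\<lambda>N. A ** N :: complex ^ 'k ^ 'm)"
  by (rule linearI) (auto simp: matrix_matrix_mult_def vec_eq_iff algebra_simps sum.distrib scaleR_sum_right)

lemma linear_matrix_mult_right: "linear (\<lambda>N. N ** A :: complex ^ 'k ^ 'm)"
  by (rule linearI) (auto simp: matrix_matrix_mult_def vec_eq_iff algebra_simps sum.distrib scaleR_sum_right)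

lemma linear_matrix_vector: "linear (\<lambda>x. A *v x :: complex ^ 'm)"
  by (rule linearI) (auto simp: matrix_vector_mult_def vec_eq_iff algebra_simps sum.distrib scaleR_sum_right)

lemma DIM_complex_vec: "DIM(complex ^ 'k) = 2 * CARD('k)"
  by (simp add: DIM_cart mult.commute)

text \<open>Only row norms are prescribed, so multiplying a row by a complex number of modulus
  \<open>d\<close> qualifies without separating its phase. The Gaussian integrals before and after
  the scaling determine the factor.\<close>

lemma jac_row_scale:
  fixes f :: "('a::euclidean_space ^ 'n) \<Rightarrow> 'a ^ 'n"
  assumes lin: "linear f" and d: "d > 0"
    and n: "\<And>x i. norm (f x $ i) = (if i = j then d else 1) * norm (x $ i)"
  shows "jac f = d ^ DIM('a)"
proof -
  have "f x = 0 \<Longrightarrow> x = 0" for x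
  proof -
    assume "f x = 0"
    then have "x $ i = 0" for i using n[of x i] d by (auto split: if_splits)
    then show "x = 0" by (simp add: vec_eq_iff)
  qed
  then have f: "linear f" "inj f" using lin linear_injective_0 by blast+
  let ?h = "\<lambda>x :: 'a ^ 'n. ennreal (exp (- (norm x)\<^sup>2))"
  have nv: "(norm x)\<^sup>2 = (\<Sum>i\<in>UNIV. (norm (x $ i))\<^sup>2)" for x :: "'a ^ 'n"
    by (simp add: norm_vec_def L2_set_def sum_nonneg)
  have "(\<integral>\<^sup>+x. ?h (f x) \<partial>lborel)
      = (\<integral>\<^sup>+(x :: 'a ^ 'n). ennreal (exp (- (\<Sum>i\<in>UNIV. (if i = j then d\<^sup>2 else 1) * (norm (x $ i))\<^sup>2))) \<partial>lborel)"
    unfolding nv n by (intro nn_integral_cong arg_cong[where f = ennreal] arg_cong[where f = exp]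
        arg_cong[where f = uminus] sum.cong refl) (simp add: power_mult_distrib)
  also have "\<dots> = ennreal (\<Prod>i\<in>UNIV. sqrt (pi / (if i = j then d\<^sup>2 else 1)) ^ DIM('a))"
    using d by (intro nn_integral_gaussian_vec) auto
  also have "(\<Prod>i\<in>UNIV. sqrt (pi / (if i = j then d\<^sup>2 else 1)) ^ DIM('a))
      = (\<Prod>i\<in>(UNIV :: 'n set). sqrt pi ^ DIM('a) * (if i = j then 1 / d ^ DIM('a) else 1))"
    using d by (intro prod.cong refl) (auto simp: real_sqrt_divide power_divide)
  also have "\<dots> = (sqrt pi ^ DIM('a)) ^ CARD('n) / d ^ DIM('a)"
    by (simp add: prod.distrib)
  finally have 1: "(\<integral>\<^sup>+x. ?h (f x) \<partial>lborel) = ennreal ((sqrt pi ^ DIM('a)) ^ CARD('n) / d ^ DIM('a))" .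
  have "(\<integral>\<^sup>+x. ?h x \<partial>lborel) = ennreal (sqrt pi ^ (CARD('n) * DIM('a)))"
    using nn_integral_gaussian_euclidean[of 1, where 'a = "'a ^ 'n"] by (simp add: DIM_cart)
  then have "ennreal ((sqrt pi ^ DIM('a)) ^ CARD('n)) = ennreal (jac f) * ennreal ((sqrt pi ^ DIM('a)) ^ CARD('n) / d ^ DIM('a))"
    using nn_integral_linear[OF f, of ?h] 1 by (simp add: power_mult mult.commute)
  then show ?thesis using d by (simp add: ennreal_mult[symmetric] field_simps)
qed

text \<open>The map acts on each of the \<open>CARD('k)\<close> columns separately, and a complex
  linear map has as real Jacobian the squared modulus of its complex determinant; hence the
  exponent.\<close>

lemma jac_matrix_mult_left:
  fixes A :: "complex ^ 'm ^ 'm"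
  assumes "det A \<noteq> 0"
  shows "jac (\<lambda>N :: complex ^ 'k ^ 'm. A ** N) = cmod (det A) ^ (2 * CARD('k))"
proof -
  interpret multiplicative_matrix_fun "\<lambda>A :: complex ^ 'm ^ 'm. jac (\<lambda>N :: complex ^ 'k ^ 'm. A ** N)"
    "\<lambda>d. cmod d ^ (2 * CARD('k))"
  proof
    fix A B :: "complex ^ 'm ^ 'm"
    have "(\<lambda>N :: complex ^ 'k ^ 'm. (A ** B) ** N) = (\<lambda>N. A ** N) \<circ> (\<lambda>N. B ** N)"
      by (auto simp: matrix_mul_assoc)
    then show "jac (\<lambda>N :: complex ^ 'k ^ 'm. (A ** B) ** N) = jac (\<lambda>N :: complex ^ 'k ^ 'm. A ** N) * jac (\<lambda>N :: complex ^ 'k ^ 'm. B ** N)"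
      using jac_compose[OF linear_matrix_mult_left linear_matrix_mult_left] by metis
  next
    fix d :: complex and j :: 'm
    assume d: "d \<noteq> 0"
    let ?D = "col_mat j (axis j d)"
    have comp: "(?D ** N) $ i = (if i = j then d else 1) *s N $ i" for N :: "complex ^ 'k ^ 'm" and i
    proof -
      have "(?D ** N) $ i $ l = (\<Sum>k\<in>UNIV. if k = i then (if i = j then d else 1) * N $ k $ l else 0)" for l
      proof -
        have "(?D ** N) $ i $ l = (\<Sum>k\<in>UNIV. ?D $ i $ k * N $ k $ l)"
          by (simp add: matrix_matrix_mult_def)
        also have "\<dots> = (\<Sum>k\<in>UNIV. if k = i then (if i = j then d else 1) * N $ k $ l else 0)"
          by (intro sum.cong refl) (auto simp: col_mat_def axis_nth)
        finally show ?thesis .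
      qed
      then show ?thesis by (simp add: vec_eq_iff)
    qed
    have nsc: "norm (c *s x) = cmod c * norm x" for c and x :: "complex ^ 'k"
      by (simp add: norm_vec_def L2_set_def norm_mult power_mult_distrib sum_distrib_left[symmetric] real_sqrt_mult)
    show "jac (\<lambda>N :: complex ^ 'k ^ 'm. ?D ** N) = cmod d ^ (2 * CARD('k))"
      unfolding DIM_complex_vec[symmetric]
    by (rule jac_row_scale[OF linear_matrix_mult_left]) (use d comp nsc in auto)
  qed (auto simp: norm_mult power_mult_distrib)
  show ?thesis using eq_det[OF assms] .
qed

lemma jac_matrix_vector:
  fixes A :: "complex ^ 'm ^ 'm"
  assumes "det A \<noteq> 0"
  shows "jac (\<lambda>x. A *v x) = (cmod (det A))\<^sup>2"
proof -
  interpret multiplicative_matrix_fun "\<lambda>A :: complex ^ 'm ^ 'm. jac (\<lambda>x. A *v x)" "\<lambda>d. (cmod d)\<^sup>2"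
  proof
    fix A B :: "complex ^ 'm ^ 'm"
    have "(\<lambda>x. (A ** B) *v x) = (\<lambda>x. A *v x) \<circ> (\<lambda>x. B *v x)"
      by (auto simp: matrix_vector_mul_assoc)
    then show "jac (\<lambda>x. (A ** B) *v x) = jac (\<lambda>x. A *v x) * jac (\<lambda>x. B *v x)"
      using jac_compose[OF linear_matrix_vector linear_matrix_vector] by metis
  next
    fix d :: complex and j :: 'm
    assume d: "d \<noteq> 0"
    let ?D = "col_mat j (axis j d)"
    have comp: "(?D *v x) $ i = (if i = j then d else 1) * x $ i" for x i
      by (simp add: col_mat_vec axis_nth algebra_simps)
    have "jac (\<lambda>x. ?D *v x) = cmod d ^ DIM(complex)"
    by (rule jac_row_scale[OF linear_matrix_vector]) (use d comp in \<open>auto simp: norm_mult\<close>)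
    then show "jac (\<lambda>x. ?D *v x) = (cmod d)\<^sup>2" by simp
  qed (auto simp: norm_mult power_mult_distrib)
  show ?thesis using eq_det[OF assms] .
qed

lemma norm_transpose: "norm (transpose N) = norm (N :: complex ^ 'k ^ 'm)"
proof -
  have "(\<Sum>i\<in>UNIV. \<Sum>j\<in>UNIV. (cmod (N $ j $ i))\<^sup>2) = (\<Sum>i\<in>UNIV. \<Sum>j\<in>UNIV. (cmod (N $ i $ j))\<^sup>2)"
    by (rule sum.swap)
  then show ?thesis by (simp add: norm_vec_def L2_set_def transpose_def sum_nonneg)
qed

lemma jac_matrix_mult_right:
  fixes A :: "complex ^ 'm ^ 'm"
  assumes "det A \<noteq> 0"
  shows "jac (\<lambda>N :: complex ^ 'm ^ 'm. N ** A) = cmod (det A) ^ (2 * CARD('m))"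
proof -
  let ?T = "transpose :: complex ^ 'm ^ 'm \<Rightarrow> _" and ?L = "\<lambda>N :: complex ^ 'm ^ 'm. transpose A ** N"
  have T: "linear ?T" by (rule linearI) (auto simp: transpose_def vec_eq_iff)
  have "(\<lambda>N :: complex ^ 'm ^ 'm. N ** A) = (?T \<circ> ?L) \<circ> ?T" by (auto simp: matrix_transpose_mul)
  then have "jac (\<lambda>N :: complex ^ 'm ^ 'm. N ** A) = jac ((?T \<circ> ?L) \<circ> ?T)" by (rule arg_cong[where f = jac])
  also have "\<dots> = jac (?T \<circ> ?L) * jac ?T"
    by (intro jac_compose linear_compose linear_matrix_mult_left T)
  also have "jac (?T \<circ> ?L) = jac ?T * jac ?L"
    by (intro jac_compose linear_matrix_mult_left T)
  finally have "jac (\<lambda>N :: complex ^ 'm ^ 'm. N ** A) = jac ?T * jac ?L * jac ?T" .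
  then show ?thesis
    using jac_isometry[OF T norm_transpose] jac_matrix_mult_left[of "transpose A", where 'k = 'm] assms
    by (simp add: det_transpose)
qed

section \<open>Block matrices and bordered determinants\<close>

text \<open>Source and target may be different types of equal dimension. A bijection of the bases
  extends to a measure and norm preserving map \<open>T\<close> back to the source, which reduces
  the claim to an isometry of one space.\<close>

lemma nn_integral_isometry_iso:
  fixes f :: "'a::euclidean_space \<Rightarrow> 'b::euclidean_space" and h :: "'b \<Rightarrow> ennreal"
  assumes f: "linear f" and n: "\<And>x. norm (f x) = norm x" and dim: "DIM('a) = DIM('b)"
    and h [measurable]: "h \<in> borel_measurable borel"
  shows "(\<integral>\<^sup>+x. h (f x) \<partial>lborel) = (\<integral>\<^sup>+y. h y \<partial>lborel)"
proof -
  obtain \<beta> :: "'b \<Rightarrow> 'a" where \<beta>: "bij_betw \<beta> Basis Basis"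
    using finite_same_card_bij[of "Basis :: 'b set" "Basis :: 'a set"] dim by auto
  define T where "T y = (\<Sum>b\<in>Basis. (y \<bullet> b) *\<^sub>R \<beta> b)" for y
  have T: "linear T"
    by (rule linearI) (auto simp: T_def algebra_simps sum.distrib scaleR_sum_right)
  have Tb: "T b = \<beta> b" if "b \<in> Basis" for b
  proof -
    have "T b = (\<Sum>c\<in>Basis. if c = b then \<beta> c else 0)"
      unfolding T_def using that by (intro sum.cong refl) (auto simp: inner_Basis)
    then show ?thesis using that by simp
  qed
  have TB: "bij_betw T Basis Basis"
    using \<beta> Tb by (metis bij_betw_cong)
  have \<beta>n: "\<beta> b \<bullet> \<beta> c = (if b = c then 1 else 0)" if "b \<in> Basis" "c \<in> Basis" for b c
  proof -
    have "\<beta> b \<in> Basis" "\<beta> c \<in> Basis" using \<beta> that by (auto simp: bij_betw_def)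
    moreover have "\<beta> b = \<beta> c \<longleftrightarrow> b = c" using \<beta> that by (auto simp: bij_betw_def inj_on_eq_iff)
    ultimately show ?thesis by (simp add: inner_Basis)
  qed
  have nT: "norm (T y) = norm y" for y
  proof -
    have "T y \<bullet> T y = (\<Sum>b\<in>Basis. \<Sum>c\<in>Basis. (y \<bullet> b) * (y \<bullet> c) * (\<beta> b \<bullet> \<beta> c))"
      by (simp add: T_def inner_sum_left inner_sum_right sum_distrib_left mult_ac inner_commute)
    also have "\<dots> = (\<Sum>b\<in>Basis. \<Sum>c\<in>Basis. if c = b then (y \<bullet> b) * (y \<bullet> b) else 0)"
      by (intro sum.cong refl) (auto simp: \<beta>n)
    also have "\<dots> = y \<bullet> y"
      by (simp add: euclidean_inner[of y y])
    finally show ?thesis by (simp add: norm_eq_sqrt_inner)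
  qed
  note [measurable] = linear_borel_measurable[OF T] linear_borel_measurable[OF f]
  have "(\<integral>\<^sup>+x. h (f x) \<partial>lborel) = (\<integral>\<^sup>+x. h (f x) \<partial>distr lborel borel T)"
    by (simp add: distr_lborel_Basis_bij[OF T TB])
  also have "\<dots> = (\<integral>\<^sup>+y. h ((f \<circ> T) y) \<partial>lborel)"
    by (subst nn_integral_distr) auto
  also have "\<dots> = (\<integral>\<^sup>+y. h y \<partial>lborel)"
    by (rule nn_integral_isometry[OF linear_compose[OF T f]]) (auto simp: n nT)
  finally show ?thesis .
qed

lemma sum_option: "(\<Sum>i\<in>UNIV. f i) = f None + (\<Sum>i\<in>UNIV. f (Some i))"
  for f :: "'n::finite option \<Rightarrow> 'a::comm_monoid_add"
  by (simp add: UNIV_option_conv sum.reindex)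

definition hcat :: "complex ^ 'm \<Rightarrow> complex ^ 'm ^ 'm \<Rightarrow> complex ^ ('m option) ^ 'm" where
  "hcat x N = (\<chi> i j. case j of None \<Rightarrow> x $ i | Some j \<Rightarrow> N $ i $ j)"

definition blk :: "complex \<Rightarrow> complex ^ 'm \<Rightarrow> complex ^ 'm \<Rightarrow> complex ^ 'm ^ 'm \<Rightarrow> complex ^ ('m option) ^ ('m option)" where
  "blk a w c D = (\<chi> i j. case i of
       None \<Rightarrow> (case j of None \<Rightarrow> a | Some j \<Rightarrow> cnj (w $ j))
     | Some i \<Rightarrow> (case j of None \<Rightarrow> c $ i | Some j \<Rightarrow> D $ i $ j))"

lemma block_mat_eq_blk: "block_mat z w B = blk z w 0 B"
  by (auto simp: block_mat_def blk_def vec_eq_iff split: option.splits)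

lemma norm_vec_power2: "(norm x)\<^sup>2 = (\<Sum>i\<in>UNIV. (norm (x $ i))\<^sup>2)" for x :: "'a::real_normed_vector ^ 'n"
  by (simp add: norm_vec_def L2_set_def sum_nonneg)

lemma norm_hcat: "(norm (hcat x N))\<^sup>2 = (norm x)\<^sup>2 + (norm N)\<^sup>2"
  by (simp add: norm_vec_power2 hcat_def sum_option sum.distrib)

lemma norm_blk: "(norm (blk a w c D))\<^sup>2 = (cmod a)\<^sup>2 + (norm w)\<^sup>2 + (norm c)\<^sup>2 + (norm D)\<^sup>2"
  by (simp add: norm_vec_power2 blk_def sum_option sum.distrib)

lemma nn_integral_hcat:
  fixes h :: "complex ^ ('m::finite option) ^ 'm \<Rightarrow> ennreal"
  assumes h [measurable]: "h \<in> borel_measurable borel"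
  shows "(\<integral>\<^sup>+M. h M \<partial>lborel) = (\<integral>\<^sup>+N. \<integral>\<^sup>+x. h (hcat x N) \<partial>lborel \<partial>lborel)"
proof -
  let ?f = "\<lambda>p :: (complex ^ 'm) \<times> (complex ^ 'm ^ 'm). hcat (fst p) (snd p)"
  have f: "linear ?f"
    by (rule linearI) (auto simp: hcat_def vec_eq_iff split: option.splits)
  have n: "norm (?f p) = norm p" for p
  proof -
    have "(norm (?f p))\<^sup>2 = (norm p)\<^sup>2" by (cases p) (simp add: norm_hcat norm_Pair)
    then show ?thesis by simp
  qed
  have "(\<integral>\<^sup>+M. h M \<partial>lborel) = (\<integral>\<^sup>+p. h (?f p) \<partial>lborel)"
    by (rule nn_integral_isometry_iso[OF f n _ h, symmetric]) (simp add: DIM_cart algebra_simps)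
  also have "\<dots> = (\<integral>\<^sup>+N. \<integral>\<^sup>+x. h (hcat x N) \<partial>lborel \<partial>lborel)"
    using measurable_compose[OF linear_borel_measurable[OF f] h]
    by (subst nn_integral_lborel_prod_iter(1)) auto
  finally show ?thesis .
qed

lemma linear_blk: "linear (\<lambda>p. blk (fst (fst p)) (fst (snd p)) (snd (fst p)) (snd (snd p)))"
  by (rule linearI) (auto simp: blk_def vec_eq_iff split: option.splits)

lemma nn_integral_blk:
  fixes h :: "complex ^ ('m::finite option) ^ ('m option) \<Rightarrow> ennreal"
  assumes h [measurable]: "h \<in> borel_measurable borel"
  shows "(\<integral>\<^sup>+M. h M \<partial>lborel) = (\<integral>\<^sup>+p. h (blk (fst (fst p)) (fst (snd p)) (snd (fst p)) (snd (snd p)))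
    \<partial>(lborel :: ((complex \<times> (complex ^ 'm)) \<times> ((complex ^ 'm) \<times> (complex ^ 'm ^ 'm))) measure))"
proof (rule nn_integral_isometry_iso[OF linear_blk _ _ h, symmetric])
  fix p :: "(complex \<times> (complex ^ 'm)) \<times> ((complex ^ 'm) \<times> (complex ^ 'm ^ 'm))"
  have "(norm (blk (fst (fst p)) (fst (snd p)) (snd (fst p)) (snd (snd p))))\<^sup>2 = (norm p)\<^sup>2"
    by (cases p) (auto simp: norm_blk norm_Pair)
  then show "norm (blk (fst (fst p)) (fst (snd p)) (snd (fst p)) (snd (snd p))) = norm p" by simp
qed (simp add: DIM_cart algebra_simps)

text \<open>x y^T without conjugation, just as \<open>cdot\<close> is bilinear. Adjoints enter
  explicitly through \<open>cnjv\<close>, which keeps the linear algebra of the rank-one updates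
  complex linear.\<close>

definition outer :: "complex ^ 'm \<Rightarrow> complex ^ 'm \<Rightarrow> complex ^ 'm ^ 'm" where
  "outer x y = (\<chi> i j. x $ i * y $ j)"

definition cdot :: "complex ^ 'm \<Rightarrow> complex ^ 'm \<Rightarrow> complex" where
  "cdot x y = (\<Sum>i\<in>UNIV. x $ i * y $ i)"

lemma outer_vec: "outer x y *v v = cdot y v *s x"
  by (auto simp: outer_def cdot_def matrix_vector_mult_def vec_eq_iff sum_distrib_left sum_distrib_right mult_ac
      intro!: sum.cong)

lemma linear_cdot: "linear (cdot y)"
  by (rule linearI) (auto simp: cdot_def algebra_simps sum.distrib scaleR_sum_right)

lemma linear_smult_vec: "linear (\<lambda>\<alpha> :: complex. \<alpha> *s (x :: complex ^ 'm))"
  by (rule linearI) (auto simp: vec_eq_iff algebra_simps)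

lemma linear_cmult: "linear (\<lambda>\<alpha> :: complex. c * \<alpha>)"
  by (rule linearI) (auto simp: algebra_simps)

lemma jac_cmult:
  assumes "c \<noteq> 0" shows "jac (\<lambda>\<alpha> :: complex. c * \<alpha>) = (cmod c)\<^sup>2"
proof (rule jac_eqI[OF linear_cmult])
  show "inj (\<lambda>\<alpha>. c * \<alpha>)" using assms by (auto simp: inj_def)
  fix h :: "complex \<Rightarrow> ennreal" assume h [measurable]: "h \<in> borel_measurable borel"
  define u where "u = c / cmod c"
  have u: "cmod u = 1" and c: "c * \<alpha> = cmod c *\<^sub>R (u * \<alpha>)" for \<alpha>
    using assms by (auto simp: u_def norm_divide scaleR_conv_of_real)
  have iso: "(\<integral>\<^sup>+\<alpha>. g (u * \<alpha>) \<partial>lborel) = (\<integral>\<^sup>+\<alpha>. g \<alpha> \<partial>lborel)" if "g \<in> borel_measurable borel" for g :: "complex \<Rightarrow> ennreal"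
    using that u by (intro nn_integral_isometry linear_cmult) (auto simp: norm_mult)
  have "(\<integral>\<^sup>+x. h x \<partial>lborel) = (\<integral>\<^sup>+x. h x \<partial>density (distr lborel borel (\<lambda>x. 0 + cmod c *\<^sub>R x)) (\<lambda>_. \<bar>cmod c\<bar> ^ DIM(complex)))"
    using assms by (subst lborel_affine[of "cmod c" 0]) auto
  also have "\<dots> = ennreal ((cmod c)\<^sup>2) * (\<integral>\<^sup>+x. h (cmod c *\<^sub>R x) \<partial>lborel)"
    by (subst nn_integral_density) (auto simp: nn_integral_distr nn_integral_cmult)
  also have "(\<integral>\<^sup>+x. h (cmod c *\<^sub>R x) \<partial>lborel) = (\<integral>\<^sup>+x. h (c * x) \<partial>lborel)"
    unfolding c by (rule iso[symmetric]) auto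
  finally show "(\<integral>\<^sup>+x. h x \<partial>lborel) = ennreal ((cmod c)\<^sup>2) * (\<integral>\<^sup>+x. h (c * x) \<partial>lborel)" .
qed simp

lemma inj_matrix_vector: "det A \<noteq> 0 \<Longrightarrow> inj (\<lambda>x. (A :: complex ^ 'm ^ 'm) *v x)"
  using invertible_det_nz inj_matrix_vector_mult by blast

lemma linear_uminus_cdot: "linear (\<lambda>v. - cdot y v)"
  using linear_compose_neg[OF linear_cdot[of y]] .

text \<open>Block LU factorisation: \<open>?U\<close> carries the Schur complement E + x y^T, and
  \<open>?L\<close> is a shear of Jacobian 1.\<close>

lemma jac_bordered:
  assumes "det (E + outer x y) \<noteq> 0"
  shows "jac (\<lambda>(\<alpha>, v). (\<alpha> - cdot y v, \<alpha> *s x + E *v v)) = (cmod (det (E + outer x y)))\<^sup>2"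
proof -
  let ?U = "\<lambda>(\<alpha>, v). (\<alpha> + - cdot y v, (E + outer x y) *v v)" and ?L = "\<lambda>(\<alpha> :: complex, v). (\<alpha>, v + \<alpha> *s x)"
  have id: "linear (\<lambda>x. x :: 'x::real_vector)" "inj (\<lambda>x. x :: 'x)" by (auto intro: linearI)
  have jU: "jac ?U = (cmod (det (E + outer x y)))\<^sup>2"
    using jac_triangular[OF id linear_matrix_vector inj_matrix_vector[OF assms] linear_uminus_cdot]
      jac_matrix_vector[OF assms] by simp
  have jL: "jac ?L = 1"
    using jac_triangular'[OF id id linear_smult_vec[of x]] by simp
  have "linear ?U" "linear ?L"
    by (rule linearI; auto simp: linear_add[OF linear_uminus_cdot, simplified] linear_add[OF linear_cdot]
      linear_cmul[OF linear_cdot] linear_add[OF linear_matrix_vector] linear_cmul[OF linear_matrix_vector]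
      linear_add[OF linear_smult_vec] linear_cmul[OF linear_smult_vec] algebra_simps)+
  then have "jac (?L \<circ> ?U) = jac ?L * jac ?U" by (intro jac_compose)
  then have "jac (?L \<circ> ?U) = (cmod (det (E + outer x y)))\<^sup>2"
    by (simp only: jU jL mult_1)
  moreover have "?L \<circ> ?U = (\<lambda>(\<alpha>, v). (\<alpha> - cdot y v, \<alpha> *s x + E *v v))"
    by (auto simp: fun_eq_iff matrix_vector_mult_add_rdistrib outer_vec vec_eq_iff algebra_simps)
  ultimately show ?thesis by simp
qed

text \<open>The matrix determinant lemma up to phase. The bordered map with E = I is factored in the
  opposite order, with Schur complement the scalar \<open>1 + cdot y x\<close>, and the two values
  of its Jacobian are compared.\<close>

lemma cmod_det_rank1:
  fixes x y :: "complex ^ 'm"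
  assumes det: "det (mat 1 + outer x y) \<noteq> 0" and c: "1 + cdot y x \<noteq> 0"
  shows "cmod (det (mat 1 + outer x y)) = cmod (1 + cdot y x)"
proof -
  let ?U = "\<lambda>(\<alpha>, v :: complex ^ 'm). ((1 + cdot y x) * \<alpha> + - cdot y v, v)" and ?L = "\<lambda>(\<alpha> :: complex, v). (\<alpha>, v + \<alpha> *s x)"
  have id: "linear (\<lambda>x. x :: 'x::real_vector)" "inj (\<lambda>x. x :: 'x)" by (auto intro: linearI)
  have jU: "jac ?U = (cmod (1 + cdot y x))\<^sup>2"
  proof -
    have "inj (\<lambda>\<alpha>. (1 + cdot y x) * \<alpha>)" using c by (auto simp: inj_def)
    from jac_triangular[OF linear_cmult this id linear_uminus_cdot] show ?thesis
      by (simp only: jac_cmult[OF c] jac_id mult_1_right)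
  qed
  have jL: "jac ?L = 1"
    using jac_triangular'[OF id id linear_smult_vec[of x]] by simp
  have "linear ?U" "linear ?L"
    by (rule linearI; auto simp: linear_add[OF linear_cdot]
      linear_cmul[OF linear_cdot] 
      linear_add[OF linear_smult_vec] linear_cmul[OF linear_smult_vec] algebra_simps)+
  then have "jac (?U \<circ> ?L) = jac ?U * jac ?L" by (intro jac_compose)
  then have "jac (?U \<circ> ?L) = (cmod (1 + cdot y x))\<^sup>2"
    by (simp only: jU jL mult_1_right)
  moreover have "cdot y (v + \<alpha> *s x) = cdot y v + \<alpha> * cdot y x" for v \<alpha>
    by (simp add: cdot_def algebra_simps sum.distrib sum_distrib_left)
  then have "?U \<circ> ?L = (\<lambda>(\<alpha>, v). (\<alpha> - cdot y v, \<alpha> *s x + mat 1 *v v))"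
    by (auto simp: fun_eq_iff algebra_simps)
  ultimately have "(cmod (det (mat 1 + outer x y)))\<^sup>2 = (cmod (1 + cdot y x))\<^sup>2"
    using jac_bordered[OF det] by simp
  then show ?thesis by simp
qed

section \<open>Hermitian rank-one perturbations of the identity\<close>

lemma continuous_on_matrix_mult [continuous_intros]:
  fixes f :: "'x::topological_space \<Rightarrow> complex ^ 'n ^ 'm" and g :: "'x \<Rightarrow> complex ^ 'k ^ 'n"
  assumes f: "continuous_on S f" and g: "continuous_on S g"
  shows "continuous_on S (\<lambda>x. f x ** g x)"
  unfolding matrix_matrix_mult_def by (intro continuous_intros f g)

lemma continuous_on_matrix_vector [continuous_intros]:
  fixes f :: "'x::topological_space \<Rightarrow> complex ^ 'n ^ 'm" and g :: "'x \<Rightarrow> complex ^ 'n"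
  assumes f: "continuous_on S f" and g: "continuous_on S g"
  shows "continuous_on S (\<lambda>x. f x *v g x)"
  unfolding matrix_vector_mult_def by (intro continuous_intros f g)

lemma continuous_on_det [continuous_intros]:
  fixes f :: "'x::topological_space \<Rightarrow> complex ^ 'n ^ 'n"
  assumes f: "continuous_on S f"
  shows "continuous_on S (\<lambda>x. det (f x))"
  unfolding det_def by (intro continuous_intros f)

lemma continuous_on_outer [continuous_intros]:
  fixes f g :: "'x::topological_space \<Rightarrow> complex ^ 'n"
  assumes f: "continuous_on S f" and g: "continuous_on S g"
  shows "continuous_on S (\<lambda>x. outer (f x) (g x))"
  unfolding outer_def by (intro continuous_intros f g)

definition cnjv :: "complex ^ 'm \<Rightarrow> complex ^ 'm" where "cnjv u = (\<chi> i. cnj (u $ i))"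

lemma cnjv_nth [simp]: "cnjv u $ i = cnj (u $ i)" by (simp add: cnjv_def)

lemma continuous_on_cnjv [continuous_intros]:
  fixes f :: "'x::topological_space \<Rightarrow> complex ^ 'n"
  assumes f: "continuous_on S f"
  shows "continuous_on S (\<lambda>x. cnjv (f x))"
  unfolding cnjv_def by (intro continuous_intros f)

lemma cdot_cnjv: "cdot (cnjv u) u = of_real ((norm u)\<^sup>2)"
  by (simp add: cdot_def norm_vec_power2 complex_norm_square mult.commute flip: of_real_power)

text \<open>The self-adjoint matrices I + c u u^H. For fixed \<open>u\<close> they are closed under
  products, so inverses, squares and square roots become identities in the real parameter
  \<open>c\<close>.\<close>

definition herm_rank1 :: "real \<Rightarrow> complex ^ 'm \<Rightarrow> complex ^ 'm ^ 'm" where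
  "herm_rank1 c u = mat 1 + outer (of_real c *s u) (cnjv u)"

lemma herm_rank1_vec: "herm_rank1 c u *v v = v + (of_real c * cdot (cnjv u) v) *s u"
  by (simp add: herm_rank1_def matrix_vector_mult_add_rdistrib outer_vec vec_eq_iff mult_ac)

lemma cdot_add_right: "cdot y (v + w) = cdot y v + cdot y w"
  and cdot_smult_right: "cdot y (c *s v) = c * cdot y v"
  by (simp_all add: cdot_def algebra_simps sum.distrib sum_distrib_left)

lemma herm_rank1_mult: "herm_rank1 a u ** herm_rank1 b u = herm_rank1 (a + b + a * b * (norm u)\<^sup>2) u"
  by (rule matrix_eqI_vec)
     (simp add: matrix_vector_mul_assoc[symmetric] herm_rank1_vec cdot_add_right cdot_smult_right cdot_cnjv
       vec_eq_iff algebra_simps)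

lemma herm_rank1_0 [simp]: "herm_rank1 0 u = mat 1"
  by (simp add: herm_rank1_def outer_def vec_eq_iff)

lemma cadj_herm_rank1: "cadj (herm_rank1 c u) = herm_rank1 c u"
  by (auto simp: cadj_def herm_rank1_def outer_def mat_def vec_eq_iff mult_ac)

lemma det_herm_rank1:
  fixes u :: "complex ^ 'm"
  assumes c: "1 + c * (norm u)\<^sup>2 \<noteq> 0"
  shows "det (herm_rank1 c u) \<noteq> 0" and "cmod (det (herm_rank1 c u)) = \<bar>1 + c * (norm u)\<^sup>2\<bar>"
proof -
  have "herm_rank1 c u ** herm_rank1 (- c / (1 + c * (norm u)\<^sup>2)) u = mat 1"
  proof -
    have "c + - c / (1 + c * (norm u)\<^sup>2) + c * (- c / (1 + c * (norm u)\<^sup>2)) * (norm u)\<^sup>2 = 0"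
      using c by (simp add: field_simps)
    then show ?thesis by (simp add: herm_rank1_mult)
  qed
  then show det: "det (herm_rank1 c u) \<noteq> 0"
    by (metis det_I det_mul mult_zero_left zero_neq_one)
  have e: "1 + cdot (cnjv u) (of_real c *s u) = of_real (1 + c * (norm u)\<^sup>2)"
    by (simp add: cdot_smult_right cdot_cnjv)
  have "cmod (det (herm_rank1 c u)) = cmod (of_real (1 + c * (norm u)\<^sup>2))"
    using cmod_det_rank1[of "of_real c *s u" "cnjv u"] det c unfolding e herm_rank1_def
    using of_real_eq_0_iff by blast
  then show "cmod (det (herm_rank1 c u)) = \<bar>1 + c * (norm u)\<^sup>2\<bar>" by (simp only: norm_of_real)
qed

text \<open>The first coordinate of the unit vector proportional to (1, u).\<close>

definition shrink :: "complex ^ 'm \<Rightarrow> real" where "shrink u = 1 / sqrt (1 + (norm u)\<^sup>2)"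

lemma shrink_pos: "0 < shrink u"
  by (simp add: shrink_def add_pos_nonneg)

lemma shrink_nz: "shrink u \<noteq> 0" "1 + shrink u \<noteq> 0" "0 < 1 + shrink u"
  using shrink_pos[of u] by linarith+

lemma shrink_power2: "(shrink u)\<^sup>2 * (1 + (norm u)\<^sup>2) = 1"
  by (simp add: shrink_def power_divide add_nonneg_eq_0_iff)

lemma norm_power2_shrink: "(norm u)\<^sup>2 = (1 - (shrink u)\<^sup>2) / (shrink u)\<^sup>2"
  using shrink_power2[of u] shrink_pos[of u] by (simp add: field_simps)

text \<open>The inverse square root of I + u u^H; \<open>mat_K\<close> below is the square root. On
  the line of \<open>u\<close> they act by r and 1 / r, where r is \<open>shrink u\<close>, and on
  its orthogonal complement as the identity.\<close>

definition mat_S :: "complex ^ 'm \<Rightarrow> complex ^ 'm ^ 'm" where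
  "mat_S u = herm_rank1 (- ((shrink u)\<^sup>2 / (1 + shrink u))) u"

definition mat_K :: "complex ^ 'm \<Rightarrow> complex ^ 'm ^ 'm" where
  "mat_K u = herm_rank1 (shrink u / (1 + shrink u)) u"

lemma one_plus_S: "1 + (- ((shrink u)\<^sup>2 / (1 + shrink u))) * (norm u)\<^sup>2 = shrink u"
proof -
  have "(shrink u)\<^sup>2 / (1 + shrink u) * (norm u)\<^sup>2 = 1 - shrink u"
    using shrink_nz[of u] unfolding norm_power2_shrink by (simp add: divide_simps) algebra
  then show ?thesis by simp
qed

lemma one_plus_K: "1 + shrink u / (1 + shrink u) * (norm u)\<^sup>2 = 1 / shrink u"
  using shrink_nz[of u] unfolding norm_power2_shrink by (simp add: divide_simps) algebra

lemma KS: "mat_K u ** mat_S u = mat 1" and SK: "mat_S u ** mat_K u = mat 1"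
proof -
  let ?r = "shrink u"
  have "?r / (1 + ?r) + - (?r\<^sup>2 / (1 + ?r)) + ?r / (1 + ?r) * - (?r\<^sup>2 / (1 + ?r)) * (norm u)\<^sup>2 = 0"
    using shrink_nz[of u] unfolding norm_power2_shrink by (simp add: divide_simps) algebra
  then show "mat_K u ** mat_S u = mat 1" by (simp add: mat_K_def mat_S_def herm_rank1_mult)
  then show "mat_S u ** mat_K u = mat 1" by (rule matrix_left_right_inverse[THEN iffD1])
qed

lemma KK: "mat_K u ** mat_K u = herm_rank1 1 u"
proof -
  let ?r = "shrink u"
  have "?r / (1 + ?r) + ?r / (1 + ?r) + ?r / (1 + ?r) * (?r / (1 + ?r)) * (norm u)\<^sup>2 = 1"
    using shrink_nz[of u] unfolding norm_power2_shrink by (simp add: divide_simps) algebra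
  then show ?thesis by (simp add: mat_K_def herm_rank1_mult)
qed

lemma SS: "mat_S u ** mat_S u = herm_rank1 (- (shrink u)\<^sup>2) u"
proof -
  let ?s = "- ((shrink u)\<^sup>2 / (1 + shrink u))"
  have "?s + ?s + ?s * ?s * (norm u)\<^sup>2 = - (shrink u)\<^sup>2"
    using shrink_nz[of u] unfolding norm_power2_shrink by (simp add: divide_simps) algebra
  then show ?thesis by (simp only: mat_S_def herm_rank1_mult)
qed

lemma S_vec_self: "mat_S u *v u = of_real (shrink u) *s u"
proof -
  have "mat_S u *v u = of_real (1 + (- ((shrink u)\<^sup>2 / (1 + shrink u))) * (norm u)\<^sup>2) *s u"
    by (simp add: mat_S_def herm_rank1_vec cdot_cnjv vec_eq_iff algebra_simps)
  then show ?thesis by (simp only: one_plus_S)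
qed

lemma det_K: "det (mat_K u) \<noteq> 0" "cmod (det (mat_K u)) = 1 / shrink u"
  using det_herm_rank1[of "shrink u / (1 + shrink u)" u] shrink_pos[of u]
  unfolding mat_K_def one_plus_K by auto

lemma det_S: "det (mat_S u) \<noteq> 0" "cmod (det (mat_S u)) = shrink u"
  using det_herm_rank1[of "- ((shrink u)\<^sup>2 / (1 + shrink u))" u] shrink_pos[of u]
  unfolding mat_S_def one_plus_S by auto

lemma continuous_on_shrink [continuous_intros]:
  "continuous_on S f \<Longrightarrow> continuous_on S (\<lambda>x. shrink (f x))"
  unfolding shrink_def by (intro continuous_intros) (auto simp: add_nonneg_eq_0_iff)

lemma continuous_on_smult [continuous_intros]:
  fixes c :: "'x::topological_space \<Rightarrow> complex"
  shows "continuous_on S c \<Longrightarrow> continuous_on S f \<Longrightarrow> continuous_on S (\<lambda>x. c x *s f x)"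
  unfolding vector_scalar_mult_def by (intro continuous_intros)

lemma continuous_on_mat_K [continuous_intros]:
  "continuous_on S f \<Longrightarrow> continuous_on S (\<lambda>x. mat_K (f x))"
  unfolding mat_K_def herm_rank1_def by (intro continuous_intros shrink_nz ballI)

section \<open>Singular matrices form a null set\<close>

lemma matrix_vector_scaleR: "(t *\<^sub>R A) *v v = t *\<^sub>R (A *v v)" for A :: "complex ^ 'n ^ 'm"
  by (simp add: matrix_vector_mult_def vec_eq_iff scaleR_sum_right)

text \<open>On every line N + t I the determinant is a nonzero polynomial in t and vanishes at
  finitely many t only. Fubini and translation invariance in N turn this into a statement about
  N.\<close>

lemma null_det: "AE N in lborel. det (N :: complex ^ 'm ^ 'm) \<noteq> 0"
proof -
  let ?M = "lborel :: (complex ^ 'm ^ 'm) measure"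
  have fin: "finite {t :: real. det (N + t *\<^sub>R mat 1) = 0}" for N :: "complex ^ 'm ^ 'm"
  proof -
    define P :: "complex poly" where "P = det (\<chi> i j. [:N $ i $ j, of_bool (i = j):])"
    have P: "poly P (of_real t) = det (N + t *\<^sub>R mat 1)" for t :: real
    proof -
      have "(N + t *\<^sub>R mat 1) $ i $ j = poly [:N $ i $ j, of_bool (i = j):] (of_real t)" for i j
        by (simp add: mat_def) (simp add: scaleR_conv_of_real)
      then show ?thesis by (simp add: P_def det_def poly_sum poly_prod)
    qed
    \<comment> \<open>For a real t above the operator bound of N, the matrix N + t I is injective,
      so P does not vanish there.\<close>
    have "P \<noteq> 0"
    proof
      assume "P = 0"
      obtain C where C: "C > 0" "\<And>v. norm (N *v v) \<le> C * norm v"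
        using linear_bounded_pos[OF linear_matrix_vector[of N]] by blast
      define t where "t = C + 1"
      have "det (N + t *\<^sub>R mat 1) = 0" using P[of t] \<open>P = 0\<close> by simp
      then obtain v where v: "v \<noteq> 0" "(N + t *\<^sub>R mat 1) *v v = 0"
        using invertible_det_nz[of "N + t *\<^sub>R mat 1"] matrix_left_invertible_ker[of "N + t *\<^sub>R mat 1"]
        by (auto simp: invertible_left_inverse)
      have "(t *\<^sub>R mat 1 :: complex ^ 'm ^ 'm) *v v = t *\<^sub>R v"
        by (simp add: matrix_vector_scaleR)
      then have "N *v v + t *\<^sub>R v = 0" using v(2) by (simp add: matrix_vector_mult_add_rdistrib)
      then have "N *v v = - (t *\<^sub>R v)" by (simp add: add_eq_0_iff2)
      then have "norm (N *v v) = t * norm v" using C(1) by (simp add: t_def)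
      then show False using C(2)[of v] v(1) by (simp add: t_def algebra_simps)
    qed
    then have "finite {z. poly P z = 0}" by (rule poly_roots_finite)
    then have "finite (of_real -` {z. poly P z = 0} :: real set)"
      by (intro finite_vimageI) (auto simp: inj_def)
    then show ?thesis by (simp add: P vimage_def)
  qed
  let ?Z = "{N :: complex ^ 'm ^ 'm. det N = 0}"
  have Z: "closed ?Z"
    by (intro closed_Collect_eq continuous_intros)
  then have [measurable]: "?Z \<in> sets borel" by (rule borel_closed)
  \<comment> \<open>With t confined to an interval of length 1, integrating over N first returns
    exactly the measure of \<open>?Z\<close>.\<close>
  let ?h = "\<lambda>p. indicator ?Z (fst p + snd p *\<^sub>R mat 1) * indicator {0..1 :: real} (snd p) :: ennreal"
  have h: "?h \<in> borel_measurable borel"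
  proof -
    have "(\<lambda>p :: (complex ^ 'm ^ 'm) \<times> real. fst p + snd p *\<^sub>R (mat 1 :: complex ^ 'm ^ 'm)) \<in> borel \<rightarrow>\<^sub>M borel"
      "(snd :: (complex ^ 'm ^ 'm) \<times> real \<Rightarrow> real) \<in> borel \<rightarrow>\<^sub>M borel"
      by (intro borel_measurable_continuous_onI continuous_intros)+
    then show ?thesis by measurable
  qed
  have "(\<integral>\<^sup>+t. ?h (N, t) \<partial>lborel) = 0" for N :: "complex ^ 'm ^ 'm"
  proof -
    have "AE t in lborel. t \<notin> {t. det (N + t *\<^sub>R mat 1) = 0}"
      using fin[of N] by (intro AE_not_in) (auto intro: finite_imp_null_set_lborel)
    then show ?thesis by (subst nn_integral_0_iff_AE) auto
  qed
  then have "0 = (\<integral>\<^sup>+p. ?h p \<partial>lborel)"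
    by (subst nn_integral_lborel_prod_iter(2)[OF h]) simp
  also have "\<dots> = (\<integral>\<^sup>+t. (\<integral>\<^sup>+N. indicator ?Z (N + t *\<^sub>R mat 1) \<partial>?M) * indicator {0..1} t \<partial>lborel)"
    by (subst nn_integral_lborel_prod_iter(1)[OF h]) (simp add: nn_integral_multc)
  also have "\<dots> = (\<integral>\<^sup>+t. emeasure ?M ?Z * indicator {0..1 :: real} t \<partial>lborel)"
    by (subst nn_integral_translate) auto
  also have "\<dots> = emeasure ?M ?Z"
    by (simp add: nn_integral_cmult_indicator)
  finally show ?thesis
    by (intro AE_I[where N = ?Z]) auto
qed

section \<open>From rectangular to square Gaussian matrices\<close>

lemma cadj_cadj [simp]: "cadj (cadj A) = A"
  by (simp add: cadj_def vec_eq_iff)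

lemma cadj_mult: "cadj (A ** B) = cadj B ** cadj A"
  by (simp add: cadj_def matrix_matrix_mult_def vec_eq_iff mult.commute)

lemma cadj_mat_1 [simp]: "cadj (mat 1) = mat 1"
  by (simp add: cadj_def mat_def vec_eq_iff)

lemma matrix_vector_smult: "A *v (c *s x) = c *s (A *v x)" for c :: complex
  by (simp add: matrix_vector_mult_def vec_eq_iff sum_distrib_left mult_ac)

lemma norm_gram: "(M ** cadj M) $ i $ i = of_real ((norm (M $ i))\<^sup>2)"
  by (simp add: matrix_matrix_mult_def cadj_def norm_vec_power2 complex_norm_square flip: of_real_power)

lemma norm_eq_of_gram_eq:
  fixes M :: "complex ^ 'k ^ 'm" and B :: "complex ^ 'l ^ 'm"
  assumes "M ** cadj M = B ** cadj B"
  shows "norm M = norm B"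
proof -
  have "(norm (M $ i))\<^sup>2 = (norm (B $ i))\<^sup>2" for i
    using norm_gram[of M i] norm_gram[of B i] assms of_real_eq_iff by metis
  then have "(norm M)\<^sup>2 = (norm B)\<^sup>2" by (simp only: norm_vec_power2[of M] norm_vec_power2[of B])
  then show ?thesis by simp
qed

lemma cdot_cnjv_adjoint: "cdot (cnjv y) (cadj N *v v) = cdot (cnjv (N *v y)) v"
proof -
  have "cdot (cnjv y) (cadj N *v v) = (\<Sum>i\<in>UNIV. \<Sum>j\<in>UNIV. cnj (y $ i) * (cnj (N $ j $ i) * v $ j))"
    by (simp add: cdot_def matrix_vector_mult_def cadj_def sum_distrib_left)
  also have "\<dots> = (\<Sum>j\<in>UNIV. \<Sum>i\<in>UNIV. cnj (y $ i) * (cnj (N $ j $ i) * v $ j))"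
    by (rule sum.swap)
  also have "\<dots> = cdot (cnjv (N *v y)) v"
    by (simp add: cdot_def matrix_vector_mult_def sum_distrib_right) (simp add: mult_ac)
  finally show ?thesis .
qed

lemma outer_cnjv_conj: "N ** outer y (cnjv y) ** cadj N = outer (N *v y) (cnjv (N *v y))"
  by (rule matrix_eqI_vec)
     (simp add: matrix_vector_mul_assoc[symmetric] outer_vec matrix_vector_smult cdot_cnjv_adjoint)

lemma gram_hcat: "hcat x N ** cadj (hcat x N) = outer x (cnjv x) + N ** cadj N"
  by (simp add: hcat_def cadj_def matrix_matrix_mult_def outer_def vec_eq_iff sum_option)

lemma matrix_mult_add_left: "(A + B) ** C = A ** C + B ** C" for A B :: "complex ^ 'n ^ 'm"
  by (simp add: matrix_matrix_mult_def vec_eq_iff algebra_simps sum.distrib)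

lemma matrix_mult_add_right: "D ** (A + B) = D ** A + D ** B" for A B :: "complex ^ 'n ^ 'm"
  by (simp add: matrix_matrix_mult_def vec_eq_iff algebra_simps sum.distrib)

lemma gram_hcat_mult: "hcat (N *v y) N ** cadj (hcat (N *v y) N) = (N ** mat_K y) ** cadj (N ** mat_K y)"
proof -
  have "(N ** mat_K y) ** cadj (N ** mat_K y) = N ** (mat_K y ** mat_K y) ** cadj N"
    by (simp add: cadj_mult matrix_mul_assoc mat_K_def cadj_herm_rank1)
  also have "\<dots> = N ** (outer y (cnjv y) + mat 1) ** cadj N"
    by (simp add: KK herm_rank1_def add.commute)
  also have "\<dots> = outer (N *v y) (cnjv (N *v y)) + N ** cadj N"
    by (simp add: matrix_mult_add_left matrix_mult_add_right outer_cnjv_conj)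
  finally show ?thesis by (simp add: gram_hcat)
qed

lemma continuous_on_hcat [continuous_intros]:
  fixes f :: "'x::topological_space \<Rightarrow> complex ^ 'm"
  assumes f: "continuous_on S f" and g: "continuous_on S g"
  shows "continuous_on S (\<lambda>x. hcat (f x) (g x))"
proof -
  have "continuous_on S (\<lambda>x. case j of None \<Rightarrow> f x $ i | Some j \<Rightarrow> g x $ i $ j)" for i j
    by (cases j) (auto intro!: continuous_intros f g)
  then show ?thesis unfolding hcat_def by (intro continuous_intros)
qed

lemma shrink_measurable [measurable]: "shrink \<in> borel_measurable borel"
  by (intro borel_measurable_continuous_onI continuous_intros)

text \<open>With n = \<open>CARD('m) + 1\<close> the integrand is (1 + |y|^2)^(-n): up to
  normalisation this is the volume of the complex projective space of dimension n - 1, seen in the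
  affine chart (1, y).\<close>

definition chart_mass :: "'m::finite itself \<Rightarrow> ennreal" where
  "chart_mass _ = (\<integral>\<^sup>+y. ennreal (shrink y ^ (2 * CARD('m) + 2)) \<partial>(lborel :: (complex ^ 'm) measure))"

abbreviation gauss :: "'a::real_normed_vector \<Rightarrow> ennreal" where
  "gauss x \<equiv> ennreal (exp (- (norm x)\<^sup>2))"

text \<open>Writing \<open>M = (N y | N)\<close> gives \<open>M M\<^sup>* = (N K) (N K)\<^sup>*\<close> with \<open>K = (I + y y\<^sup>*)\<^bsup>1/2\<^esup>\<close>;
  so a function of \<open>M M\<^sup>*\<close> becomes a function of the square matrix \<open>N K\<close>.\<close>
lemma nn_integral_rect_to_square:
  fixes G :: "complex ^ 'm ^ 'm \<Rightarrow> ennreal" and H :: "complex ^ ('m::finite option) ^ 'm \<Rightarrow> ennreal"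
  assumes G [measurable]: "G \<in> borel_measurable borel" and H [measurable]: "H \<in> borel_measurable borel"
    and null: "N0 \<in> null_sets lborel"
    and HG: "\<And>M B. M \<notin> N0 \<Longrightarrow> det B \<noteq> 0 \<Longrightarrow> M ** cadj M = B ** cadj B \<Longrightarrow> H M = G B"
  shows "(\<integral>\<^sup>+M. H M * gauss M \<partial>lborel)
    = chart_mass TYPE('m) * (\<integral>\<^sup>+B. G B * ennreal ((cmod (det B))\<^sup>2) * gauss B \<partial>lborel)"
proof -
  let ?m = "CARD('m)"
  have [measurable]: "N0 \<in> sets borel" using null by auto
  have hc [measurable]: "(\<lambda>x. hcat x N) \<in> borel_measurable borel" for N :: "complex ^ 'm ^ 'm"
    by (intro borel_measurable_continuous_onI continuous_intros)
  have nm [measurable]: "(\<lambda>y. N *v y) \<in> borel_measurable borel" for N :: "complex ^ 'm ^ 'm"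
    by (intro borel_measurable_continuous_onI continuous_intros)
  have detm [measurable]: "(\<lambda>B :: complex ^ 'm ^ 'm. det B) \<in> borel_measurable borel"
    by (intro borel_measurable_continuous_onI continuous_intros)
  have NK: "(\<lambda>p :: (complex ^ 'm ^ 'm) \<times> (complex ^ 'm). fst p ** mat_K (snd p)) \<in> borel_measurable borel"
    by (intro borel_measurable_continuous_onI continuous_intros)
  have fm: "(fst :: (complex ^ 'm ^ 'm) \<times> (complex ^ 'm) \<Rightarrow> _) \<in> borel_measurable borel"
    by (intro borel_measurable_continuous_onI continuous_intros)
  have NKy [measurable]: "(\<lambda>N :: complex ^ 'm ^ 'm. N ** mat_K y) \<in> borel_measurable borel" for y
    by (intro borel_measurable_continuous_onI continuous_intros)
  have NyK [measurable]: "(\<lambda>y. N ** mat_K y) \<in> borel_measurable borel" for N :: "complex ^ 'm ^ 'm"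
    by (intro borel_measurable_continuous_onI continuous_intros)
  \<comment> \<open>\<open>HG\<close> is available off \<open>N0\<close> only, so the exceptional
    set must follow the splitting: almost every slice over \<open>N\<close> is null, and it remains
    null after the substitution x = N y with \<open>N\<close> invertible.\<close>
  have "0 = (\<integral>\<^sup>+M. indicator N0 M \<partial>lborel)" using null by auto
  also have "\<dots> = (\<integral>\<^sup>+N. \<integral>\<^sup>+x. indicator N0 (hcat x N) \<partial>lborel \<partial>lborel)"
    by (rule nn_integral_hcat) auto
  finally have z: "(\<integral>\<^sup>+N. \<integral>\<^sup>+x. indicator N0 (hcat x N) \<partial>lborel \<partial>lborel) = 0" ..
  have zm: "(\<lambda>N. \<integral>\<^sup>+x. indicator N0 (hcat x N) \<partial>lborel) \<in> borel_measurable borel"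
  proof -
    have "(\<lambda>p. hcat (snd p) (fst p)) \<in> borel_measurable (borel :: ((complex ^ 'm ^ 'm) \<times> (complex ^ 'm)) measure)"
      by (intro borel_measurable_continuous_onI continuous_intros)
    then have "(\<lambda>p. indicator N0 (hcat (snd p) (fst p)) :: ennreal)
        \<in> borel_measurable (borel :: ((complex ^ 'm ^ 'm) \<times> (complex ^ 'm)) measure)"
      by measurable
    then have "(\<lambda>p. indicator N0 (hcat (snd p) (fst p)) :: ennreal) \<in> borel_measurable (lborel \<Otimes>\<^sub>M lborel)"
      by (simp add: lborel_prod)
    from lborel.borel_measurable_nn_integral_fst[OF this] show ?thesis by simp
  qed
  have null1: "AE N in lborel. (\<integral>\<^sup>+x. indicator N0 (hcat x N) \<partial>lborel) = 0"
    using z zm by (subst (asm) nn_integral_0_iff_AE) auto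
  have inner: "(\<integral>\<^sup>+x. H (hcat x N) * gauss (hcat x N) \<partial>lborel)
      = (\<integral>\<^sup>+y. ennreal ((cmod (det N))\<^sup>2) * (G (N ** mat_K y) * gauss (N ** mat_K y)) \<partial>lborel)"
    if d: "det N \<noteq> 0" and n: "(\<integral>\<^sup>+x. indicator N0 (hcat x N) \<partial>lborel) = 0" for N :: "complex ^ 'm ^ 'm"
  proof -
    note lin = nn_integral_linear[OF linear_matrix_vector inj_matrix_vector[OF d]]
    have "(\<integral>\<^sup>+y. indicator N0 (hcat (N *v y) N) \<partial>lborel) = 0"
      using n d jac_matrix_vector[OF d] lin[of "\<lambda>x. indicator N0 (hcat x N)"] by simp
    then have ae: "AE y in lborel. hcat (N *v y) N \<notin> N0"
      by (subst (asm) nn_integral_0_iff_AE) (auto simp: indicator_def)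
    have "(\<integral>\<^sup>+x. H (hcat x N) * gauss (hcat x N) \<partial>lborel)
      = ennreal ((cmod (det N))\<^sup>2) * (\<integral>\<^sup>+y. H (hcat (N *v y) N) * gauss (hcat (N *v y) N) \<partial>lborel)"
      using lin[of "\<lambda>x. H (hcat x N) * gauss (hcat x N)"] jac_matrix_vector[OF d] by simp
    also have "(\<integral>\<^sup>+y. H (hcat (N *v y) N) * gauss (hcat (N *v y) N) \<partial>lborel)
      = (\<integral>\<^sup>+y. G (N ** mat_K y) * gauss (N ** mat_K y) \<partial>lborel)"
    proof (rule nn_integral_cong_AE, use ae in eventually_elim)
      fix y assume "hcat (N *v y) N \<notin> N0"
      then show "H (hcat (N *v y) N) * gauss (hcat (N *v y) N) = G (N ** mat_K y) * gauss (N ** mat_K y)"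
        using HG[OF _ _ gram_hcat_mult, of N y] norm_eq_of_gram_eq[OF gram_hcat_mult, of N y] d det_K[of y]
        by (simp add: det_mul)
    qed
    finally show ?thesis by (simp add: nn_integral_cmult)
  qed
  have "(\<integral>\<^sup>+M. H M * gauss M \<partial>lborel) = (\<integral>\<^sup>+N. \<integral>\<^sup>+x. H (hcat x N) * gauss (hcat x N) \<partial>lborel \<partial>lborel)"
    by (rule nn_integral_hcat) auto
  also have "\<dots> = (\<integral>\<^sup>+N. \<integral>\<^sup>+y. ennreal ((cmod (det N))\<^sup>2) * (G (N ** mat_K y) * gauss (N ** mat_K y)) \<partial>lborel \<partial>lborel)"
    by (rule nn_integral_cong_AE, use null1 null_det in eventually_elim) (rule inner)
  also have "\<dots> = (\<integral>\<^sup>+y. \<integral>\<^sup>+N. ennreal ((cmod (det N))\<^sup>2) * (G (N ** mat_K y) * gauss (N ** mat_K y)) \<partial>lborel \<partial>lborel)"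
  proof -
    have m: "(\<lambda>p. ennreal ((cmod (det (fst p)))\<^sup>2) * (G (fst p ** mat_K (snd p)) * gauss (fst p ** mat_K (snd p))))
        \<in> borel_measurable (borel :: ((complex ^ 'm ^ 'm) \<times> (complex ^ 'm)) measure)"
      using NK fm by measurable
    show ?thesis
      using nn_integral_lborel_prod_iter(1)[OF m] nn_integral_lborel_prod_iter(2)[OF m] by simp
  qed
  also have "\<dots> = (\<integral>\<^sup>+y. ennreal (shrink y ^ (2 * ?m + 2)) *
      (\<integral>\<^sup>+B. G B * ennreal ((cmod (det B))\<^sup>2) * gauss B \<partial>lborel) \<partial>(lborel :: (complex ^ 'm) measure))"
  proof (rule nn_integral_cong)
    fix y :: "complex ^ 'm"
    \<comment> \<open>With r = \<open>shrink y\<close> and m = \<open>CARD('m)\<close>, the map N ->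
      N K has Jacobian r^(-2m) and the squared determinant of N K contains another r^(-2). Together
      they invert the weight in \<open>chart_mass\<close>.\<close>
    let ?r = "shrink y"
    note r = shrink_pos[of y]
    have i: "inj (\<lambda>N :: complex ^ 'm ^ 'm. N ** mat_K y)"
      by (rule injI) (metis KS matrix_mul_assoc matrix_mul_rid)
    have "(\<integral>\<^sup>+B. G B * ennreal ((cmod (det B))\<^sup>2) * gauss B \<partial>lborel)
      = ennreal ((1 / ?r) ^ (2 * ?m)) * (\<integral>\<^sup>+N. G (N ** mat_K y) * ennreal ((cmod (det (N ** mat_K y)))\<^sup>2) * gauss (N ** mat_K y) \<partial>lborel)"
      using nn_integral_linear[OF linear_matrix_mult_right i, of "\<lambda>B. G B * ennreal ((cmod (det B))\<^sup>2) * gauss B"]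
        jac_matrix_mult_right[OF det_K(1), of y] det_K(2)[of y] by simp
    also have "(\<integral>\<^sup>+N. G (N ** mat_K y) * ennreal ((cmod (det (N ** mat_K y)))\<^sup>2) * gauss (N ** mat_K y) \<partial>lborel)
      = (\<integral>\<^sup>+N. ennreal ((1 / ?r)\<^sup>2) * (ennreal ((cmod (det N))\<^sup>2) * (G (N ** mat_K y) * gauss (N ** mat_K y))) \<partial>lborel)"
      using r by (intro nn_integral_cong)
        (simp add: det_mul norm_mult det_K power_mult_distrib power_divide ennreal_mult mult_ac flip: ennreal_mult)
    also have "\<dots> = ennreal ((1 / ?r)\<^sup>2) * (\<integral>\<^sup>+N. ennreal ((cmod (det N))\<^sup>2) * (G (N ** mat_K y) * gauss (N ** mat_K y)) \<partial>lborel)"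
      by (rule nn_integral_cmult) measurable
    finally have e0: "(\<integral>\<^sup>+B. G B * ennreal ((cmod (det B))\<^sup>2) * gauss B \<partial>lborel) =
      ennreal ((1 / ?r) ^ (2 * ?m)) * (ennreal ((1 / ?r)\<^sup>2) * (\<integral>\<^sup>+N. ennreal ((cmod (det N))\<^sup>2) * (G (N ** mat_K y) * gauss (N ** mat_K y)) \<partial>lborel))" .
    have e: "(\<integral>\<^sup>+B. G B * ennreal ((cmod (det B))\<^sup>2) * gauss B \<partial>lborel) =
      ennreal ((1 / ?r) ^ (2 * ?m + 2)) * (\<integral>\<^sup>+N. ennreal ((cmod (det N))\<^sup>2) * (G (N ** mat_K y) * gauss (N ** mat_K y)) \<partial>lborel)"
    proof -
      have "ennreal ((1 / ?r) ^ (2 * ?m + 2)) = ennreal ((1 / ?r) ^ (2 * ?m)) * ennreal ((1 / ?r)\<^sup>2)"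
        using r by (simp only: power_add) (simp add: ennreal_mult)
      then show ?thesis using e0 by (simp only: mult.assoc)
    qed
    have "ennreal (?r ^ (2 * ?m + 2)) * ennreal ((1 / ?r) ^ (2 * ?m + 2)) = 1"
      using r by (simp add: ennreal_mult[symmetric] power_mult_distrib[symmetric])
    then show "(\<integral>\<^sup>+N. ennreal ((cmod (det N))\<^sup>2) * (G (N ** mat_K y) * gauss (N ** mat_K y)) \<partial>lborel)
      = ennreal (?r ^ (2 * ?m + 2)) * (\<integral>\<^sup>+B. G B * ennreal ((cmod (det B))\<^sup>2) * gauss B \<partial>lborel)"
      unfolding e by (simp add: mult.assoc[symmetric])
  qed
  also have "\<dots> = chart_mass TYPE('m) * (\<integral>\<^sup>+B. G B * ennreal ((cmod (det B))\<^sup>2) * gauss B \<partial>lborel)"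
    unfolding chart_mass_def
    by (rule nn_integral_multc) measurable
  finally show ?thesis .
qed

section \<open>Determinant estimates\<close>

lemma norm_matrix_power2: "(norm M)\<^sup>2 = (\<Sum>i\<in>UNIV. \<Sum>j\<in>UNIV. (cmod (M $ i $ j))\<^sup>2)"
  by (simp only: norm_vec_power2)

lemma matrix_vector_nth: "(Y *v v) $ i = cdot (Y $ i) v"
  by (simp add: matrix_vector_mult_def cdot_def)

lemma sqrt_pi_power_DIM: "sqrt pi ^ DIM(complex ^ 'm) = pi ^ CARD('m)"
  unfolding DIM_complex_vec by (simp only: power_mult) simp

lemma norm_cadj: "norm (cadj N) = norm (N :: complex ^ 'k ^ 'm)"
proof -
  have "(\<Sum>i\<in>UNIV. \<Sum>j\<in>UNIV. (cmod (N $ j $ i))\<^sup>2) = (\<Sum>i\<in>UNIV. \<Sum>j\<in>UNIV. (cmod (N $ i $ j))\<^sup>2)"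
    by (rule sum.swap)
  then show ?thesis by (simp add: norm_vec_def L2_set_def cadj_def sum_nonneg)
qed

lemma norm_smult_vec: "norm (c *s x) = cmod c * norm x" for c and x :: "complex ^ 'k"
  by (simp add: norm_vec_def L2_set_def norm_mult power_mult_distrib sum_distrib_left[symmetric] real_sqrt_mult)

lemma norm_matrix_mult_le:
  fixes A :: "complex ^ 'n ^ 'm" and B :: "complex ^ 'k ^ 'n"
  shows "norm (A ** B) \<le> norm A * norm B"
proof -
  have row: "norm ((A ** B) $ i) \<le> norm (A $ i) * norm B" for i
  proof -
    have "(A ** B) $ i = (\<Sum>k\<in>UNIV. A $ i $ k *s B $ k)"
      by (simp add: matrix_matrix_mult_def vec_eq_iff)
    then have "norm ((A ** B) $ i) \<le> (\<Sum>k\<in>UNIV. norm (A $ i $ k *s B $ k))"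
      using norm_sum by metis
    also have "\<dots> = (\<Sum>k\<in>UNIV. \<bar>cmod (A $ i $ k)\<bar> * \<bar>norm (B $ k)\<bar>)"
      by (simp add: norm_smult_vec)
    also have "\<dots> \<le> norm (A $ i) * norm B"
      unfolding norm_vec_def[of "A $ i"] norm_vec_def[of B] by (rule L2_set_mult_ineq)
    finally show ?thesis .
  qed
  have "(norm (A ** B))\<^sup>2 = (\<Sum>i\<in>UNIV. (norm ((A ** B) $ i))\<^sup>2)" by (rule norm_vec_power2)
  also have "\<dots> \<le> (\<Sum>i\<in>UNIV. (norm (A $ i) * norm B)\<^sup>2)"
    by (intro sum_mono power_mono row) auto
  also have "\<dots> = (norm A * norm B)\<^sup>2"
    by (simp add: power_mult_distrib sum_distrib_right[symmetric] norm_vec_power2[of A])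
  finally show ?thesis by (rule power2_le_imp_le) simp
qed

section \<open>Second moments of Gaussian vectors\<close>

lemma ennreal_double_cancel: "2 * x = 2 * y \<Longrightarrow> x = (y :: ennreal)"
  by (simp add: ennreal_mult_cancel_left)

text \<open>The reflection \<open>R\<close> in a basis vector \<open>e\<close> preserves the
  Gaussian and exchanges a + t e with a - t e when \<open>a\<close> is orthogonal to
  \<open>e\<close>. The parallelogram law then adds one coordinate at a time, so no signed cross
  term has to be integrated and everything stays in \<open>ennreal\<close>.\<close>

lemma gaussian_second_moment_inner:
  fixes a :: "'a::euclidean_space"
  shows "(\<integral>\<^sup>+x. ennreal ((x \<bullet> a)\<^sup>2) * gauss x \<partial>lborel) = ennreal ((norm a)\<^sup>2 * (sqrt pi ^ DIM('a) / 2))"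
proof -
  define Q where "Q = sqrt pi ^ DIM('a) / 2"
  define q where "q a = (\<integral>\<^sup>+x. ennreal ((x \<bullet> a)\<^sup>2) * gauss x \<partial>lborel)" for a :: 'a
  have Qp: "Q \<ge> 0" by (simp add: Q_def)
  have step: "q (a + t *\<^sub>R e) = q a + ennreal (t\<^sup>2 * Q)" if e: "e \<in> Basis" and ae: "a \<bullet> e = 0" for a e t
  proof -
    define R where "R x = x - (2 * (x \<bullet> e)) *\<^sub>R e" for x
    have R: "linear R" by (rule linearI) (auto simp: R_def algebra_simps)
    have "norm (R x) = norm x" for x
    proof -
      have "R x \<bullet> R x = x \<bullet> x" using e by (simp add: R_def algebra_simps inner_commute)
      then show ?thesis by (simp add: norm_eq_sqrt_inner)
    qed
    note iso = nn_integral_isometry[OF R this]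
    have Rm: "(R x \<bullet> (a - t *\<^sub>R e)) = x \<bullet> (a + t *\<^sub>R e)" for x
      using e ae by (simp add: R_def algebra_simps inner_commute)
    have eq: "q (a - t *\<^sub>R e) = q (a + t *\<^sub>R e)"
      using iso[of "\<lambda>x. ennreal ((x \<bullet> (a - t *\<^sub>R e))\<^sup>2) * gauss x"] \<open>\<And>x. norm (R x) = norm x\<close>
      by (simp add: q_def Rm)
    have qe: "q e = ennreal Q"
      using nn_integral_gaussian_moment[OF e] by (simp add: q_def Q_def ennreal_mult)
    have "q (a + t *\<^sub>R e) + q (a - t *\<^sub>R e)
        = (\<integral>\<^sup>+x. (ennreal ((x \<bullet> (a + t *\<^sub>R e))\<^sup>2) + ennreal ((x \<bullet> (a - t *\<^sub>R e))\<^sup>2)) * gauss x \<partial>lborel)"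
      unfolding q_def by (subst nn_integral_add[symmetric]) (auto simp: distrib_right)
    also have "\<dots> = (\<integral>\<^sup>+x. 2 * (ennreal ((x \<bullet> a)\<^sup>2) * gauss x) + 2 * ennreal (t\<^sup>2) * (ennreal ((x \<bullet> e)\<^sup>2) * gauss x) \<partial>lborel)"
    proof (rule nn_integral_cong)
      fix x
      have "(x \<bullet> (a + t *\<^sub>R e))\<^sup>2 + (x \<bullet> (a - t *\<^sub>R e))\<^sup>2 = 2 * (x \<bullet> a)\<^sup>2 + 2 * t\<^sup>2 * (x \<bullet> e)\<^sup>2"
        by (simp add: inner_add_right inner_diff_right) algebra
      then have "ennreal ((x \<bullet> (a + t *\<^sub>R e))\<^sup>2) + ennreal ((x \<bullet> (a - t *\<^sub>R e))\<^sup>2)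
          = 2 * ennreal ((x \<bullet> a)\<^sup>2) + 2 * ennreal (t\<^sup>2) * ennreal ((x \<bullet> e)\<^sup>2)"
        by (simp add: ennreal_plus[symmetric] ennreal_mult[symmetric] flip: ennreal_numeral del: ennreal_plus)
      then show "(ennreal ((x \<bullet> (a + t *\<^sub>R e))\<^sup>2) + ennreal ((x \<bullet> (a - t *\<^sub>R e))\<^sup>2)) * gauss x
          = 2 * (ennreal ((x \<bullet> a)\<^sup>2) * gauss x) + 2 * ennreal (t\<^sup>2) * (ennreal ((x \<bullet> e)\<^sup>2) * gauss x)"
        by (simp add: distrib_right mult.assoc)
    qed
    also have "\<dots> = 2 * q a + 2 * ennreal (t\<^sup>2) * q e"
      unfolding q_def by (subst nn_integral_add) (auto simp: nn_integral_cmult)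
    finally have "2 * q (a + t *\<^sub>R e) = 2 * (q a + ennreal (t\<^sup>2 * Q))"
      using Qp by (simp add: eq qe mult_2 distrib_left ennreal_mult mult.assoc)
        (simp add: mult_2[symmetric] mult.assoc)
    then show ?thesis by (rule ennreal_double_cancel)
  qed
  have "q (\<Sum>e\<in>F. (a \<bullet> e) *\<^sub>R e) = ennreal ((\<Sum>e\<in>F. (a \<bullet> e)\<^sup>2) * Q)" if "finite F" "F \<subseteq> Basis" for F
    using that
  proof (induction F rule: finite_induct)
    case empty then show ?case by (simp add: q_def)
  next
    case (insert e F)
    have "(\<Sum>e\<in>F. (a \<bullet> e) *\<^sub>R e) \<bullet> e = 0"
      using insert by (auto simp: inner_sum_left inner_Basis intro!: sum.neutral)
    then show ?case
      using insert step[of e "\<Sum>e\<in>F. (a \<bullet> e) *\<^sub>R e" "a \<bullet> e"] Qp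
      by (simp add: add.commute ennreal_plus[symmetric] sum_nonneg distrib_right del: ennreal_plus)
  qed
  from this[of Basis] show ?thesis
    by (simp add: euclidean_representation q_def Q_def norm_power2_Basis[of a])
qed

lemma gaussian_second_moment_cdot:
  fixes c :: "complex ^ 'm"
  shows "(\<integral>\<^sup>+b. ennreal ((cmod (cdot c b))\<^sup>2) * gauss b \<partial>lborel) = ennreal ((norm c)\<^sup>2 * pi ^ CARD('m))"
proof -
  define c1 where "c1 = cnjv c"
  define c2 where "c2 = \<i> *s cnjv c"
  have re: "Re (cdot c b) = b \<bullet> c1" and im: "Im (cdot c b) = b \<bullet> c2" for b
    by (simp_all add: cdot_def c1_def c2_def inner_vec_def inner_complex_def Re_sum Im_sum algebra_simps)
  have n: "norm c1 = norm c" "norm c2 = norm c"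
    by (simp_all add: c1_def c2_def norm_smult_vec norm_vec_def L2_set_def norm_mult)
  have "(\<integral>\<^sup>+b. ennreal ((cmod (cdot c b))\<^sup>2) * gauss b \<partial>lborel)
      = (\<integral>\<^sup>+b. ennreal ((b \<bullet> c1)\<^sup>2) * gauss b + ennreal ((b \<bullet> c2)\<^sup>2) * gauss b \<partial>lborel)"
    by (intro nn_integral_cong) (simp add: cmod_power2 re im distrib_right)
  also have "\<dots> = ennreal ((norm c)\<^sup>2 * (pi ^ CARD('m) / 2)) + ennreal ((norm c)\<^sup>2 * (pi ^ CARD('m) / 2))"
    by (subst nn_integral_add) (auto simp: gaussian_second_moment_inner n sqrt_pi_power_DIM simp del: DIM_cart)
  also have "\<dots> = ennreal ((norm c)\<^sup>2 * pi ^ CARD('m))"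
    by (simp add: ennreal_plus[symmetric] del: ennreal_plus)
  finally show ?thesis .
qed

lemma nn_integral_gauss_vec: "(\<integral>\<^sup>+v. gauss v \<partial>(lborel :: (complex ^ 'm) measure)) = ennreal (pi ^ CARD('m))"
  using nn_integral_gaussian_euclidean[of 1, where 'a = "complex ^ 'm"] by (simp add: sqrt_pi_power_DIM del: DIM_cart)

lemma gaussian_second_moment_matrix:
  fixes Y :: "complex ^ 'm ^ 'k"
  shows "(\<integral>\<^sup>+v. ennreal ((norm (Y *v v))\<^sup>2) * gauss v \<partial>lborel) = ennreal ((norm Y)\<^sup>2 * pi ^ CARD('m))"
proof -
  have m: "(\<lambda>v. cdot (Y $ i) v) \<in> borel_measurable borel" for i
    by (rule linear_borel_measurable[OF linear_cdot])
  have "(\<integral>\<^sup>+v. ennreal ((norm (Y *v v))\<^sup>2) * gauss v \<partial>lborel)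
      = (\<integral>\<^sup>+v. (\<Sum>i\<in>UNIV. ennreal ((cmod (cdot (Y $ i) v))\<^sup>2) * gauss v) \<partial>lborel)"
    by (intro nn_integral_cong)
       (simp add: norm_vec_power2[of "Y *v _"] sum_distrib_right[symmetric] sum_ennreal matrix_vector_nth)
  also have "\<dots> = (\<Sum>i\<in>UNIV. ennreal ((norm (Y $ i))\<^sup>2 * pi ^ CARD('m)))"
    using m by (subst nn_integral_sum) (auto simp: gaussian_second_moment_cdot)
  also have "\<dots> = ennreal ((norm Y)\<^sup>2 * pi ^ CARD('m))"
    by (simp add: sum_ennreal sum_distrib_right[symmetric] norm_vec_power2[of Y])
  finally show ?thesis .
qed

text \<open>Integrating \<open>exp (|v|\<^sup>2 - |Yv|\<^sup>2) \<ge> 1 + |v|\<^sup>2 - |Yv|\<^sup>2\<close> against the Gaussian weight.\<close>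
lemma det_le_1:
  fixes Y :: "complex ^ 'm ^ 'm"
  assumes n: "(norm Y)\<^sup>2 = CARD('m)" and d: "det Y \<noteq> 0"
  shows "(cmod (det Y))\<^sup>2 \<le> 1"
proof -
  let ?P = "pi ^ CARD('m)"
  have P: "?P > 0" by simp
  define I where "I = (\<integral>\<^sup>+v. gauss (Y *v v) \<partial>(lborel :: (complex ^ 'm) measure))"
  have Ym: "(\<lambda>v. Y *v v) \<in> borel_measurable borel" by (rule linear_borel_measurable[OF linear_matrix_vector])
  have "norm (mat 1 :: complex ^ 'm ^ 'm) ^ 2 = CARD('m)"
    by (simp add: norm_vec_power2 mat_def if_distrib[of norm] if_distrib[of "\<lambda>x. x\<^sup>2"] cong: if_cong)
  then have m1: "(\<integral>\<^sup>+v. ennreal ((norm v)\<^sup>2) * gauss v \<partial>(lborel :: (complex ^ 'm) measure)) = ennreal (CARD('m) * ?P)"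
    using gaussian_second_moment_matrix[of "mat 1 :: complex ^ 'm ^ 'm"] by simp
  have "ennreal ?P + ennreal (CARD('m) * ?P)
      = (\<integral>\<^sup>+v. gauss v + ennreal ((norm v)\<^sup>2) * gauss v \<partial>(lborel :: (complex ^ 'm) measure))"
    by (subst nn_integral_add) (auto simp: m1 nn_integral_gauss_vec)
  also have "\<dots> \<le> (\<integral>\<^sup>+v. gauss (Y *v v) + ennreal ((norm (Y *v v))\<^sup>2) * gauss v \<partial>(lborel :: (complex ^ 'm) measure))"
  proof (rule nn_integral_mono)
    fix v :: "complex ^ 'm"
    let ?a = "(norm v)\<^sup>2" and ?b = "(norm (Y *v v))\<^sup>2"
    have "1 + (?a - ?b) \<le> exp (?a - ?b)" by (rule exp_ge_add_one_self)
    then have "(1 + (?a - ?b)) * exp (- ?a) \<le> exp (?a - ?b) * exp (- ?a)" by (intro mult_right_mono) auto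
    then have "exp (- ?a) + ?a * exp (- ?a) \<le> exp (- ?b) + ?b * exp (- ?a)"
      by (simp add: exp_add[symmetric] algebra_simps)
    then have "ennreal (exp (- ?a) + ?a * exp (- ?a)) \<le> ennreal (exp (- ?b) + ?b * exp (- ?a))"
      by (rule ennreal_leI)
    then show "gauss v + ennreal ?a * gauss v \<le> gauss (Y *v v) + ennreal ?b * gauss v"
      by (simp add: ennreal_mult)
  qed
  also have "\<dots> = I + ennreal (CARD('m) * ?P)"
    using Ym unfolding I_def by (subst nn_integral_add) (auto simp: gaussian_second_moment_matrix n)
  finally have PI: "ennreal ?P \<le> I"
    by (simp add: ennreal_add_left_cancel_le add.commute[of _ "ennreal (CARD('m) * ?P)"])
  have "ennreal ?P = ennreal ((cmod (det Y))\<^sup>2) * I"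
    using nn_integral_linear[OF linear_matrix_vector inj_matrix_vector[OF d], of gauss]
    by (simp add: nn_integral_gauss_vec jac_matrix_vector[OF d] I_def)
  then have "ennreal ((cmod (det Y))\<^sup>2) * ennreal ?P \<le> ennreal ?P"
    using PI by (metis mult_left_mono zero_le)
  then have "(cmod (det Y))\<^sup>2 * ?P \<le> 1 * ?P"
    by (simp add: ennreal_mult[symmetric])
  then show ?thesis using P mult_le_cancel_right by blast
qed

lemma det_scaleR: "det (s *\<^sub>R Y) = of_real s ^ CARD('m) * det Y" for Y :: "complex ^ 'm ^ 'm"
  by (simp add: det_def) (simp add: scaleR_conv_of_real prod.distrib sum_distrib_left mult_ac)

text \<open>The arithmetic-geometric mean inequality for the squared singular values, obtained from
  \<open>det_le_1\<close> by rescaling \<open>Y\<close>.\<close>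

lemma cmod_det_le:
  fixes Y :: "complex ^ 'm ^ 'm"
  shows "(cmod (det Y))\<^sup>2 \<le> ((norm Y)\<^sup>2 / CARD('m)) ^ CARD('m)"
proof (cases "det Y = 0")
  case False
  have "Y \<noteq> 0"
  proof
    assume "Y = 0"
    then have "det Y = of_real 0 ^ CARD('m) * det Y" using det_scaleR[of 0 Y] by simp
    then show False using False by (simp add: power_0_left)
  qed
  define s where "s = sqrt (CARD('m)) / norm Y"
  have s: "s > 0" using \<open>Y \<noteq> 0\<close> by (simp add: s_def)
  have "(norm (s *\<^sub>R Y))\<^sup>2 = CARD('m)" using \<open>Y \<noteq> 0\<close> by (simp add: s_def)
  then have "(cmod (det (s *\<^sub>R Y)))\<^sup>2 \<le> 1" using False s by (intro det_le_1) (auto simp: det_scaleR)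
  then have "(s\<^sup>2) ^ CARD('m) * (cmod (det Y))\<^sup>2 \<le> 1"
    using s by (simp add: det_scaleR norm_mult norm_power power_mult_distrib power_mult[symmetric] mult.commute)
  moreover have "s\<^sup>2 = 1 / ((norm Y)\<^sup>2 / CARD('m))" by (simp add: s_def power_divide)
  ultimately show ?thesis using \<open>Y \<noteq> 0\<close> by (simp add: power_divide field_simps)
qed simp

text \<open>The origin of 11/2. The left side is (1 + m^(-3/2))^(2m), at most exp (2 / sqrt m). For
  m = 1 it equals 4; for m at least 2 the exponent is at most sqrt 2, hence at most 3/2, and exp 3
  is at most 27, below (11/2)^2.\<close>

lemma exp_bound_aux:
  fixes m :: nat
  assumes "m \<ge> 1"
  shows "((sqrt m + 1 / m)\<^sup>2 / m) ^ m \<le> 11 / 2"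
proof (cases "m = 1")
  case False
  then have m: "m \<ge> 2" using assms by simp
  have e: "(sqrt m + 1 / m)\<^sup>2 / m = (1 + 1 / (m * sqrt m))\<^sup>2"
    using m by (simp add: field_simps power2_eq_square)
  have "1 + 1 / (m * sqrt m) \<le> exp (1 / (m * sqrt m))" by (rule exp_ge_add_one_self)
  then have "(1 + 1 / (m * sqrt m)) ^ (2 * m) \<le> exp (1 / (m * sqrt m)) ^ (2 * m)"
    using m by (intro power_mono) auto
  also have "\<dots> = exp (2 / sqrt m)"
    using m by (simp add: exp_of_nat_mult[symmetric])
  also have "\<dots> \<le> exp (3 / 2)"
  proof -
    have "2 / sqrt m \<le> 2 / sqrt 2" using m by (intro divide_left_mono) auto
    also have "2 / sqrt 2 = sqrt 2" by (simp add: real_div_sqrt)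
    also have "sqrt 2 \<le> 3 / 2" by (rule real_le_lsqrt) (auto simp: power2_eq_square)
    finally show ?thesis by simp
  qed
  also have "\<dots> \<le> 11 / 2"
  proof -
    have "exp (3 / 2 :: real) ^ 2 = exp 1 ^ 3" by (simp add: exp_of_nat_mult[symmetric])
    also have "\<dots> \<le> 3 ^ 3" using exp_le by (intro power_mono) auto
    also have "\<dots> \<le> (11 / 2 :: real) ^ 2" by (simp add: power2_eq_square)
    finally show ?thesis by (rule power2_le_imp_le) simp
  qed
  finally show ?thesis unfolding e by (simp add: power_mult)
qed simp

section \<open>Comparing det B with det (z - B)\<close>

lemma matrix_mult_diff_left: "(A - B) ** C = A ** C - B ** C" for A B :: "complex ^ 'n ^ 'm"
  by (simp add: matrix_matrix_mult_def vec_eq_iff algebra_simps sum_subtractf)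

lemma matrix_mult_outer: "A ** outer x y = outer (A *v x) y"
  by (rule matrix_eqI_vec) (simp add: matrix_vector_mul_assoc[symmetric] outer_vec matrix_vector_smult)

text \<open>With X = z B' one has z - B = -(I - X) B, so det B is det (z - B) times det Y up to
  sign, for Y the inverse of I - X. Smallness of X keeps Y within Frobenius distance 1/m of the
  identity, m = \<open>CARD('m)\<close>, and \<open>cmod_det_le\<close> then bounds det Y.\<close>

lemma det_shift_bound:
  fixes B B' :: "complex ^ 'm ^ 'm"
  assumes inv: "B ** B' = mat 1" and small: "(real CARD('m) + 1) * cmod z * norm B' \<le> 1"
  shows "(cmod (det B))\<^sup>2 \<le> 11 / 2 * (cmod (det (cscale z (mat 1) - B)))\<^sup>2"
proof -
  let ?m = "CARD('m)"
  define X where "X = cscale z B'"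
  define E where "E = cscale z (mat 1) - B"
  have "cscale z B' = (\<chi> i. z *s B' $ i)" by (simp add: cscale_def vec_eq_iff)
  then have "(norm X)\<^sup>2 = (cmod z * norm B')\<^sup>2"
    by (simp add: X_def norm_vec_power2[of B'] norm_vec_power2[of "vec_lambda _"] norm_smult_vec power_mult_distrib sum_distrib_left)
  then have "norm X = cmod z * norm B'" by simp
  then have x: "norm X \<le> 1 / (real ?m + 1)" using small by (simp add: field_simps)
  have csc: "cscale z (mat 1) ** A = cscale z A" for A :: "complex ^ 'm ^ 'm"
    by (simp add: cscale_def matrix_matrix_mult_def mat_def vec_eq_iff if_distrib[of "\<lambda>t. t * _"] if_distrib[of "\<lambda>t. _ * t"] cong: if_cong)
  define T where "T = mat 1 - X"
  have EB: "E ** B' = (- 1) *\<^sub>R T"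
    using inv by (simp add: E_def X_def T_def matrix_mult_diff_left csc)
  have detT: "det T \<noteq> 0"
  proof
    assume "det T = 0"
    then obtain v where v: "v \<noteq> 0" "T *v v = 0"
      using invertible_det_nz[of T] matrix_left_invertible_ker[of T] by (auto simp: invertible_left_inverse)
    \<comment> \<open>The fixed vector is repeated as every column of a matrix, so that
      submultiplicativity of the Frobenius norm applies to it.\<close>
    define V :: "complex ^ 'm ^ 'm" where "V = outer v (\<chi> i. 1)"
    have "X *v v = v" using v(2) by (simp add: T_def matrix_vector_mult_diff_rdistrib)
    then have "X ** V = V" by (simp add: V_def matrix_mult_outer)
    then have "norm V \<le> norm X * norm V" using norm_matrix_mult_le[of X V] by simp
    moreover have "V \<noteq> 0" using v(1) by (auto simp: V_def outer_def vec_eq_iff)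
    moreover have "norm X < 1" using x by (rule order_le_less_trans) simp
    ultimately show False by (simp add: mult_le_cancel_right1)
  qed
  obtain Y where Y: "T ** Y = mat 1"
    using detT invertible_det_nz[of T] by (auto simp: invertible_def)
  have Y1: "Y = mat 1 + X ** Y"
    using Y by (simp add: T_def matrix_mult_diff_left algebra_simps)
  \<comment> \<open>If t is the norm of X Y, this identity gives t \<le> (1 + t) / (m + 1), that is
    t \<le> 1 / m.\<close>
  have "X ** Y = X + X ** (X ** Y)"
    by (subst Y1) (simp add: matrix_mult_add_right)
  then have "norm (X ** Y) \<le> norm X + norm (X ** (X ** Y))"
    by (metis norm_triangle_ineq)
  also have "norm (X ** (X ** Y)) \<le> norm X * norm (X ** Y)" by (rule norm_matrix_mult_le)
  also have "norm X + norm X * norm (X ** Y) = norm X * (1 + norm (X ** Y))" by (simp add: algebra_simps)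
  also have "\<dots> \<le> 1 / (real ?m + 1) * (1 + norm (X ** Y))" using x by (intro mult_right_mono) auto
  finally have XY: "norm (X ** Y) \<le> 1 / ?m"
    by (simp add: field_simps)
  have "(norm (mat 1 :: complex ^ 'm ^ 'm))\<^sup>2 = real ?m"
    by (simp add: norm_vec_power2 mat_def if_distrib[of norm] if_distrib[of "\<lambda>x. x\<^sup>2"] cong: if_cong)
  then have "norm (mat 1 :: complex ^ 'm ^ 'm) = sqrt ?m"
    by (metis norm_ge_zero real_sqrt_unique)
  then have "norm Y \<le> sqrt ?m + 1 / ?m"
    using norm_triangle_ineq[of "mat 1" "X ** Y"] XY Y1 by simp
  then have "((norm Y)\<^sup>2 / ?m) ^ ?m \<le> ((sqrt ?m + 1 / ?m)\<^sup>2 / ?m) ^ ?m"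
    by (intro power_mono divide_right_mono) auto
  also have "\<dots> \<le> 11 / 2" by (rule exp_bound_aux) (simp add: Suc_le_eq)
  finally have dY: "(cmod (det Y))\<^sup>2 \<le> 11 / 2" using cmod_det_le[of Y] by linarith
  have 1: "cmod (det E) * cmod (det B') = cmod (det T)"
  proof -
    have "det E * det B' = of_real (- 1) ^ ?m * det T"
      by (simp only: det_mul[symmetric] EB det_scaleR)
    then have "cmod (det E * det B') = cmod (of_real (- 1) ^ ?m * det T)" by (rule arg_cong)
    then show ?thesis by (simp add: norm_mult norm_power)
  qed
  have 2: "cmod (det B) * cmod (det B') = 1" and 3: "cmod (det T) * cmod (det Y) = 1"
    using arg_cong[OF inv, of det] arg_cong[OF Y, of det] by (simp_all add: det_mul flip: norm_mult)
  have "cmod (det B) = cmod (det B) * (cmod (det T) * cmod (det Y))" by (simp add: 3)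
  also have "\<dots> = cmod (det E) * (cmod (det B) * cmod (det B')) * cmod (det Y)" by (simp add: 1[symmetric])
  finally have "(cmod (det B))\<^sup>2 = (cmod (det E))\<^sup>2 * (cmod (det Y))\<^sup>2"
    by (simp add: 2 power_mult_distrib)
  then show ?thesis
    using mult_left_mono[OF dY, of "(cmod (det E))\<^sup>2"] by (simp add: E_def mult.commute)
qed

section \<open>Cofactors of Gaussian matrices\<close>

definition rowrep :: "complex ^ 'm ^ 'm \<Rightarrow> 'm \<Rightarrow> complex ^ 'm \<Rightarrow> complex ^ 'm ^ 'm" where
  "rowrep B i b = (\<chi> k. if k = i then b else B $ k)"

text \<open>The squared Frobenius norm of the cofactor matrix. For invertible B it is |det B|^2
  times the squared norm of the inverse, but it is continuous on all matrices.\<close>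

definition cofsum :: "complex ^ 'm ^ 'm \<Rightarrow> real" where
  "cofsum B = (\<Sum>i\<in>UNIV. \<Sum>j\<in>UNIV. (cmod (det (rowrep B i (axis j 1))))\<^sup>2)"

lemma det_rowrep: "det (rowrep B i b) = cdot (\<chi> j. det (rowrep B i (axis j 1))) b"
proof -
  have b: "b = (\<Sum>j\<in>UNIV. b $ j *s axis j 1)"
    by (simp add: vec_eq_iff axis_nth if_distrib[of "\<lambda>x. _ * x"] cong: if_cong)
  have "det (rowrep B i b) = (\<Sum>j\<in>UNIV. det (\<chi> k. if k = i then b $ j *s axis j 1 else B $ k))"
    unfolding rowrep_def by (subst b) (rule det_linear_row_sum[OF finite_class.finite_UNIV])
  also have "\<dots> = (\<Sum>j\<in>UNIV. b $ j * det (rowrep B i (axis j 1)))"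
    unfolding rowrep_def by (intro sum.cong refl) (rule det_row_mul)
  finally show ?thesis by (simp add: cdot_def mult.commute)
qed

lemma det_rowrep_inverse:
  assumes "B' ** B = mat 1"
  shows "det (rowrep B i (axis j 1)) = B' $ j $ i * det B"
proof -
  have "axis j 1 = (\<Sum>k\<in>UNIV. B' $ j $ k *s row k B)"
    using assms by (simp add: vec_eq_iff matrix_matrix_mult_def mat_def row_def axis_nth)
  then have "rowrep B i (axis j 1) = (\<chi> k. if k = i then \<Sum>k\<in>UNIV. B' $ j $ k *s row k B else row k B)"
    by (simp add: rowrep_def row_def vec_eq_iff)
  then show ?thesis using cramer_lemma_transpose[where k = i and x = "B' $ j" and A = B] by simp
qed

lemma cofsum_inverse:
  assumes "B' ** B = mat 1"
  shows "cofsum B = (norm B')\<^sup>2 * (cmod (det B))\<^sup>2"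
proof -
  have "cofsum B = (\<Sum>i\<in>UNIV. \<Sum>j\<in>UNIV. (cmod (B' $ j $ i))\<^sup>2 * (cmod (det B))\<^sup>2)"
    unfolding cofsum_def det_rowrep_inverse[OF assms] by (simp add: norm_mult power_mult_distrib)
  also have "\<dots> = (norm (cadj B'))\<^sup>2 * (cmod (det B))\<^sup>2"
    unfolding norm_matrix_power2 by (simp add: cadj_def sum_distrib_right)
  finally show ?thesis by (simp add: norm_cadj)
qed

lemma continuous_on_rowrep [continuous_intros]:
  fixes f :: "'x::topological_space \<Rightarrow> complex ^ 'm ^ 'm"
  assumes f: "continuous_on S f" and g: "continuous_on S g"
  shows "continuous_on S (\<lambda>x. rowrep (f x) i (g x))"
proof -
  have "continuous_on S (\<lambda>x. if k = i then g x else f x $ k)" for k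
    by (cases "k = i") (auto intro!: continuous_intros f g)
  then show ?thesis unfolding rowrep_def by (intro continuous_intros)
qed

lemma continuous_on_cofsum [continuous_intros]:
  "continuous_on S f \<Longrightarrow> continuous_on S (\<lambda>x. cofsum (f x))"
  unfolding cofsum_def by (intro continuous_intros)

text \<open>Exchanging row \<open>i\<close> of a Gaussian matrix with an independent Gaussian vector preserves the measure.\<close>
lemma nn_integral_cofsum:
  "(\<integral>\<^sup>+B. ennreal (cofsum B) * gauss B \<partial>(lborel :: (complex ^ 'm ^ 'm) measure))
    = of_nat CARD('m) * (\<integral>\<^sup>+B. ennreal ((cmod (det B))\<^sup>2) * gauss B \<partial>(lborel :: (complex ^ 'm ^ 'm) measure))"
proof -
  let ?P = "ennreal (pi ^ CARD('m))"
  define D where "D = (\<integral>\<^sup>+B. ennreal ((cmod (det B))\<^sup>2) * gauss B \<partial>(lborel :: (complex ^ 'm ^ 'm) measure))"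
  have detm [measurable]: "(\<lambda>B :: complex ^ 'm ^ 'm. det B) \<in> borel_measurable borel"
    by (intro borel_measurable_continuous_onI continuous_intros)
  have rm [measurable]: "(\<lambda>B. rowrep B i b) \<in> borel_measurable borel" for i b
    by (intro borel_measurable_continuous_onI continuous_intros)
  have row: "(\<integral>\<^sup>+B. ennreal (\<Sum>j\<in>UNIV. (cmod (det (rowrep B i (axis j 1))))\<^sup>2) * gauss B \<partial>lborel) = D" for i :: 'm
  proof -
    let ?c = "\<lambda>B. \<chi> j. det (rowrep B i (axis j 1))"
    let ?h = "\<lambda>p :: (complex ^ 'm ^ 'm) \<times> (complex ^ 'm). ennreal ((cmod (det (fst p)))\<^sup>2) * gauss p"
    let ?s = "\<lambda>p :: (complex ^ 'm ^ 'm) \<times> (complex ^ 'm). (rowrep (fst p) i (snd p), fst p $ i)"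
    have hm: "?h \<in> borel_measurable borel"
    proof -
      have "(fst :: (complex ^ 'm ^ 'm) \<times> (complex ^ 'm) \<Rightarrow> _) \<in> borel_measurable borel"
        by (intro borel_measurable_continuous_onI continuous_intros)
      then show ?thesis by measurable
    qed
    have s: "linear ?s"
      by (rule linearI) (auto simp: rowrep_def vec_eq_iff)
    have "norm (?s p) = norm p" for p
    proof -
      have "(\<Sum>k\<in>UNIV. (norm (rowrep (fst p) i (snd p) $ k))\<^sup>2) + (norm (fst p $ i))\<^sup>2
          = (\<Sum>k\<in>UNIV. (norm (fst p $ k))\<^sup>2) + (norm (snd p))\<^sup>2"
        unfolding sum.remove[OF finite_class.finite_UNIV UNIV_I[of i]]
        by (simp add: rowrep_def)
      then have "(norm (rowrep (fst p) i (snd p)))\<^sup>2 + (norm (fst p $ i))\<^sup>2 = (norm (fst p))\<^sup>2 + (norm (snd p))\<^sup>2"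
        by (simp only: norm_vec_power2[of "rowrep _ _ _"] norm_vec_power2[of "fst p"])
      then have "(norm (?s p))\<^sup>2 = (norm p)\<^sup>2" by (cases p) (simp add: norm_Pair)
      then show ?thesis by simp
    qed
    note iso = nn_integral_isometry[OF s this hm] and n = this
    have g: "gauss (B, b) = gauss B * gauss b" for B :: "complex ^ 'm ^ 'm" and b :: "complex ^ 'm"
      by (simp add: norm_Pair exp_add[symmetric] ennreal_mult[symmetric])
    have "(\<integral>\<^sup>+p. ?h p \<partial>lborel) = (\<integral>\<^sup>+B. \<integral>\<^sup>+b. ?h (B, b) \<partial>lborel \<partial>lborel)"
      by (rule nn_integral_lborel_prod_iter(2)[OF hm])
    also have "\<dots> = D * ?P"
      by (simp add: g D_def nn_integral_cmult nn_integral_multc nn_integral_gauss_vec mult.assoc[symmetric])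
    finally have 1: "(\<integral>\<^sup>+p. ?h p \<partial>lborel) = D * ?P" .
    \<comment> \<open>After the exchange the determinant is linear in \<open>b\<close>, with the
      cofactors of row \<open>i\<close> as coefficients. Its Gaussian second moment in
      \<open>b\<close> is therefore their sum of squares.\<close>
    have "(\<integral>\<^sup>+p. ?h (?s p) \<partial>lborel) = (\<integral>\<^sup>+B. \<integral>\<^sup>+b. ?h (?s (B, b)) \<partial>lborel \<partial>lborel)"
      using measurable_compose[OF linear_borel_measurable[OF s] hm] by (rule nn_integral_lborel_prod_iter(2))
    also have "\<dots> = (\<integral>\<^sup>+B. gauss B * (\<integral>\<^sup>+b. ennreal ((cmod (cdot (?c B) b))\<^sup>2) * gauss b \<partial>lborel) \<partial>lborel)"
    proof (rule nn_integral_cong)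
      fix B :: "complex ^ 'm ^ 'm"
      have m [measurable]: "(\<lambda>b. cdot (?c B) b) \<in> borel_measurable borel" by (rule linear_borel_measurable[OF linear_cdot])
      have "(\<integral>\<^sup>+b. ?h (?s (B, b)) \<partial>lborel) = (\<integral>\<^sup>+b. gauss B * (ennreal ((cmod (cdot (?c B) b))\<^sup>2) * gauss b) \<partial>lborel)"
      proof (intro nn_integral_cong)
        fix b
        note dr = det_rowrep[of B i b, symmetric]
        show "?h (?s (B, b)) = gauss B * (ennreal ((cmod (cdot (?c B) b))\<^sup>2) * gauss b)"
          unfolding n g dr by (simp add: mult_ac)
      qed
      also have "\<dots> = gauss B * (\<integral>\<^sup>+b. ennreal ((cmod (cdot (?c B) b))\<^sup>2) * gauss b \<partial>lborel)"
        by (rule nn_integral_cmult) measurable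
      finally show "(\<integral>\<^sup>+b. ?h (?s (B, b)) \<partial>lborel) = gauss B * (\<integral>\<^sup>+b. ennreal ((cmod (cdot (?c B) b))\<^sup>2) * gauss b \<partial>lborel)" .
    qed
    also have "\<dots> = (\<integral>\<^sup>+B. (ennreal (\<Sum>j\<in>UNIV. (cmod (det (rowrep B i (axis j 1))))\<^sup>2) * gauss B) * ?P \<partial>lborel)"
    proof (rule nn_integral_cong)
      fix B :: "complex ^ 'm ^ 'm"
      have "(\<integral>\<^sup>+b. ennreal ((cmod (cdot (?c B) b))\<^sup>2) * gauss b \<partial>lborel)
          = ennreal (\<Sum>j\<in>UNIV. (cmod (det (rowrep B i (axis j 1))))\<^sup>2) * ?P"
        by (simp add: gaussian_second_moment_cdot norm_vec_power2[of "?c B"] ennreal_mult sum_nonneg)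
      then show "gauss B * (\<integral>\<^sup>+b. ennreal ((cmod (cdot (?c B) b))\<^sup>2) * gauss b \<partial>lborel)
          = ennreal (\<Sum>j\<in>UNIV. (cmod (det (rowrep B i (axis j 1))))\<^sup>2) * gauss B * ?P"
        by (simp only: mult_ac)
    qed
    also have "\<dots> = (\<integral>\<^sup>+B. ennreal (\<Sum>j\<in>UNIV. (cmod (det (rowrep B i (axis j 1))))\<^sup>2) * gauss B \<partial>lborel) * ?P"
      by (rule nn_integral_multc) measurable
    finally have "(\<integral>\<^sup>+B. ennreal (\<Sum>j\<in>UNIV. (cmod (det (rowrep B i (axis j 1))))\<^sup>2) * gauss B \<partial>lborel) * ?P = D * ?P"
      using 1 iso by simp
    then show ?thesis by (simp add: ennreal_mult_cancel_left mult.commute[of _ ?P])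
  qed
  have "(\<integral>\<^sup>+B. ennreal (cofsum B) * gauss B \<partial>(lborel :: (complex ^ 'm ^ 'm) measure))
      = (\<integral>\<^sup>+B. (\<Sum>i\<in>UNIV. ennreal (\<Sum>j\<in>UNIV. (cmod (det (rowrep B i (axis j 1))))\<^sup>2) * gauss B) \<partial>(lborel :: (complex ^ 'm ^ 'm) measure))"
    by (intro nn_integral_cong) (simp add: cofsum_def sum_distrib_right[symmetric] sum_ennreal sum_nonneg)
  also have "\<dots> = (\<Sum>i\<in>(UNIV :: 'm set). D)"
    by (subst nn_integral_sum) (auto simp: row)
  finally show ?thesis by (simp add: D_def)
qed

section \<open>The Schur form at an eigenpair\<close>

text \<open>One type in two roles: ((l, u), (w, D)) lists an eigenvalue, the eigenvector (1, u), the
  first row and the lower block, while ((a, c), (w, D)) lists the blocks of a matrix. The chart thus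
  becomes an endomorphism that fixes its second component.\<close>

type_synonym 'm chart = "(complex \<times> (complex ^ 'm)) \<times> ((complex ^ 'm) \<times> (complex ^ 'm ^ 'm))"

definition ext :: "complex \<Rightarrow> complex ^ 'm \<Rightarrow> complex ^ ('m option)" where
  "ext \<alpha> u = (\<chi> i. case i of None \<Rightarrow> \<alpha> | Some i \<Rightarrow> u $ i)"

lemma blk_ext: "blk a w c D *v ext \<alpha> v = ext (a * \<alpha> + cdot (cnjv w) v) (\<alpha> *s c + D *v v)"
  by (auto simp: blk_def ext_def matrix_vector_mult_def cdot_def vec_eq_iff sum_option mult.commute split: option.splits)

lemma blk_mult: "blk a w c D ** blk a' w' c' D' =
  blk (a * a' + cdot (cnjv w) c') (cnj a *s w' + cadj D' *v w) (a' *s c + D *v c') (outer c (cnjv w') + D ** D')"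
proof -
  have "(blk a w c D ** blk a' w' c' D') $ i $ j =
    blk (a * a' + cdot (cnjv w) c') (cnj a *s w' + cadj D' *v w) (a' *s c + D *v c') (outer c (cnjv w') + D ** D') $ i $ j" for i j
    by (cases i; cases j)
      (auto simp: blk_def cdot_def cadj_def outer_def matrix_matrix_mult_def matrix_vector_mult_def sum_option mult.commute)
  then show ?thesis by (simp add: vec_eq_iff)
qed

lemma cadj_blk: "cadj (blk a w c D) = blk (cnj a) c w (cadj D)"
  by (auto simp: blk_def cadj_def vec_eq_iff split: option.splits)

lemma blk_eq_iff: "blk a w c D = blk a' w' c' D' \<longleftrightarrow> a = a' \<and> w = w' \<and> c = c' \<and> D = D'"
proof
  assume "blk a w c D = blk a' w' c' D'"
  then have "blk a w c D $ i $ j = blk a' w' c' D' $ i $ j" for i j by simp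
  from this[of None None] this[of None "Some _"] this[of "Some _" None] this[of "Some _" "Some _"]
  show "a = a' \<and> w = w' \<and> c = c' \<and> D = D'"
    by (auto simp: blk_def vec_eq_iff)
qed simp

lemma mat_1_blk: "mat 1 = blk 1 0 0 (mat 1)"
  by (auto simp: blk_def mat_def vec_eq_iff split: option.splits)

lemma blk_surj: "\<exists>a w c D. A = blk a w c D"
proof (intro exI)
  show "A = blk (A $ None $ None) (\<chi> j. cnj (A $ None $ Some j)) (\<chi> i. A $ Some i $ None) (\<chi> i j. A $ Some i $ Some j)"
    by (auto simp: blk_def vec_eq_iff split: option.splits)
qed

lemma ext_eq_iff: "ext \<alpha> u = ext \<beta> v \<longleftrightarrow> \<alpha> = \<beta> \<and> u = v"
proof
  assume "ext \<alpha> u = ext \<beta> v"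
  then have "ext \<alpha> u $ i = ext \<beta> v $ i" for i by simp
  from this[of None] this[of "Some _"] show "\<alpha> = \<beta> \<and> u = v" by (auto simp: ext_def vec_eq_iff)
qed simp

lemma ext_0: "ext 0 0 = 0"
  by (simp add: ext_def vec_eq_iff split: option.splits)

lemma smult_ext: "c *s ext \<alpha> u = ext (c * \<alpha>) (c *s u)"
  by (auto simp: ext_def vec_eq_iff split: option.splits)

lemma Vn_iff: "(A, l, v) \<in> Vn \<longleftrightarrow> v \<noteq> 0 \<and> A *v v = l *s v"
proof -
  have "cscale l (mat 1) *v v = l *s v"
    by (simp add: cscale_def mat_def matrix_vector_mult_def vec_eq_iff if_distrib[of "\<lambda>t. _ * t"] if_distrib[of "\<lambda>t. t * _"] cong: if_cong)
  then show ?thesis by (auto simp: Vn_def matrix_vector_mult_diff_rdistrib)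
qed

text \<open>The change of basis to the Schur form: the first column is (1, u) scaled to length 1.
  With the inverse square root S of I + u u^H as lower block, unitarity reduces to S u = r u and S^2
  = I - r^2 u u^H, where r is \<open>shrink u\<close>.\<close>

definition mat_P :: "complex ^ 'm \<Rightarrow> complex ^ ('m option) ^ ('m option)" where
  "mat_P u = blk (of_real (shrink u)) (- (of_real (shrink u) *s u)) (of_real (shrink u) *s u) (mat_S u)"

lemma cadj_S: "cadj (mat_S u) = mat_S u"
  by (simp add: mat_S_def cadj_herm_rank1)

lemma cadj_P: "cadj (mat_P u) = blk (of_real (shrink u)) (of_real (shrink u) *s u) (- (of_real (shrink u) *s u)) (mat_S u)"
  by (simp add: mat_P_def cadj_blk cadj_S)

lemma cnjv_smult: "cnjv (c *s u) = cnj c *s cnjv u" and cnjv_minus: "cnjv (- u) = - cnjv u"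
  by (simp_all add: cnjv_def vec_eq_iff)

lemma cdot_smult_left: "cdot (c *s x) y = c * cdot x y"
  by (simp_all add: cdot_def sum_distrib_left sum_negf algebra_simps sum.distrib)

lemma outer_smult_left: "outer (c *s x) y = cscale c (outer x y)"
  and outer_smult_right: "outer x (c *s y) = cscale c (outer x y)"
  by (simp_all add: outer_def cscale_def vec_eq_iff algebra_simps)

lemma matrix_vector_minus: "A *v (- x) = - (A *v x :: complex ^ 'm)"
  by (simp add: matrix_vector_mult_def vec_eq_iff sum_negf)

lemma unitary_P: "cadj (mat_P u) ** mat_P u = mat 1"
proof -
  let ?r = "complex_of_real (shrink u)"
  have r: "?r * ?r + ?r * ?r * of_real ((norm u)\<^sup>2) = 1"
    using arg_cong[OF shrink_power2[of u], of complex_of_real] by (simp add: power2_eq_square algebra_simps)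
  have S: "mat_S u ** mat_S u = mat 1 - cscale (?r * ?r) (outer u (cnjv u))"
    by (simp add: SS herm_rank1_def outer_def cscale_def vec_eq_iff power2_eq_square)
  have 1: "?r * ?r + cdot (cnjv (?r *s u)) (?r *s u) = 1"
    using r by (simp add: cnjv_smult cdot_smult_left cdot_smult_right cdot_cnjv mult.assoc)
  have 2: "cnj ?r *s (- (?r *s u)) + mat_S u *v (?r *s u) = 0"
    by (simp add: matrix_vector_smult S_vec_self vec_eq_iff)
  have 3: "?r *s (- (?r *s u)) + mat_S u *v (?r *s u) = 0"
    by (simp add: matrix_vector_smult S_vec_self vec_eq_iff)
  have 4: "outer (- (?r *s u)) (cnjv (- (?r *s u))) + mat_S u ** mat_S u = mat 1"
    unfolding S by (simp add: cnjv_minus cnjv_smult outer_def cscale_def vec_eq_iff)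
  show ?thesis
    unfolding cadj_P by (simp only: mat_P_def blk_mult 1 cadj_S 2 3 4 mat_1_blk)
qed

lemma matrix_inv_unitary:
  fixes P :: "complex ^ 'n ^ 'n"
  assumes "cadj P ** P = mat 1"
  shows "matrix_inv P = cadj P"
proof -
  have P': "P ** cadj P = mat 1" using assms by (rule matrix_left_right_inverse[THEN iffD1])
  then have "P ** matrix_inv P = mat 1"
    unfolding matrix_inv_def using assms by (metis (mono_tags, lifting) someI_ex)
  then have "cadj P ** P ** matrix_inv P = cadj P" by (simp add: matrix_mul_assoc[symmetric])
  then show ?thesis using assms by simp
qed

lemma P_e1: "mat_P u *v ext 1 0 = of_real (shrink u) *s ext 1 u"
  by (simp add: mat_P_def blk_ext smult_ext) (simp add: cdot_def)

lemma norm_unitary_conj: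
  fixes P :: "complex ^ 'n ^ 'n"
  assumes P: "cadj P ** P = mat 1"
  shows "norm (P ** T ** cadj P) = norm T"
proof -
  have P': "P ** cadj P = mat 1" using P by (rule matrix_left_right_inverse[THEN iffD1])
  have right: "norm (X ** V) = norm X" if "V ** cadj V = mat 1" for X V :: "complex ^ 'n ^ 'n"
  proof (rule norm_eq_of_gram_eq)
    have "X ** V ** cadj (X ** V) = X ** V ** (cadj V ** cadj X)" by (simp only: cadj_mult)
    also have "\<dots> = X ** (V ** cadj V) ** cadj X" by (simp only: matrix_mul_assoc)
    also have "\<dots> = X ** cadj X" by (simp only: that matrix_mul_rid)
    finally show "X ** V ** cadj (X ** V) = X ** cadj X" .
  qed
  have nc: "norm (cadj X) = norm X" for X :: "complex ^ 'n ^ 'n"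
  proof -
    have "(\<Sum>i\<in>UNIV. \<Sum>j\<in>UNIV. (cmod (X $ j $ i))\<^sup>2) = (\<Sum>i\<in>UNIV. \<Sum>j\<in>UNIV. (cmod (X $ i $ j))\<^sup>2)"
      by (rule sum.swap)
    then show ?thesis by (simp add: norm_vec_def L2_set_def cadj_def sum_nonneg)
  qed
  have "norm (P ** T ** cadj P) = norm (P ** T)" by (rule right) (simp add: P)
  also have "\<dots> = norm (cadj T ** cadj P)" using nc[of "P ** T"] by (simp add: cadj_mult)
  also have "\<dots> = norm (cadj T)" by (rule right) (simp add: P)
  finally show ?thesis by (simp add: nc)
qed

text \<open>The vector (1, u) is an eigenvector for l of the matrix with blocks a, w, c, D exactly
  when a = l - w^H u and c = l u - D u.\<close>

definition eig_chart :: "('m::finite) chart \<Rightarrow> 'm chart" where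
  "eig_chart = (\<lambda>((l, u), (w, D)). ((l - cdot (cnjv w) u, l *s u - D *v u), (w, D)))"

definition of_chart :: "('m::finite) chart \<Rightarrow> complex ^ ('m option) ^ ('m option)" where
  "of_chart p = blk (fst (fst p)) (fst (snd p)) (snd (fst p)) (snd (snd p))"

lemma of_chart_simp [simp]: "of_chart ((a, c), (w, D)) = blk a w c D"
  by (simp add: of_chart_def)

lemma eig_chart_eigen: "of_chart (eig_chart ((l, u), (w, D))) *v ext 1 u = l *s ext 1 u"
  by (simp add: eig_chart_def blk_ext smult_ext ext_eq_iff)

lemma eig_chart_Vn: "(of_chart (eig_chart ((l, u), (w, D))), l, ext 1 u) \<in> Vn"
proof -
  have "ext 1 u \<noteq> 0" using ext_eq_iff[of 1 u 0 0] by (simp add: ext_0)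
  then show ?thesis by (simp add: Vn_iff eig_chart_eigen)
qed

text \<open>Chart coordinates of a conjugated Schur form. For fixed l and u the passage from (w',
  B') to (w, D) is affine and triangular: w is affine in w' once B' is fixed, and D is affine in B'
  once w is fixed. This makes its Jacobian accessible.\<close>

lemma unitary_chart:
  fixes u w' :: "complex ^ 'm" and B' :: "complex ^ 'm ^ 'm" and l :: complex
  defines "r \<equiv> complex_of_real (shrink u)"
  defines "w \<equiv> (r *s (mat_S u *v w') + ((r * r * cnj l) *s u - r *s (mat_S u *v (cadj B' *v u))))"
  shows "of_chart (eig_chart ((l, u), (w, mat_K u ** B' ** mat_S u + outer u (cnjv w))))
       = mat_P u ** blk l w' 0 B' ** cadj (mat_P u)" (is "of_chart (eig_chart ((l, u), (w, ?D))) = ?A")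
proof -
  \<comment> \<open>The rank-one difference of K and S cancels the term containing B' in u w^H,
    which leaves S B' S in the lower block.\<close>
  have KS': "mat_K u = mat_S u + cscale r (outer u (cnjv u))"
  proof -
    have "shrink u / (1 + shrink u) = - ((shrink u)\<^sup>2 / (1 + shrink u)) + shrink u"
      using shrink_nz[of u] by (simp add: field_simps power2_eq_square)
    then have "complex_of_real (shrink u / (1 + shrink u)) = complex_of_real (- ((shrink u)\<^sup>2 / (1 + shrink u))) + r"
      by (metis of_real_add r_def)
    then show ?thesis
      by (simp only: mat_K_def mat_S_def herm_rank1_def)
         (simp add: outer_def cscale_def vec_eq_iff algebra_simps)
  qed
  obtain a c w2 D2 where A: "?A = blk a w2 c D2" using blk_surj by blast
  have PT: "mat_P u ** blk l w' 0 B' = blk (r * l) (r *s w' - r *s (cadj B' *v u)) ((l * r) *s u)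
      (cscale r (outer u (cnjv w')) + mat_S u ** B')"
    unfolding mat_P_def blk_mult
    by (simp add: blk_eq_iff r_def[symmetric] cdot_def matrix_vector_minus matrix_vector_smult outer_smult_left
        matrix_vector_mult_0_right vec_eq_iff) (simp add: r_def)
  have w2: "w2 = w" and D2: "D2 = ?D"
  proof -
    have "?A = blk (r * l) (r *s w' - r *s (cadj B' *v u)) ((l * r) *s u) (cscale r (outer u (cnjv w')) + mat_S u ** B')
      ** blk r (r *s u) (- (r *s u)) (mat_S u)"
      by (simp add: PT cadj_P r_def)
    then have e: "w2 = cnj (r * l) *s (r *s u) + cadj (mat_S u) *v (r *s w' - r *s (cadj B' *v u))"
      "D2 = outer ((l * r) *s u) (cnjv (r *s u)) + (cscale r (outer u (cnjv w')) + mat_S u ** B') ** mat_S u"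
      unfolding blk_mult using A by (simp_all add: blk_eq_iff)
    show w2: "w2 = w"
      unfolding e(1) w_def cadj_S
      by (simp add: matrix_vector_mult_diff_distrib matrix_vector_smult vec_eq_iff r_def algebra_simps)
    have o1: "outer x (cnjv (X *v y)) = outer x (cnjv y) ** cadj X" for x y :: "complex ^ 'm" and X :: "complex ^ 'm ^ 'm"
      by (rule matrix_eqI_vec) (simp add: matrix_vector_mul_assoc[symmetric] outer_vec cdot_cnjv_adjoint)
    have cs: "cscale k X ** Y = cscale k (X ** Y)" for k and X Y :: "complex ^ 'm ^ 'm"
      by (simp add: cscale_def matrix_matrix_mult_def vec_eq_iff sum_distrib_left mult.assoc)
    have ow: "outer u (cnjv w) = cscale r (outer u (cnjv w') ** mat_S u) + cscale (r * r * l) (outer u (cnjv u))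
        - cscale r (outer u (cnjv u) ** B' ** mat_S u)"
    proof -
      have "cnjv w = r *s cnjv (mat_S u *v w') + (r * r * l) *s cnjv u - r *s cnjv (mat_S u *v (cadj B' *v u))"
        by (simp add: w_def cnjv_def vec_eq_iff r_def)
      moreover have "outer u (k1 *s x + k2 *s y - k1 *s z) = cscale k1 (outer u x) + cscale k2 (outer u y) - cscale k1 (outer u z)"
        for k1 k2 x y z by (simp add: outer_def cscale_def vec_eq_iff algebra_simps)
      ultimately have "outer u (cnjv w) = cscale r (outer u (cnjv (mat_S u *v w'))) + cscale (r * r * l) (outer u (cnjv u))
        - cscale r (outer u (cnjv (mat_S u *v (cadj B' *v u))))" by (simp only:)
      then show ?thesis by (simp add: o1 cadj_S matrix_mul_assoc)
    qed
    have cr: "cnjv (r *s u) = r *s cnjv u" by (simp add: cnjv_def vec_eq_iff r_def)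
    show "D2 = ?D"
      unfolding e(2) ow KS' cr
      by (simp add: matrix_mult_add_left cs outer_smult_left outer_smult_right)
         (simp add: cscale_def vec_eq_iff algebra_simps)
  qed
  \<comment> \<open>The first column of the conjugate is not multiplied out; the eigenvector
    equation for (1, u) determines it.\<close>
  have "?A *v (of_real (shrink u) *s ext 1 u) = mat_P u *v (blk l w' 0 B' *v (cadj (mat_P u) *v (mat_P u *v ext 1 0)))"
    by (simp add: P_e1 matrix_vector_mul_assoc matrix_mul_assoc)
  also have "\<dots> = mat_P u *v (blk l w' 0 B' *v ext 1 0)"
    by (simp add: matrix_vector_mul_assoc[of "cadj (mat_P u)"] unitary_P)
  also have "blk l w' 0 B' *v ext 1 0 = l *s ext 1 0"
    by (simp add: blk_ext smult_ext ext_eq_iff) (simp add: cdot_def)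
  finally have "of_real (shrink u) *s (?A *v ext 1 u) = of_real (shrink u) *s (l *s ext 1 u)"
    by (simp add: matrix_vector_smult P_e1 vec_eq_iff)
  then have "?A *v ext 1 u = l *s ext 1 u"
    using shrink_pos[of u] by (simp add: vec_eq_iff)
  then have "a = l - cdot (cnjv w) u" "c = l *s u - ?D *v u"
    unfolding A w2 D2 blk_ext smult_ext ext_eq_iff by (auto simp: algebra_simps eq_diff_eq)
  then show ?thesis unfolding A w2 D2 by (simp add: eig_chart_def)
qed

section \<open>The eigenpair chart\<close>

lemma bilinear_bounded:
  fixes h :: "'a::euclidean_space \<Rightarrow> 'b::euclidean_space \<Rightarrow> 'c::euclidean_space"
  assumes "\<And>x. linear (h x)" "\<And>y. linear (\<lambda>x. h x y)"
  shows "bounded_bilinear h"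
  using assms bilinear_conv_bounded_bilinear by (auto simp: bilinear_def)

lemma bounded_bilinear_sesq: "bounded_bilinear (\<lambda>w u. cdot (cnjv w) u)"
  by (rule bilinear_bounded[OF linear_cdot])
     (rule linearI, auto simp: cdot_def cnjv_def algebra_simps sum.distrib scaleR_sum_right)

lemma bounded_bilinear_smult: "bounded_bilinear (\<lambda>(l :: complex) (u :: complex ^ 'm). l *s u)"
  by (rule bilinear_bounded; rule linearI) (auto simp: vec_eq_iff algebra_simps)

lemma bounded_bilinear_mv: "bounded_bilinear (\<lambda>(D :: complex ^ 'm ^ 'm) u. D *v u)"
  by (rule bilinear_bounded[OF linear_matrix_vector])
     (rule linearI, auto simp: matrix_vector_mult_def vec_eq_iff algebra_simps sum.distrib scaleR_sum_right)

definition eig_chart_deriv :: "('m::finite) chart \<Rightarrow> 'm chart \<Rightarrow> 'm chart" where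
  "eig_chart_deriv = (\<lambda>((l, u), (w, D)) ((dl, du), (dw, dD)).
    ((dl - cdot (cnjv w) du - cdot (cnjv dw) u, dl *s u + l *s du - D *v du - dD *v u), (dw, dD)))"

lemma eig_chart_has_derivative:
  fixes p :: "('m::finite) chart"
  shows "(eig_chart has_derivative eig_chart_deriv p) (at p)"
proof -
  have d: "((\<lambda>p :: 'm chart. fst (fst p)) has_derivative (\<lambda>p. fst (fst p))) (at p)"
    "((\<lambda>p :: 'm chart. snd (fst p)) has_derivative (\<lambda>p. snd (fst p))) (at p)"
    "((\<lambda>p :: 'm chart. fst (snd p)) has_derivative (\<lambda>p. fst (snd p))) (at p)"
    "((\<lambda>p :: 'm chart. snd (snd p)) has_derivative (\<lambda>p. snd (snd p))) (at p)" for p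
    by (intro has_derivative_fst has_derivative_snd has_derivative_ident)+
  note b1 = bounded_bilinear.FDERIV[OF bounded_bilinear_sesq d(3) d(2)]
  note b2 = bounded_bilinear.FDERIV[OF bounded_bilinear_smult d(1) d(2)]
  note b3 = bounded_bilinear.FDERIV[OF bounded_bilinear_mv d(4) d(2)]
  have e: "eig_chart = (\<lambda>p. ((fst (fst p) - cdot (cnjv (fst (snd p))) (snd (fst p)),
      fst (fst p) *s snd (fst p) - snd (snd p) *v snd (fst p)), (fst (snd p), snd (snd p))))"
    by (auto simp: eig_chart_def)
  show ?thesis unfolding e
    by (rule has_derivative_eq_rhs[OF has_derivative_Pair[OF has_derivative_Pair[OF
          has_derivative_diff[OF d(1) b1] has_derivative_diff[OF b2 b3]] has_derivative_Pair[OF d(3) d(4)]]])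
       (auto simp: eig_chart_deriv_def fun_eq_iff algebra_simps split: prod.splits)
qed

definition eig_det :: "('m::finite) chart \<Rightarrow> complex" where
  "eig_det = (\<lambda>((l, u), (w, D)). det (cscale l (mat 1) - D + outer u (cnjv w)))"

lemma cscale_mat1_vec: "cscale l (mat 1) *v v = l *s v"
  by (simp add: cscale_def mat_def matrix_vector_mult_def vec_eq_iff if_distrib[of "\<lambda>t. _ * t"] if_distrib[of "\<lambda>t. t * _"] cong: if_cong)

text \<open>Since (w, D) is carried along, the derivative is block triangular, and its block in the
  directions of l and u is the bordered map of \<open>jac_bordered\<close>.\<close>

lemma eig_chart_deriv_jac:
  assumes "eig_det p \<noteq> 0"
  shows "inj (eig_chart_deriv p)" "jac (eig_chart_deriv p) = (cmod (eig_det p))\<^sup>2"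
proof -
  obtain l u w D where p: "p = ((l, u), (w, D))" by (metis surj_pair)
  let ?E = "cscale l (mat 1) - D"
  have d: "det (?E + outer u (cnjv w)) \<noteq> 0" using assms by (simp add: p eig_det_def)
  let ?p = "\<lambda>(\<alpha>, v). (\<alpha> - cdot (cnjv w) v, \<alpha> *s u + ?E *v v)"
  let ?q = "\<lambda>r. (- cdot (cnjv (fst r)) u, - (snd r *v u))"
  have lp: "linear ?p"
    by (rule linearI; auto simp: linear_add[OF linear_cdot] linear_cmul[OF linear_cdot]
        linear_add[OF linear_matrix_vector] linear_cmul[OF linear_matrix_vector]
        linear_add[OF linear_smult_vec] linear_cmul[OF linear_smult_vec] algebra_simps)
  have lq: "linear ?q"
    by (rule linearI) (auto simp: cdot_def cnjv_def matrix_vector_mult_def vec_eq_iff algebra_simps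
        sum.distrib scaleR_sum_right sum_negf)
  have ip: "inj ?p"
  proof -
    have "x = 0" if "?p x = 0" for x
    proof -
      obtain \<alpha> v where x: "x = (\<alpha>, v)" by (cases x)
      have 1: "\<alpha> = cdot (cnjv w) v" and 2: "\<alpha> *s u + ?E *v v = 0" using that by (auto simp: x zero_prod_def)
      have "(?E + outer u (cnjv w)) *v v = (?E + outer u (cnjv w)) *v 0"
        using 2 by (simp add: matrix_vector_mult_add_rdistrib outer_vec 1[symmetric] add.commute)
      then have "v = 0" using injD[OF inj_matrix_vector[OF d]] by blast
      then show "x = 0" using 1 by (simp add: x cdot_def zero_prod_def)
    qed
    then show ?thesis using linear_injective_0[OF lp] by blast
  qed
  have id: "linear (\<lambda>x. x :: 'x::real_vector)" "inj (\<lambda>x. x :: 'x)" by (auto intro: linearI)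
  have e: "eig_chart_deriv p = (\<lambda>(a, x). (?p a + ?q x, x))"
    by (auto simp: p eig_chart_deriv_def fun_eq_iff matrix_vector_mult_diff_rdistrib cscale_mat1_vec algebra_simps)
  show "jac (eig_chart_deriv p) = (cmod (eig_det p))\<^sup>2"
    unfolding e jac_triangular[OF lp ip id lq] jac_bordered[OF d] by (simp add: p eig_det_def)
  show "inj (eig_chart_deriv p)"
  proof (rule injI)
    fix z z' assume z: "eig_chart_deriv p z = eig_chart_deriv p z'"
    obtain a x a' x' where zz: "z = (a, x)" "z' = (a', x')" by (metis surj_pair)
    have eq: "(?p a + ?q x, x) = (?p a' + ?q x', x')" using z unfolding e zz by (simp only: case_prod_conv)
    have x: "x = x'" using arg_cong[OF eq, of snd] by (simp only: snd_conv)
    have "?p a + ?q x' = ?p a' + ?q x'" using arg_cong[OF eq, of fst] by (simp only: fst_conv x)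
    then have "x = x'" "?p a = ?p a'" using x by (simp_all only: add_right_cancel)
    then show "z = z'" using injD[OF ip] zz by blast
  qed
qed

lemma continuous_on_cscale [continuous_intros]:
  fixes f :: "'x::topological_space \<Rightarrow> complex ^ 'n ^ 'm"
  assumes f: "continuous_on S f" and c: "continuous_on S c"
  shows "continuous_on S (\<lambda>x. cscale (c x) (f x))"
  unfolding cscale_def by (intro continuous_intros f c)

lemma continuous_on_cdot [continuous_intros]:
  fixes f g :: "'x::topological_space \<Rightarrow> complex ^ 'n"
  assumes f: "continuous_on S f" and g: "continuous_on S g"
  shows "continuous_on S (\<lambda>x. cdot (f x) (g x))"
  unfolding cdot_def by (intro continuous_intros f g)

lemma continuous_on_ext [continuous_intros]:
  fixes f :: "'x::topological_space \<Rightarrow> complex" and g :: "'x \<Rightarrow> complex ^ 'n"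
  assumes f: "continuous_on S f" and g: "continuous_on S g"
  shows "continuous_on S (\<lambda>x. ext (f x) (g x))"
proof -
  have "continuous_on S (\<lambda>x. case i of None \<Rightarrow> f x | Some i \<Rightarrow> g x $ i)" for i
    by (cases i) (auto intro!: continuous_intros f g)
  then show ?thesis unfolding ext_def by (intro continuous_intros)
qed

lemma continuous_on_blk [continuous_intros]:
  fixes a :: "'x::topological_space \<Rightarrow> complex" and w c :: "'x \<Rightarrow> complex ^ 'n" and D :: "'x \<Rightarrow> complex ^ 'n ^ 'n"
  assumes f: "continuous_on S a" "continuous_on S w" "continuous_on S c" "continuous_on S D"
  shows "continuous_on S (\<lambda>x. blk (a x) (w x) (c x) (D x))"
proof -
  have "continuous_on S (\<lambda>x. case i of
       None \<Rightarrow> (case j of None \<Rightarrow> a x | Some j \<Rightarrow> cnj (w x $ j))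
     | Some i \<Rightarrow> (case j of None \<Rightarrow> c x $ i | Some j \<Rightarrow> D x $ i $ j))" for i j
    by (cases i; cases j) (auto intro!: continuous_intros f)
  then show ?thesis unfolding blk_def by (intro continuous_intros)
qed

lemma continuous_on_eig_det: "continuous_on UNIV eig_det"
  unfolding eig_det_def case_prod_unfold by (intro continuous_intros)

lemma continuous_on_eig_chart: "continuous_on UNIV eig_chart"
  using eig_chart_has_derivative by (meson continuous_at_imp_continuous_on has_derivative_continuous)

lemma continuous_on_of_chart [continuous_intros]:
  "continuous_on S f \<Longrightarrow> continuous_on S (\<lambda>x. of_chart (f x))"
  unfolding of_chart_def by (intro continuous_intros)

lemma proj_pt_ext_eq_iff: "proj_pt (ext 1 u) = proj_pt (ext 1 u') \<longleftrightarrow> u = u'"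
proof
  assume "proj_pt (ext 1 u) = proj_pt (ext 1 u')"
  moreover have "ext 1 u \<in> proj_pt (ext 1 u)" unfolding proj_pt_def by (auto intro!: exI[of _ 1])
  ultimately obtain c where "ext 1 u = c *s ext 1 u'" by (auto simp: proj_pt_def)
  then show "u = u'" by (simp add: smult_ext ext_eq_iff)
qed simp

locale eig_observable =
  fixes \<phi> :: "complex ^ ('m::finite option) ^ ('m option) \<Rightarrow> complex \<Rightarrow> complex ^ ('m option) \<Rightarrow> ennreal"
  assumes meas: "(\<lambda>(A, l, v). \<phi> A l v) \<in> borel_measurable (restrict_space borel Vn)"
    and proj: "(A, l, v) \<in> Vn \<Longrightarrow> c \<noteq> 0 \<Longrightarrow> \<phi> A l (c *s v) = \<phi> A l v"
    and unitary: "(A, l, v) \<in> Vn \<Longrightarrow> U \<in> unitary_mats \<Longrightarrow> \<phi> (U ** A ** matrix_inv U) l (U *v v) = \<phi> A l v"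
begin

text \<open>\<open>\<phi>\<close> is measurable on the solution variety only, so each composition
  has to stay inside \<open>Vn\<close>.\<close>

lemma measurable_compose_Vn:
  fixes f :: "'a::euclidean_space \<Rightarrow> complex ^ ('m option) ^ ('m option)"
  assumes "continuous_on UNIV f" "continuous_on UNIV g" "continuous_on UNIV h"
    and V: "\<And>x. (f x, g x, h x) \<in> Vn"
  shows "(\<lambda>x. \<phi> (f x) (g x) (h x)) \<in> borel_measurable borel"
proof -
  have "(\<lambda>x. (f x, g x, h x)) \<in> borel_measurable borel"
    using assms by (intro borel_measurable_continuous_onI continuous_intros)
  then have "(\<lambda>x. (f x, g x, h x)) \<in> borel \<rightarrow>\<^sub>M restrict_space borel Vn"
    using V by (intro measurable_restrict_space2) auto
  from measurable_compose[OF this meas] show ?thesis by simp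
qed

definition chart_val :: "'m chart \<Rightarrow> ennreal" where
  "chart_val p = \<phi> (of_chart (eig_chart p)) (fst (fst p)) (ext 1 (snd (fst p))) * gauss (of_chart (eig_chart p))"

lemma chart_val_measurable [measurable]: "chart_val \<in> borel_measurable borel"
proof -
  have c: "continuous_on UNIV (\<lambda>p. of_chart (eig_chart p))"
    by (intro continuous_intros continuous_on_eig_chart[unfolded continuous_on_eq_continuous_at[OF open_UNIV]] continuous_on_eig_chart)
  have "(\<lambda>p. \<phi> (of_chart (eig_chart p)) (fst (fst p)) (ext 1 (snd (fst p)))) \<in> borel_measurable borel"
    by (intro measurable_compose_Vn c continuous_intros) (metis eig_chart_Vn prod.collapse)
  moreover have "(\<lambda>p. of_chart (eig_chart p)) \<in> borel_measurable borel"
    using c by (rule borel_measurable_continuous_onI)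
  ultimately show ?thesis unfolding chart_val_def by measurable
qed

text \<open>A line has at most one representative of the form (1, u), so points of a fibre give
  distinct eigenpairs; \<open>proj\<close> moves from the representative chosen by
  \<open>eig_sum\<close> to this one. Lines with vanishing first coordinate are missed, hence an
  inequality.\<close>

lemma eig_sum_ge_fibre:
  "(\<integral>\<^sup>+p. chart_val p \<partial>count_space {p \<in> U. eig_chart p = y}) \<le> gauss (of_chart y) * eig_sum \<phi> (of_chart y)"
proof -
  let ?F = "{p \<in> U. eig_chart p = y}" and ?A = "of_chart y"
  let ?e = "\<lambda>p :: 'm chart. (fst (fst p), proj_pt (ext 1 (snd (fst p))))"
  have inj: "inj_on ?e ?F"
  proof (rule inj_onI)
    fix p q assume p: "p \<in> ?F" and q: "q \<in> ?F" and e: "?e p = ?e q"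
    have "snd p = snd q" using p q by (auto simp: eig_chart_def split: prod.splits)
    moreover have "fst (fst p) = fst (fst q)" "snd (fst p) = snd (fst q)"
      using e by (auto simp: proj_pt_ext_eq_iff)
    ultimately show "p = q" by (simp add: prod_eq_iff)
  qed
  have V: "(?A, fst (fst p), ext 1 (snd (fst p))) \<in> Vn" if "p \<in> ?F" for p
    using that eig_chart_Vn[of "fst (fst p)" "snd (fst p)" "fst (snd p)" "snd (snd p)"] by auto
  have sub: "?e ` ?F \<subseteq> eigpairs ?A"
    using V unfolding eigpairs_def by blast
  have val: "\<phi> ?A (fst (?e p)) (SOME v. v \<in> snd (?e p)) = \<phi> ?A (fst (fst p)) (ext 1 (snd (fst p)))" if "p \<in> ?F" for p
  proof -
    have "\<exists>v. v \<in> proj_pt (ext 1 (snd (fst p)))" unfolding proj_pt_def by (auto intro!: exI[of _ 1])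
    then have "(SOME v. v \<in> proj_pt (ext 1 (snd (fst p)))) \<in> proj_pt (ext 1 (snd (fst p)))" by (rule someI_ex)
    then obtain c where "c \<noteq> 0" "(SOME v. v \<in> proj_pt (ext 1 (snd (fst p)))) = c *s ext 1 (snd (fst p))"
      by (auto simp: proj_pt_def)
    then show ?thesis using proj[OF V[OF that]] by simp
  qed
  have "(\<integral>\<^sup>+p. chart_val p \<partial>count_space ?F)
      = (\<integral>\<^sup>+p. gauss ?A * \<phi> ?A (fst (?e p)) (SOME v. v \<in> snd (?e p)) \<partial>count_space ?F)"
  proof (rule nn_integral_cong)
    fix p assume "p \<in> space (count_space ?F)"
    then have p: "p \<in> ?F" by simp
    then have "eig_chart p = y" by simp
    then show "chart_val p = gauss ?A * \<phi> ?A (fst (?e p)) (SOME v. v \<in> snd (?e p))"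
      unfolding val[OF p] by (simp add: chart_val_def mult.commute)
  qed
  also have "\<dots> = gauss ?A * (\<integral>\<^sup>+p. \<phi> ?A (fst (?e p)) (SOME v. v \<in> snd (?e p)) \<partial>count_space ?F)"
    by (rule nn_integral_cmult) simp
  also have "(\<integral>\<^sup>+p. \<phi> ?A (fst (?e p)) (SOME v. v \<in> snd (?e p)) \<partial>count_space ?F)
      = (\<integral>\<^sup>+e. \<phi> ?A (fst e) (SOME v. v \<in> snd e) \<partial>count_space (?e ` ?F))"
    using inj by (intro nn_integral_bij_count_space) (simp add: bij_betw_def)
  also have "\<dots> \<le> eig_sum \<phi> ?A"
    unfolding eig_sum_def by (intro nn_integral_count_space_subset_mono sub)
  finally show ?thesis by (simp add: mult_left_mono)
qed

text \<open>Where \<open>eig_det\<close> vanishes the left integrand is zero, so restricting to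
  \<open>U\<close> loses nothing. The minorant of the area formula is moved from block coordinates
  to matrices by \<open>unchart\<close>.\<close>

lemma chart_integral_le:
  "\<exists>g \<in> borel_measurable borel. (\<forall>A. g A \<le> gauss A * eig_sum \<phi> A) \<and>
     (\<integral>\<^sup>+p. chart_val p * ennreal ((cmod (eig_det p))\<^sup>2) \<partial>lborel) \<le> (\<integral>\<^sup>+A. g A \<partial>lborel)"
proof -
  define U where "U = {p :: 'm chart. eig_det p \<noteq> 0}"
  have U: "open U" unfolding U_def by (intro open_Collect_neq continuous_on_eig_det continuous_intros)
  have cd: "continuous_on U (\<lambda>p. eig_chart_deriv p v)" for v
    unfolding eig_chart_deriv_def case_prod_unfold by (intro continuous_intros)
  obtain h where h [measurable]: "h \<in> borel_measurable borel"
    and hle: "\<And>y. h y \<le> (\<integral>\<^sup>+p. chart_val p \<partial>count_space {p\<in>U. eig_chart p = y})"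
    and le: "(\<integral>\<^sup>+p. chart_val p * (jac (eig_chart_deriv p) * indicator U p) \<partial>lborel) \<le> (\<integral>\<^sup>+y. h y \<partial>lborel)"
    using area_formula_le[OF U eig_chart_has_derivative cd eig_chart_deriv_jac(1) chart_val_measurable]
    by (auto simp: U_def)
  define unchart :: "complex ^ ('m option) ^ ('m option) \<Rightarrow> 'm chart" where
    "unchart A = ((A $ None $ None, \<chi> i. A $ Some i $ None), (\<chi> j. cnj (A $ None $ Some j), \<chi> i j. A $ Some i $ Some j))" for A
  have b1: "unchart (of_chart y) = y" for y
    by (cases y) (auto simp: unchart_def of_chart_def blk_def vec_eq_iff)
  have b2: "of_chart (unchart A) = A" for A
    by (auto simp: unchart_def of_chart_def blk_def vec_eq_iff split: option.splits)
  have bm [measurable]: "unchart \<in> borel_measurable borel"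
    unfolding unchart_def by (intro borel_measurable_continuous_onI continuous_intros)
  have "(\<integral>\<^sup>+p. chart_val p * ennreal ((cmod (eig_det p))\<^sup>2) \<partial>lborel)
      = (\<integral>\<^sup>+p. chart_val p * (jac (eig_chart_deriv p) * indicator U p) \<partial>lborel)"
    by (intro nn_integral_cong) (auto simp: U_def indicator_def eig_chart_deriv_jac)
  also have "\<dots> \<le> (\<integral>\<^sup>+y. h y \<partial>lborel)" by (rule le)
  also have "\<dots> = (\<integral>\<^sup>+A. h (unchart A) \<partial>lborel)"
    using nn_integral_blk[of "\<lambda>A. h (unchart A)"] by (simp add: b1 of_chart_def[symmetric])
  finally have le': "(\<integral>\<^sup>+p. chart_val p * ennreal ((cmod (eig_det p))\<^sup>2) \<partial>lborel) \<le> (\<integral>\<^sup>+A. h (unchart A) \<partial>lborel)" .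
  have "h (unchart A) \<le> gauss A * eig_sum \<phi> A" for A
    using order_trans[OF hle eig_sum_ge_fibre, of "unchart A"] by (simp add: b2)
  then show ?thesis
    using le' by (intro bexI[of _ "\<lambda>A. h (unchart A)"]) auto
qed
end

section \<open>The eigenpair integral in Schur coordinates\<close>

context eig_observable
begin

definition schur_val :: "complex \<Rightarrow> complex ^ 'm \<Rightarrow> complex ^ 'm ^ 'm \<Rightarrow> ennreal" where
  "schur_val l w B = \<phi> (blk l w 0 B) l (ext 1 0)"

lemma schur_Vn: "(blk l (w :: complex ^ 'm) 0 B, l, ext 1 0) \<in> Vn"
proof -
  have "ext 1 (0 :: complex ^ 'm) $ None \<noteq> 0 $ None" by (simp add: ext_def)
  then have "ext 1 (0 :: complex ^ 'm) \<noteq> 0" by metis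
  moreover have "blk l w 0 B *v ext 1 0 = l *s ext 1 0" by (simp add: blk_ext smult_ext ext_eq_iff) (simp add: cdot_def)
  ultimately show ?thesis by (simp only: Vn_iff) simp
qed

lemma schur_val_measurable:
  fixes f :: "'a::euclidean_space \<Rightarrow> complex"
  assumes "continuous_on UNIV f" "continuous_on UNIV g" "continuous_on UNIV h"
  shows "(\<lambda>x. schur_val (f x) (g x) (h x)) \<in> borel_measurable borel"
  unfolding schur_val_def
  by (intro measurable_compose_Vn schur_Vn continuous_intros assms)

text \<open>Unitary invariance of \<open>\<phi>\<close> and of the Frobenius norm allow evaluation
  at the Schur form. The matrix D - u w^H is K B' S, similar to B' because K and S are inverse, so
  the chart determinant becomes that of l - B'.\<close>

lemma chart_val_unitary:
  fixes u w' :: "complex ^ 'm" and B' :: "complex ^ 'm ^ 'm" and l :: complex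
  defines "r \<equiv> complex_of_real (shrink u)"
  defines "w \<equiv> (r *s (mat_S u *v w') + ((r * r * cnj l) *s u - r *s (mat_S u *v (cadj B' *v u))))"
  defines "p \<equiv> ((l, u), (w, mat_K u ** B' ** mat_S u + outer u (cnjv w)))"
  shows "chart_val p = schur_val l w' B' * gauss (blk l w' 0 B')"
    and "eig_det p = det (cscale l (mat 1) - B')"
proof -
  let ?P = "mat_P u" and ?T = "blk l w' 0 B'"
  have r: "r \<noteq> 0" using shrink_pos[of u] by (simp add: r_def)
  have A: "of_chart (eig_chart p) = ?P ** ?T ** cadj ?P"
    unfolding p_def w_def r_def by (rule unitary_chart)
  have U: "?P \<in> unitary_mats" by (simp add: unitary_mats_def unitary_P)
  have "\<phi> (?P ** ?T ** cadj ?P) l (ext 1 u) = \<phi> (?P ** ?T ** cadj ?P) l (r *s ext 1 u)"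
    using proj[of "?P ** ?T ** cadj ?P" l "ext 1 u" r] eig_chart_Vn[of l u w "mat_K u ** B' ** mat_S u + outer u (cnjv w)"] A r
    by (simp add: p_def)
  also have "\<dots> = \<phi> (?P ** ?T ** matrix_inv ?P) l (?P *v ext 1 0)"
    by (simp add: matrix_inv_unitary[OF unitary_P] P_e1 r_def)
  also have "\<dots> = schur_val l w' B'"
    unfolding schur_val_def by (rule unitary[OF schur_Vn U])
  finally show "chart_val p = schur_val l w' B' * gauss ?T"
    unfolding chart_val_def A norm_unitary_conj[OF unitary_P] by (simp add: p_def)
  have cs: "cscale l (mat 1) ** X = cscale l X" "X ** cscale l (mat 1) = cscale l X" for X :: "complex ^ 'm ^ 'm"
    by (simp_all add: cscale_def matrix_matrix_mult_def mat_def vec_eq_iff if_distrib[of "\<lambda>t. t * _"] if_distrib[of "\<lambda>t. _ * t"] mult.commute cong: if_cong)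
  have "mat_K u ** (cscale l (mat 1) - B') ** mat_S u = cscale l (mat 1) - mat_K u ** B' ** mat_S u"
  proof -
    have "mat_K u ** (cscale l (mat 1) - B') = cscale l (mat_K u) - mat_K u ** B'"
      using cs(2)[of "mat_K u"] by (simp add: matrix_matrix_mult_def vec_eq_iff algebra_simps sum_subtractf)
    moreover have "cscale l (mat_K u) ** mat_S u = cscale l (mat 1)"
      by (metis KS cs(1) matrix_mul_assoc)
    ultimately show ?thesis by (simp add: matrix_mult_diff_left)
  qed
  moreover have "det (mat_K u) * det (mat_S u) = 1"
    by (metis KS det_mul det_I)
  ultimately have "det (cscale l (mat 1) - mat_K u ** B' ** mat_S u) = det (cscale l (mat 1) - B')"
    by (metis (no_types, lifting) det_mul mult.commute mult.left_commute mult_1)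
  then show "eig_det p = det (cscale l (mat 1) - B')"
    by (simp add: eig_det_def p_def)
qed

text \<open>For fixed l and u, substituting D = K B S + u w^H has Jacobian 1, since the determinants
  of K and S have reciprocal moduli. The linear part r S of the substitution in w contributes r^(2m
  + 2), with r = \<open>shrink u\<close> and m = \<open>CARD('m)\<close>. The integrand is then free
  of u, whose integral splits off as \<open>chart_mass\<close>.\<close>

lemma chart_integral_eq:
  "(\<integral>\<^sup>+p. chart_val p * ennreal ((cmod (eig_det p))\<^sup>2) \<partial>lborel)
   = chart_mass TYPE('m) * (\<integral>\<^sup>+l. \<integral>\<^sup>+w. \<integral>\<^sup>+B.
       schur_val l w B * gauss (blk l w 0 B) * ennreal ((cmod (det (cscale l (mat 1) - B)))\<^sup>2) \<partial>lborel \<partial>lborel \<partial>lborel)"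
proof -
  define F where "F p = chart_val p * ennreal ((cmod (eig_det p))\<^sup>2)" for p :: "'m chart"
  define H where "H l w B = schur_val l w B * gauss (blk l w 0 B) * ennreal ((cmod (det (cscale l (mat 1) - B)))\<^sup>2)"
    for l and w :: "complex ^ 'm" and B
  have Fm [measurable]: "F \<in> borel_measurable borel"
  proof -
    have "(eig_det :: 'm chart \<Rightarrow> complex) \<in> borel_measurable borel"
      by (intro borel_measurable_continuous_onI continuous_on_eig_det)
    then show ?thesis unfolding F_def by measurable
  qed
  have Fc: "(\<lambda>x. F (f x)) \<in> borel_measurable borel" if "continuous_on UNIV f" for f :: "'x::euclidean_space \<Rightarrow> 'm chart"
    using measurable_compose[OF borel_measurable_continuous_onI[OF that] Fm] .
  have Hc: "(\<lambda>x. H (f x) (g x) (h x)) \<in> borel_measurable borel"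
    if c: "continuous_on UNIV f" "continuous_on UNIV g" "continuous_on UNIV h" for f :: "'x::euclidean_space \<Rightarrow> complex" and g :: "'x \<Rightarrow> complex ^ 'm" and h
  proof -
    have "(\<lambda>x. blk (f x) (g x) 0 (h x)) \<in> borel_measurable borel"
      "(\<lambda>x. det (cscale (f x) (mat 1) - h x)) \<in> borel_measurable borel"
      by (intro borel_measurable_continuous_onI continuous_intros c)+
    then show ?thesis unfolding H_def using schur_val_measurable[OF c] by measurable
  qed
  have fixed: "(\<integral>\<^sup>+q. F ((l, u), q) \<partial>lborel) = ennreal (shrink u ^ (2 * CARD('m) + 2)) * (\<integral>\<^sup>+w. \<integral>\<^sup>+B. H l w B \<partial>lborel \<partial>lborel)" for l u
  proof -
    let ?f = "\<lambda>B :: complex ^ 'm ^ 'm. mat_K u ** B ** mat_S u"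
    have ff: "?f = (\<lambda>N. N ** mat_S u) \<circ> (\<lambda>N. mat_K u ** N)" by auto
    have lf: "linear ?f"
      unfolding ff by (intro linear_compose linear_matrix_mult_left linear_matrix_mult_right)
    have "jac ?f = jac (\<lambda>N :: complex ^ 'm ^ 'm. N ** mat_S u) * jac (\<lambda>N :: complex ^ 'm ^ 'm. mat_K u ** N)"
      unfolding ff by (intro jac_compose linear_matrix_mult_left linear_matrix_mult_right)
    then have jf: "jac ?f = 1"
      using shrink_pos[of u]
      by (simp add: jac_matrix_mult_left[OF det_K(1)] jac_matrix_mult_right[OF det_S(1)] det_K(2) det_S(2) power_divide)
    have if': "inj ?f"
    proof (rule injI)
      fix X Y assume "?f X = ?f Y"
      then have "mat_S u ** ?f X ** mat_K u = mat_S u ** ?f Y ** mat_K u" by simp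
      moreover have "mat_S u ** ?f Z ** mat_K u = Z" for Z
      proof -
        have "mat_S u ** ?f Z ** mat_K u = (mat_S u ** mat_K u) ** Z ** (mat_S u ** mat_K u)"
          by (simp only: matrix_mul_assoc)
        then show ?thesis by (simp add: SK)
      qed
      ultimately show "X = Y" by simp
    qed
    let ?r = "complex_of_real (shrink u)"
    let ?b = "\<lambda>B'. ((?r * ?r * cnj l) *s u - ?r *s (mat_S u *v (cadj B' *v u)))"
    let ?M = "shrink u *\<^sub>R mat_S u"
    have Mv: "?M *v w' = ?r *s (mat_S u *v w')" for w'
      by (simp add: matrix_vector_scaleR vec_eq_iff) (simp add: scaleR_conv_of_real)
    have "cmod (det ?M) = shrink u ^ Suc CARD('m)"
      using det_S[of u] shrink_pos[of u] by (simp add: det_scaleR norm_mult norm_power)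
    then have dM: "det ?M \<noteq> 0" "(cmod (det ?M))\<^sup>2 = shrink u ^ (2 * CARD('m) + 2)"
      using shrink_pos[of u] by (auto simp: power_mult[symmetric] mult.commute simp del: power_Suc)
    have "(\<integral>\<^sup>+q. F ((l, u), q) \<partial>lborel) = (\<integral>\<^sup>+w. \<integral>\<^sup>+D. F ((l, u), (w, D)) \<partial>lborel \<partial>lborel)"
      by (rule nn_integral_lborel_prod_iter(2)) (intro Fc continuous_intros)
    also have "\<dots> = (\<integral>\<^sup>+w. \<integral>\<^sup>+B. F ((l, u), (w, ?f B + outer u (cnjv w))) \<partial>lborel \<partial>lborel)"
    proof (rule nn_integral_cong)
      fix w
      have "(\<lambda>D. F ((l, u), (w, D))) \<in> borel_measurable borel" by (intro Fc continuous_intros)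
      from nn_integral_affine[OF lf if' this, of "outer u (cnjv w)"]
      show "(\<integral>\<^sup>+D. F ((l, u), (w, D)) \<partial>lborel) = (\<integral>\<^sup>+B. F ((l, u), (w, ?f B + outer u (cnjv w))) \<partial>lborel)"
        by (simp add: jf)
    qed
    \<comment> \<open>The shift in the next substitution of \<open>w\<close> involves
      \<open>B\<close>, so \<open>B\<close> has to be the outer variable.\<close>
    also have "\<dots> = (\<integral>\<^sup>+B. \<integral>\<^sup>+w. F ((l, u), (w, ?f B + outer u (cnjv w))) \<partial>lborel \<partial>lborel)"
    proof -
      have m: "(\<lambda>q. F ((l, u), (fst q, ?f (snd q) + outer u (cnjv (fst q))))) \<in> borel_measurable borel"
        by (intro Fc continuous_intros)
      show ?thesis using nn_integral_lborel_prod_iter[OF m] by simp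
    qed
    also have "\<dots> = (\<integral>\<^sup>+B. ennreal (shrink u ^ (2 * CARD('m) + 2)) * (\<integral>\<^sup>+w'. H l w' B \<partial>lborel) \<partial>lborel)"
    proof (rule nn_integral_cong)
      fix B
      have "(\<lambda>w. F ((l, u), (w, ?f B + outer u (cnjv w)))) \<in> borel_measurable borel" by (intro Fc continuous_intros)
      from nn_integral_affine[OF linear_matrix_vector inj_matrix_vector[OF dM(1)] this, of "?b B",
          unfolded jac_matrix_vector[OF dM(1)] dM(2), unfolded Mv]
      have "(\<integral>\<^sup>+w. F ((l, u), (w, ?f B + outer u (cnjv w))) \<partial>lborel) = ennreal (shrink u ^ (2 * CARD('m) + 2)) *
          (\<integral>\<^sup>+w'. F ((l, u), (?r *s (mat_S u *v w') + ?b B, ?f B + outer u (cnjv (?r *s (mat_S u *v w') + ?b B)))) \<partial>lborel)"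
        .
      then show "(\<integral>\<^sup>+w. F ((l, u), (w, ?f B + outer u (cnjv w))) \<partial>lborel) = ennreal (shrink u ^ (2 * CARD('m) + 2)) * (\<integral>\<^sup>+w'. H l w' B \<partial>lborel)"
        unfolding F_def chart_val_unitary H_def .
    qed
    also have "\<dots> = ennreal (shrink u ^ (2 * CARD('m) + 2)) * (\<integral>\<^sup>+B. \<integral>\<^sup>+w'. H l w' B \<partial>lborel \<partial>lborel)"
    proof -
      have m: "(\<lambda>q. H l (snd q) (fst q)) \<in> borel_measurable (lborel \<Otimes>\<^sub>M lborel)"
        unfolding lborel_prod by simp (intro Hc continuous_intros)
      have "(\<lambda>B. \<integral>\<^sup>+w'. H l w' B \<partial>lborel) \<in> borel_measurable lborel"
        using lborel.borel_measurable_nn_integral_fst[OF m] by simp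
      then show ?thesis by (rule nn_integral_cmult)
    qed
    also have "(\<integral>\<^sup>+B. \<integral>\<^sup>+w'. H l w' B \<partial>lborel \<partial>lborel) = (\<integral>\<^sup>+w'. \<integral>\<^sup>+B. H l w' B \<partial>lborel \<partial>lborel)"
    proof -
      have m: "(\<lambda>q. H l (fst q) (snd q)) \<in> borel_measurable borel"
        by (intro Hc continuous_intros)
      show ?thesis using nn_integral_lborel_prod_iter[OF m] by simp
    qed
    finally show ?thesis .
  qed
  have Im: "(\<lambda>l. \<integral>\<^sup>+w. \<integral>\<^sup>+B. H l w B \<partial>lborel \<partial>lborel) \<in> borel_measurable borel"
  proof -
    have m: "(\<lambda>q. H (fst q) (fst (snd q)) (snd (snd q))) \<in> borel_measurable (lborel \<Otimes>\<^sub>M lborel)"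
      unfolding lborel_prod by simp (intro Hc continuous_intros)
    have "(\<lambda>l. \<integral>\<^sup>+q. H l (fst q) (snd q) \<partial>lborel) \<in> borel_measurable borel"
      using lborel.borel_measurable_nn_integral_fst[OF m] by simp
    moreover have "(\<integral>\<^sup>+q. H l (fst q) (snd q) \<partial>lborel) = (\<integral>\<^sup>+w. \<integral>\<^sup>+B. H l w B \<partial>lborel \<partial>lborel)" for l
    proof -
      have m: "(\<lambda>q. H l (fst q) (snd q)) \<in> borel_measurable borel" by (intro Hc continuous_intros)
      show ?thesis using nn_integral_lborel_prod_iter(2)[OF m] by simp
    qed
    ultimately show ?thesis by simp
  qed
  note Im [measurable]
  have "(\<integral>\<^sup>+p. F p \<partial>lborel) = (\<integral>\<^sup>+x. \<integral>\<^sup>+q. F (x, q) \<partial>lborel \<partial>lborel)"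
    by (rule nn_integral_lborel_prod_iter(2)) simp
  also have "\<dots> = (\<integral>\<^sup>+(x :: complex \<times> (complex ^ 'm)). ennreal (shrink (snd x) ^ (2 * CARD('m) + 2)) * (\<integral>\<^sup>+w. \<integral>\<^sup>+B. H (fst x) w B \<partial>lborel \<partial>lborel) \<partial>lborel)"
  proof (rule nn_integral_cong)
    fix x :: "complex \<times> (complex ^ 'm)"
    show "(\<integral>\<^sup>+q. F (x, q) \<partial>lborel) = ennreal (shrink (snd x) ^ (2 * CARD('m) + 2)) * (\<integral>\<^sup>+w. \<integral>\<^sup>+B. H (fst x) w B \<partial>lborel \<partial>lborel)"
      using fixed[of "fst x" "snd x"] by simp
  qed
  also have "\<dots> = (\<integral>\<^sup>+l. \<integral>\<^sup>+(u :: complex ^ 'm). ennreal (shrink u ^ (2 * CARD('m) + 2)) * (\<integral>\<^sup>+w. \<integral>\<^sup>+B. H l w B \<partial>lborel \<partial>lborel) \<partial>lborel \<partial>lborel)"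
  proof -
    have fs: "(fst :: complex \<times> (complex ^ 'm) \<Rightarrow> _) \<in> borel_measurable borel" "(snd :: complex \<times> (complex ^ 'm) \<Rightarrow> _) \<in> borel_measurable borel"
      by (intro borel_measurable_continuous_onI continuous_intros)+
    have m: "(\<lambda>x :: complex \<times> (complex ^ 'm). ennreal (shrink (snd x) ^ (2 * CARD('m) + 2)) * (\<integral>\<^sup>+w. \<integral>\<^sup>+B. H (fst x) w B \<partial>lborel \<partial>lborel)) \<in> borel_measurable borel"
      using measurable_compose[OF fs(1) Im] measurable_compose[OF fs(2) shrink_measurable] by measurable
    show ?thesis using nn_integral_lborel_prod_iter(2)[OF m] by simp
  qed
  also have "\<dots> = (\<integral>\<^sup>+l. chart_mass TYPE('m) * (\<integral>\<^sup>+w. \<integral>\<^sup>+B. H l w B \<partial>lborel \<partial>lborel) \<partial>lborel)"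
    unfolding chart_mass_def by (intro nn_integral_cong nn_integral_multc) measurable
  also have "\<dots> = chart_mass TYPE('m) * (\<integral>\<^sup>+l. \<integral>\<^sup>+w. \<integral>\<^sup>+B. H l w B \<partial>lborel \<partial>lborel \<partial>lborel)"
    by (rule nn_integral_cmult) measurable
  finally show ?thesis unfolding F_def H_def .
qed

end

section \<open>Haar averaging and the pseudoinverse\<close>

lemma norm_mult_unitary: "V ** cadj V = mat 1 \<Longrightarrow> norm (X ** V) = norm X"
  for X :: "complex ^ 'n ^ 'm" and V :: "complex ^ 'k ^ 'n"
proof (rule norm_eq_of_gram_eq)
  assume V: "V ** cadj V = mat 1"
  have "X ** V ** cadj (X ** V) = X ** V ** (cadj V ** cadj X)" by (simp only: cadj_mult)
  also have "\<dots> = X ** (V ** cadj V) ** cadj X" by (simp only: matrix_mul_assoc)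
  also have "\<dots> = X ** cadj X" by (simp only: V matrix_mul_rid)
  finally show "X ** V ** cadj (X ** V) = X ** cadj X" .
qed

lemma norm_isometry_mult:
  fixes Q :: "complex ^ 'm ^ 'n" and X :: "complex ^ 'k ^ 'm"
  assumes Q: "cadj Q ** Q = mat 1"
  shows "norm (Q ** X) = norm X"
  using norm_mult_unitary[of "cadj Q" "cadj X"] Q norm_cadj[of "Q ** X"] norm_cadj[of X] by (simp add: cadj_mult)

lemma unitary_matsD: "U \<in> unitary_mats \<Longrightarrow> cadj U ** U = mat 1" "U \<in> unitary_mats \<Longrightarrow> U ** cadj U = mat 1"
  by (simp_all add: unitary_mats_def matrix_left_right_inverse)

lemma cmod_det_unitary:
  fixes U :: "complex ^ 'm ^ 'm"
  assumes "U \<in> unitary_mats" shows "cmod (det U) = 1"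
proof -
  have nz: "det U \<noteq> 0" using unitary_matsD(1)[OF assms] by (metis det_I det_mul mult_zero_right zero_neq_one)
  have "cmod (det U) ^ (2 * CARD('m)) = 1"
  proof -
    have "jac (\<lambda>N :: complex ^ 'm ^ 'm. N ** U) = 1"
      by (rule jac_isometry[OF linear_matrix_mult_right norm_mult_unitary[OF unitary_matsD(2)[OF assms]]])
    then show ?thesis using jac_matrix_mult_right[OF nz] by simp
  qed
  from power_eq_1_iff[OF this] show ?thesis by auto
qed

text \<open>The first three Penrose conditions follow from M X = I. For uniqueness, any solution Y
  also has M Y = I, so (X M)(Y M) = X M and (Y M)(X M) = Y M; taking adjoints gives X M = Y M, hence
  X = Y.\<close>

lemma mp_pinv_eq:
  fixes M :: "complex ^ 'n ^ 'm" and Q :: "complex ^ 'm ^ 'n"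
  assumes MX: "M ** X = mat 1" and XM: "cadj (X ** M) = X ** M"
  shows "mp_pinv M = X"
  unfolding mp_pinv_def
proof (rule the_equality)
  show "M ** X ** M = M \<and> X ** M ** X = X \<and> cadj (M ** X) = M ** X \<and> cadj (X ** M) = X ** M"
    using MX XM by (simp add: matrix_mul_assoc[symmetric])
  fix Y assume Y: "M ** Y ** M = M \<and> Y ** M ** Y = Y \<and> cadj (M ** Y) = M ** Y \<and> cadj (Y ** M) = Y ** M"
  have MY: "M ** Y = mat 1"
  proof -
    have "M ** Y = M ** Y ** (M ** X)" by (simp add: MX)
    also have "\<dots> = (M ** Y ** M) ** X" by (simp only: matrix_mul_assoc)
    also have "\<dots> = mat 1" using Y MX by simp
    finally show ?thesis .
  qed
  have 1: "(X ** M) ** (Y ** M) = X ** M"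
  proof -
    have "(X ** M) ** (Y ** M) = X ** (M ** Y ** M)" by (simp only: matrix_mul_assoc)
    then show ?thesis using Y by simp
  qed
  have 2: "(Y ** M) ** (X ** M) = Y ** M"
  proof -
    have "(Y ** M) ** (X ** M) = Y ** (M ** X) ** M" by (simp only: matrix_mul_assoc)
    then show ?thesis by (simp add: MX)
  qed
  have "cadj ((Y ** M) ** (X ** M)) = (X ** M) ** (Y ** M)"
    using Y XM by (simp add: cadj_mult[of "Y ** M" "X ** M"])
  then have "Y ** M = X ** M" using 1 2 Y by simp
  then have "Y ** M ** Y = X ** M ** Y" by simp
  also have "X ** M ** Y = X ** (M ** Y)" by (simp only: matrix_mul_assoc)
  finally show "Y = X" using Y MY by simp
qed

lemma det_inverse_obtain:
  fixes B :: "complex ^ 'm ^ 'm"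
  assumes "det B \<noteq> 0"
  obtains B' where "B ** B' = mat 1" "B' ** B = mat 1"
  using assms invertible_det_nz[of B] by (auto simp: invertible_def)

text \<open>The support condition n |z| |B^(-1)|_F \<le> 1 with n = \<open>CARD('m) + 1\<close>,
  squared and cleared of denominators. In this form it defines a closed set and makes sense for
  singular B.\<close>

definition near :: "complex \<Rightarrow> complex ^ 'm ^ 'm \<Rightarrow> bool" where
  "near z B \<longleftrightarrow> ((real CARD('m) + 1) * cmod z)\<^sup>2 * cofsum B \<le> (cmod (det B))\<^sup>2"

lemma near_iff:
  fixes B :: "complex ^ 'm ^ 'm"
  assumes "B' ** B = mat 1"
  shows "near z B \<longleftrightarrow> (real CARD('m) + 1) * cmod z * norm B' \<le> 1"
proof -
  have "det B \<noteq> 0" using assms by (metis det_I det_mul mult_zero_right zero_neq_one)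
  then have d: "(cmod (det B))\<^sup>2 > 0" by simp
  have "near z B \<longleftrightarrow> ((real CARD('m) + 1) * cmod z * norm B')\<^sup>2 * (cmod (det B))\<^sup>2 \<le> 1 * (cmod (det B))\<^sup>2"
    by (simp add: near_def cofsum_inverse[OF assms] power_mult_distrib mult_ac)
  also have "\<dots> \<longleftrightarrow> ((real CARD('m) + 1) * cmod z * norm B')\<^sup>2 \<le> 1"
    using d by (rule mult_le_cancel_right_pos)
  also have "\<dots> \<longleftrightarrow> (real CARD('m) + 1) * cmod z * norm B' \<le> 1"
    by (subst power_le_one_iff) auto
  finally show ?thesis .
qed

lemma near_det_bound:
  fixes B :: "complex ^ 'm ^ 'm"
  assumes "near z B"
  shows "(cmod (det B))\<^sup>2 \<le> 11 / 2 * (cmod (det (cscale z (mat 1) - B)))\<^sup>2"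
proof (cases "det B = 0")
  case False
  then obtain B' where "B ** B' = mat 1" "B' ** B = mat 1" by (rule det_inverse_obtain)
  then show ?thesis using near_iff det_shift_bound assms by blast
qed simp

lemma reduced_QR:
  assumes "is_reduced_QR_Q M Q"
  shows "cadj Q ** Q = mat 1" "M = (M ** Q) ** cadj Q"
proof -
  obtain R where Q: "cadj Q ** Q = mat 1" and R: "cadj M = Q ** R"
    using assms by (auto simp: is_reduced_QR_Q_def)
  have M: "M = cadj R ** cadj Q" using arg_cong[OF R, of cadj] by (simp add: cadj_mult)
  have "M ** Q = cadj R"
    unfolding M by (simp add: matrix_mul_assoc[symmetric] Q)
  then show "cadj Q ** Q = mat 1" "M = (M ** Q) ** cadj Q" using Q M by simp_all
qed

lemma gram_of_isometry:
  assumes Q: "cadj Q ** Q = mat 1" and M: "M = (M ** Q) ** cadj Q"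
  shows "M ** cadj M = (M ** Q) ** cadj (M ** Q)"
proof -
  have "M ** cadj M = ((M ** Q) ** cadj Q) ** cadj ((M ** Q) ** cadj Q)" using M by simp
  also have "\<dots> = (M ** Q) ** (cadj Q ** Q) ** cadj (M ** Q)"
    unfolding cadj_mult[of "M ** Q" "cadj Q"] cadj_cadj by (simp only: matrix_mul_assoc)
  finally show ?thesis by (simp add: Q)
qed

text \<open>If C inverts M Q, then Q C is the pseudoinverse of M and U^H C inverts M Q U. Both have
  the Frobenius norm of C, because Q and U^H have orthonormal columns.\<close>

lemma near_mp_pinv:
  fixes M :: "complex ^ 'n ^ 'm"
  assumes QQ: "cadj Q ** Q = mat 1" and MQ: "M = (M ** Q) ** cadj Q" and d: "det (M ** Q) \<noteq> 0" and U: "U \<in> unitary_mats"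
  shows "near z (M ** Q ** U) \<longleftrightarrow> (real CARD('m) + 1) * cmod z * norm (mp_pinv M) \<le> 1"
proof -
  obtain C where C: "(M ** Q) ** C = mat 1" "C ** (M ** Q) = mat 1" using det_inverse_obtain[OF d] .
  note g = QQ MQ
  have X: "mp_pinv M = Q ** C"
  proof (rule mp_pinv_eq)
    show "M ** (Q ** C) = mat 1" using C by (simp add: matrix_mul_assoc)
    have "Q ** C ** M = Q ** C ** ((M ** Q) ** cadj Q)" using g(2) by simp
    also have "\<dots> = Q ** (C ** (M ** Q)) ** cadj Q" by (simp only: matrix_mul_assoc)
    also have "\<dots> = Q ** cadj Q" by (simp add: C)
    finally show "cadj (Q ** C ** M) = Q ** C ** M" by (simp add: cadj_mult)
  qed
  have "(cadj U ** C) ** (M ** Q ** U) = cadj U ** (C ** (M ** Q)) ** U" by (simp only: matrix_mul_assoc)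
  then have inv: "(cadj U ** C) ** (M ** Q ** U) = mat 1" by (simp add: C unitary_matsD[OF U])
  have "norm (cadj U ** C) = norm (mp_pinv M)"
    unfolding X norm_isometry_mult[OF g(1)] using norm_isometry_mult[of "cadj U" C] by (simp add: unitary_matsD[OF U])
  then show ?thesis using near_iff[OF inv, of z] by simp
qed

section \<open>Averages over the unitary group\<close>

locale haar_unitary =
  fixes \<mu> :: "(complex ^ 'm ^ 'm) measure"
  assumes haar: "is_haar_unitary \<mu>"
begin

lemma sets_haar [simp, measurable_cong]: "sets \<mu> = sets borel"
  using haar by (simp add: is_haar_unitary_def)

lemma space_haar [simp]: "space \<mu> = UNIV"
  using sets_eq_imp_space_eq[OF sets_haar] by simp

sublocale prob_space \<mu>
  by (rule prob_spaceI) (use haar in \<open>simp add: is_haar_unitary_def\<close>)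

lemma AE_unitary: "AE U in \<mu>. U \<in> unitary_mats"
proof -
  have "closed (unitary_mats :: (complex ^ 'm ^ 'm) set)"
    unfolding unitary_mats_def cadj_def by (intro closed_Collect_eq continuous_intros)
  then have "- (unitary_mats :: (complex ^ 'm ^ 'm) set) \<in> sets \<mu>" by (simp add: borel_closed)
  then show ?thesis
    using haar by (intro AE_I[where N = "- unitary_mats"]) (auto simp: is_haar_unitary_def)
qed

text \<open>Left invariance of the Haar measure makes \<open>avg F\<close> invariant under right
  multiplication by unitaries. On invertible matrices it is therefore a function of B B^H, as
  \<open>nn_integral_rect_to_square\<close> requires.\<close>

definition avg :: "(complex ^ 'm ^ 'm \<Rightarrow> ennreal) \<Rightarrow> complex ^ 'm ^ 'm \<Rightarrow> ennreal" where
  "avg F B = (\<integral>\<^sup>+U. F (B ** U) \<partial>\<mu>)"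

lemma borel_pair_haar: "sets (borel \<Otimes>\<^sub>M \<mu>) = sets (borel :: ('a::second_countable_topology \<times> (complex ^ 'm ^ 'm)) measure)"
  by (simp add: borel_prod[symmetric] cong: sets_pair_measure_cong)

lemma avg_measurable [measurable]:
  assumes F [measurable]: "F \<in> borel_measurable borel"
  shows "avg F \<in> borel_measurable borel"
proof -
  have "(\<lambda>p :: (complex ^ 'm ^ 'm) \<times> (complex ^ 'm ^ 'm). fst p ** snd p) \<in> borel_measurable borel"
    by (intro borel_measurable_continuous_onI continuous_intros)
  then have "(\<lambda>p :: (complex ^ 'm ^ 'm) \<times> (complex ^ 'm ^ 'm). F (fst p ** snd p)) \<in> borel_measurable borel"
    by measurable
  then have "(\<lambda>p. F (fst p ** snd p)) \<in> borel_measurable (borel \<Otimes>\<^sub>M \<mu>)"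
    by (subst measurable_cong_sets[OF borel_pair_haar refl])
  from borel_measurable_nn_integral_fst[OF this] show ?thesis
    by (simp add: avg_def[abs_def])
qed

lemma avg_mult_unitary:
  assumes F [measurable]: "F \<in> borel_measurable borel" and V: "V \<in> unitary_mats"
  shows "avg F (B ** V) = avg F B"
proof -
  have [measurable]: "(\<lambda>X. V ** X) \<in> borel_measurable borel" "(\<lambda>U. B ** U) \<in> borel_measurable borel"
    by (intro borel_measurable_continuous_onI continuous_intros)+
  have d: "distr \<mu> borel (\<lambda>X. V ** X) = \<mu>" using haar V by (auto simp: is_haar_unitary_def)
  have "avg F B = (\<integral>\<^sup>+U. F (B ** U) \<partial>distr \<mu> borel (\<lambda>X. V ** X))" by (simp add: avg_def d)
  also have "\<dots> = (\<integral>\<^sup>+U. F (B ** (V ** U)) \<partial>\<mu>)" by (rule nn_integral_distr) measurable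
  finally show ?thesis by (simp add: avg_def matrix_mul_assoc)
qed

text \<open>Fubini, and the invariance of the weight and of Lebesgue measure under right
  multiplication by a unitary matrix.\<close>

lemma nn_integral_avg:
  assumes F [measurable]: "F \<in> borel_measurable borel"
  shows "(\<integral>\<^sup>+B. avg F B * ennreal ((cmod (det B))\<^sup>2) * gauss B \<partial>lborel)
    = (\<integral>\<^sup>+B. F B * ennreal ((cmod (det B))\<^sup>2) * gauss B \<partial>lborel)"
proof -
  interpret pair_sigma_finite "lborel :: (complex ^ 'm ^ 'm) measure" \<mu> ..
  let ?G = "\<lambda>B. F B * ennreal ((cmod (det B))\<^sup>2) * gauss B"
  have detm [measurable]: "(\<lambda>B :: complex ^ 'm ^ 'm. det B) \<in> borel_measurable borel"
    by (intro borel_measurable_continuous_onI continuous_intros)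
  have multm [measurable]: "(\<lambda>U. B ** U) \<in> borel_measurable borel" "(\<lambda>X. X ** B) \<in> borel_measurable borel" for B :: "complex ^ 'm ^ 'm"
    by (intro borel_measurable_continuous_onI continuous_intros)+
  have mf: "(\<lambda>p. F (fst p ** snd p) * ennreal ((cmod (det (fst p)))\<^sup>2) * gauss (fst p)) \<in> borel_measurable (lborel \<Otimes>\<^sub>M \<mu>)"
  proof -
    have m1: "(\<lambda>p :: (complex ^ 'm ^ 'm) \<times> (complex ^ 'm ^ 'm). fst p ** snd p) \<in> borel_measurable borel"
      and m2: "(fst :: (complex ^ 'm ^ 'm) \<times> (complex ^ 'm ^ 'm) \<Rightarrow> _) \<in> borel_measurable borel"
      by (intro borel_measurable_continuous_onI continuous_intros)+
    have "(\<lambda>p. F (fst p ** snd p) * ennreal ((cmod (det (fst p)))\<^sup>2) * gauss (fst p)) \<in> borel_measurable borel"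
      using m1 m2 by measurable
    moreover have "sets (lborel \<Otimes>\<^sub>M \<mu>) = sets (borel :: ((complex ^ 'm ^ 'm) \<times> (complex ^ 'm ^ 'm)) measure)"
      by (simp add: borel_prod[symmetric] cong: sets_pair_measure_cong)
    ultimately show ?thesis by (subst measurable_cong_sets[OF _ refl])
  qed
  have "(\<integral>\<^sup>+B. avg F B * ennreal ((cmod (det B))\<^sup>2) * gauss B \<partial>lborel)
      = (\<integral>\<^sup>+B. \<integral>\<^sup>+U. F (B ** U) * ennreal ((cmod (det B))\<^sup>2) * gauss B \<partial>\<mu> \<partial>lborel)"
    unfolding avg_def by (intro nn_integral_cong) (simp add: nn_integral_multc mult.assoc)
  also have "\<dots> = (\<integral>\<^sup>+U. \<integral>\<^sup>+B. F (B ** U) * ennreal ((cmod (det B))\<^sup>2) * gauss B \<partial>lborel \<partial>\<mu>)"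
    using Fubini[OF mf] by simp
  also have "\<dots> = (\<integral>\<^sup>+U. (\<integral>\<^sup>+B. ?G B \<partial>lborel) \<partial>\<mu>)"
  proof (rule nn_integral_cong_AE, use AE_unitary in eventually_elim)
    fix U :: "complex ^ 'm ^ 'm" assume U: "U \<in> unitary_mats"
    have "(\<integral>\<^sup>+B. F (B ** U) * ennreal ((cmod (det B))\<^sup>2) * gauss B \<partial>lborel) = (\<integral>\<^sup>+B. ?G (B ** U) \<partial>lborel)"
      by (intro nn_integral_cong)
         (simp add: norm_mult_unitary[OF unitary_matsD(2)[OF U]] det_mul norm_mult cmod_det_unitary[OF U])
    also have "\<dots> = (\<integral>\<^sup>+B. ?G B \<partial>lborel)"
      by (rule nn_integral_isometry[OF linear_matrix_mult_right norm_mult_unitary[OF unitary_matsD(2)[OF U]]]) measurable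
    finally show "(\<integral>\<^sup>+B. F (B ** U) * ennreal ((cmod (det B))\<^sup>2) * gauss B \<partial>lborel) = (\<integral>\<^sup>+B. ?G B \<partial>lborel)" .
  qed
  also have "\<dots> = (\<integral>\<^sup>+B. ?G B \<partial>lborel)" by (simp add: emeasure_space_1[simplified])
  finally show ?thesis .
qed

text \<open>If M M^H = B B^H with B invertible, then M Q = B V with V unitary, so the average of
  \<open>F\<close> cannot distinguish M Q from B.\<close>

lemma nn_integral_rect_haar:
  fixes Q :: "complex ^ ('m option) ^ 'm \<Rightarrow> complex ^ 'm ^ ('m option)"
  assumes F [measurable]: "F \<in> borel_measurable borel" and Q [measurable]: "Q \<in> borel_measurable borel"
    and N: "N \<in> null_sets lborel"
    and gram: "\<And>M. M \<notin> N \<Longrightarrow> M ** cadj M = (M ** Q M) ** cadj (M ** Q M)"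
  shows "(\<integral>\<^sup>+M. avg F (M ** Q M) * gauss M \<partial>lborel)
    = chart_mass TYPE('m) * (\<integral>\<^sup>+B. F B * ennreal ((cmod (det B))\<^sup>2) * gauss B \<partial>lborel)"
  unfolding nn_integral_avg[OF F, symmetric]
proof (rule nn_integral_rect_to_square[OF _ _ N])
  show "avg F \<in> borel_measurable borel" by measurable
  have "(\<lambda>p :: (complex ^ ('m option) ^ 'm) \<times> (complex ^ 'm ^ ('m option)). fst p ** snd p) \<in> borel_measurable borel"
    by (intro borel_measurable_continuous_onI continuous_intros)
  then have "(\<lambda>M. fst (M, Q M) ** snd (M, Q M)) \<in> borel_measurable borel"
    by (rule measurable_compose[rotated]) (intro borel_measurable_Pair measurable_ident_sets Q, simp)
  then have [measurable]: "(\<lambda>M. M ** Q M) \<in> borel_measurable borel" by simp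
  show "(\<lambda>M. avg F (M ** Q M)) \<in> borel_measurable borel" by measurable
  fix M :: "complex ^ ('m option) ^ 'm" and B assume M: "M \<notin> N" and B: "det B \<noteq> 0" and eq: "M ** cadj M = B ** cadj B"
  obtain B' where B': "B ** B' = mat 1" "B' ** B = mat 1" using det_inverse_obtain[OF B] .
  let ?C = "M ** Q M" and ?V = "B' ** (M ** Q M)"
  have "?V ** cadj ?V = B' ** (?C ** cadj ?C) ** cadj B'" by (simp add: cadj_mult matrix_mul_assoc)
  also have "?C ** cadj ?C = B ** cadj B" using gram[OF M] eq by simp
  also have "B' ** (B ** cadj B) ** cadj B' = (B' ** B) ** cadj (B' ** B)" by (simp only: cadj_mult matrix_mul_assoc)
  also have "\<dots> = mat 1" by (simp add: B')
  finally have "?V \<in> unitary_mats" by (simp add: unitary_mats_def matrix_left_right_inverse)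
  moreover have "?C = B ** ?V" using B' by (simp add: matrix_mul_assoc)
  ultimately show "avg F (M ** Q M) = avg F B" using avg_mult_unitary[OF F, of ?V B] by simp
qed
end

section \<open>Integration against the sampling density\<close>

lemma gaussian_complex:
  assumes "a > 0"
  shows "(\<integral>\<^sup>+z. ennreal (exp (- (a * (cmod z)\<^sup>2))) \<partial>lborel) = ennreal (pi / a)"
  using nn_integral_gaussian_euclidean[OF assms, where 'a = complex] assms by simp

lemma gaussian_complex_moment:
  assumes a: "a > 0"
  shows "(\<integral>\<^sup>+z. ennreal ((cmod z)\<^sup>2) * ennreal (exp (- (a * (cmod z)\<^sup>2))) \<partial>lborel) = ennreal (pi / a\<^sup>2)"
proof -
  let ?s = "complex_of_real (1 / sqrt a)"
  have s: "?s \<noteq> 0" using a by simp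
  have inj: "inj (\<lambda>z. ?s * z)" using s by (auto simp: inj_def)
  have 1: "(\<integral>\<^sup>+z. ennreal ((cmod z)\<^sup>2) * gauss z \<partial>lborel) = ennreal pi"
  proof -
    have "(\<integral>\<^sup>+z. ennreal ((cmod z)\<^sup>2) * gauss z \<partial>lborel)
        = (\<integral>\<^sup>+z. ennreal ((z \<bullet> 1)\<^sup>2) * gauss z + ennreal ((z \<bullet> \<i>)\<^sup>2) * gauss z \<partial>lborel)"
      by (intro nn_integral_cong) (simp add: cmod_power2 distrib_right inner_complex_def)
    also have "\<dots> = ennreal (pi / 2) + ennreal (pi / 2)"
      using gaussian_second_moment_inner[of "1 :: complex"] gaussian_second_moment_inner[of \<i>]
      by (subst nn_integral_add) simp_all
    finally show ?thesis by (simp add: ennreal_plus[symmetric] del: ennreal_plus)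
  qed
  have "(\<integral>\<^sup>+z. ennreal ((cmod z)\<^sup>2) * ennreal (exp (- (a * (cmod z)\<^sup>2))) \<partial>lborel)
      = ennreal ((cmod ?s)\<^sup>2) * (\<integral>\<^sup>+z. ennreal ((cmod (?s * z))\<^sup>2) * ennreal (exp (- (a * (cmod (?s * z))\<^sup>2))) \<partial>lborel)"
    using nn_integral_linear[OF linear_cmult inj, of "\<lambda>z. ennreal ((cmod z)\<^sup>2) * ennreal (exp (- (a * (cmod z)\<^sup>2)))"]
    unfolding jac_cmult[OF s] by simp
  also have "(\<integral>\<^sup>+z. ennreal ((cmod (?s * z))\<^sup>2) * ennreal (exp (- (a * (cmod (?s * z))\<^sup>2))) \<partial>lborel)
      = (\<integral>\<^sup>+z. ennreal (1 / a) * (ennreal ((cmod z)\<^sup>2) * gauss z) \<partial>lborel)"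
    using a by (intro nn_integral_cong) (simp add: norm_mult norm_divide power_divide ennreal_mult[symmetric])
  also have "\<dots> = ennreal (1 / a) * ennreal pi"
    by (subst nn_integral_cmult) (auto simp: 1)
  finally show ?thesis using a by (simp add: norm_divide power_divide ennreal_mult[symmetric] power2_eq_square)
qed

text \<open>The rectangular-to-square identity for the constant function 1. The normalisation
  estimate takes the size of \<open>chart_mass\<close> from this product.\<close>

lemma chart_mass_det:
  "chart_mass TYPE('m::finite) * (\<integral>\<^sup>+B. ennreal ((cmod (det B))\<^sup>2) * gauss B \<partial>(lborel :: (complex ^ 'm ^ 'm) measure))
    = ennreal (pi ^ (CARD('m) * (CARD('m) + 1)))"
proof -
  have "(\<integral>\<^sup>+M. gauss M \<partial>(lborel :: (complex ^ ('m option) ^ 'm) measure)) = ennreal (sqrt pi ^ (2 * (CARD('m) * (CARD('m) + 1))))"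
    using nn_integral_gaussian_euclidean[of 1, where 'a = "complex ^ ('m option) ^ 'm"] by (simp add: mult_ac)
  also have "sqrt pi ^ (2 * (CARD('m) * (CARD('m) + 1))) = pi ^ (CARD('m) * (CARD('m) + 1))"
    by (subst power_mult) simp
  finally show ?thesis
    using nn_integral_rect_to_square[of "\<lambda>_ :: complex ^ 'm ^ 'm. 1" "\<lambda>_. 1" "{}"] by simp
qed

context haar_unitary
begin

lemma sets_theta_base: "sets (theta_base \<mu>) = sets borel"
  unfolding theta_base_def borel_prod[symmetric]
  by (intro sets_pair_measure_cong sets_lborel sets_haar)

lemma nn_integral_theta_base:
  assumes f: "f \<in> borel_measurable borel"
  shows "(\<integral>\<^sup>+\<omega>. f \<omega> \<partial>theta_base \<mu>) = (\<integral>\<^sup>+z. \<integral>\<^sup>+M. \<integral>\<^sup>+U. \<integral>\<^sup>+w. f (z, M, U, w) \<partial>lborel \<partial>\<mu> \<partial>lborel \<partial>lborel)"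
proof -
  have sf1: "sigma_finite_measure (\<mu> \<Otimes>\<^sub>M (lborel :: (complex ^ 'm) measure))"
    by (intro sigma_finite_pair_measure sigma_finite_measure_axioms lborel.sigma_finite_measure_axioms)
  have sf2: "sigma_finite_measure ((lborel :: (complex ^ ('m option) ^ 'm) measure) \<Otimes>\<^sub>M \<mu> \<Otimes>\<^sub>M (lborel :: (complex ^ 'm) measure))"
    by (intro sigma_finite_pair_measure sf1 lborel.sigma_finite_measure_axioms)
  have f1: "f \<in> borel_measurable (lborel \<Otimes>\<^sub>M lborel \<Otimes>\<^sub>M \<mu> \<Otimes>\<^sub>M lborel)"
    using f sets_theta_base unfolding theta_base_def by (simp cong: measurable_cong_sets)
  have "(\<integral>\<^sup>+\<omega>. f \<omega> \<partial>theta_base \<mu>) = (\<integral>\<^sup>+z. \<integral>\<^sup>+q. f (z, q) \<partial>(lborel \<Otimes>\<^sub>M \<mu> \<Otimes>\<^sub>M lborel) \<partial>lborel)"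
    unfolding theta_base_def using sigma_finite_measure.nn_integral_fst[OF sf2 f1] by simp
  also have "\<dots> = (\<integral>\<^sup>+z. \<integral>\<^sup>+M. \<integral>\<^sup>+q. f (z, M, q) \<partial>(\<mu> \<Otimes>\<^sub>M lborel) \<partial>lborel \<partial>lborel)"
  proof (rule nn_integral_cong)
    fix z :: complex
    have "(\<lambda>q. f (z, q)) \<in> borel_measurable (lborel \<Otimes>\<^sub>M \<mu> \<Otimes>\<^sub>M lborel)"
      using f1 by (rule measurable_Pair2) simp
    from sigma_finite_measure.nn_integral_fst[OF sf1 this]
    show "(\<integral>\<^sup>+q. f (z, q) \<partial>(lborel \<Otimes>\<^sub>M \<mu> \<Otimes>\<^sub>M lborel)) = (\<integral>\<^sup>+M. \<integral>\<^sup>+q. f (z, M, q) \<partial>(\<mu> \<Otimes>\<^sub>M lborel) \<partial>lborel)"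
      by simp
  qed
  also have "\<dots> = (\<integral>\<^sup>+z. \<integral>\<^sup>+M. \<integral>\<^sup>+U. \<integral>\<^sup>+w. f (z, M, U, w) \<partial>lborel \<partial>\<mu> \<partial>lborel \<partial>lborel)"
  proof (intro nn_integral_cong)
    fix z :: complex and M :: "complex ^ ('m option) ^ 'm"
    have "(\<lambda>q. f (z, q)) \<in> borel_measurable (lborel \<Otimes>\<^sub>M \<mu> \<Otimes>\<^sub>M lborel)"
      using f1 by (rule measurable_Pair2) simp
    then have "(\<lambda>q. f (z, M, q)) \<in> borel_measurable (\<mu> \<Otimes>\<^sub>M lborel)"
      by (rule measurable_Pair2) simp
    from lborel.nn_integral_fst[OF this]
    show "(\<integral>\<^sup>+q. f (z, M, q) \<partial>(\<mu> \<Otimes>\<^sub>M lborel)) = (\<integral>\<^sup>+U. \<integral>\<^sup>+w. f (z, M, U, w) \<partial>lborel \<partial>\<mu>)"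
      by simp
  qed
  finally show ?thesis .
qed

lemma AE_theta_base_M:
  assumes R: "R \<in> null_sets lborel"
  shows "AE \<omega> in theta_base \<mu>. fst (snd \<omega>) \<notin> R"
proof -
  have [measurable]: "R \<in> sets borel" using R by auto
  have p: "(\<lambda>\<omega>. fst (snd \<omega>)) \<in> borel_measurable (borel :: (complex \<times> (complex ^ ('m option) ^ 'm) \<times> (complex ^ 'm ^ 'm) \<times> (complex ^ 'm)) measure)"
    by (intro borel_measurable_continuous_onI continuous_intros)
  have m: "(\<lambda>\<omega>. indicator R (fst (snd \<omega>)) :: ennreal) \<in> borel_measurable (borel :: (complex \<times> (complex ^ ('m option) ^ 'm) \<times> (complex ^ 'm ^ 'm) \<times> (complex ^ 'm)) measure)"
    using p by measurable
  have "(\<integral>\<^sup>+M. indicator R M * c \<partial>lborel) = 0" for c :: ennreal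
    using R by (subst nn_integral_multc) auto
  then have "(\<integral>\<^sup>+\<omega>. indicator R (fst (snd \<omega>)) \<partial>theta_base \<mu>) = 0"
    by (subst nn_integral_theta_base[OF m]) (simp add: emeasure_space_1[simplified])
  then show ?thesis
    using m sets_theta_base by (subst (asm) nn_integral_0_iff_AE) (auto simp: indicator_def cong: measurable_cong_sets)
qed

lemma AE_theta_base_U: "AE \<omega> in theta_base \<mu>. fst (snd (snd \<omega>)) \<in> unitary_mats"
proof -
  let ?R = "- unitary_mats :: (complex ^ 'm ^ 'm) set"
  have "closed (unitary_mats :: (complex ^ 'm ^ 'm) set)"
    unfolding unitary_mats_def cadj_def by (intro closed_Collect_eq continuous_intros)
  then have [measurable]: "?R \<in> sets borel" by (simp add: borel_closed)
  have p: "(\<lambda>\<omega>. fst (snd (snd \<omega>))) \<in> borel_measurable (borel :: (complex \<times> (complex ^ ('m option) ^ 'm) \<times> (complex ^ 'm ^ 'm) \<times> (complex ^ 'm)) measure)"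
    by (intro borel_measurable_continuous_onI continuous_intros)
  have m: "(\<lambda>\<omega>. indicator ?R (fst (snd (snd \<omega>))) :: ennreal) \<in> borel_measurable (borel :: (complex \<times> (complex ^ ('m option) ^ 'm) \<times> (complex ^ 'm ^ 'm) \<times> (complex ^ 'm)) measure)"
    using p by measurable
  have "(\<integral>\<^sup>+U. indicator ?R U * c \<partial>\<mu>) = 0" for c :: ennreal
    using haar by (subst nn_integral_multc) (auto simp: is_haar_unitary_def)
  then have "(\<integral>\<^sup>+\<omega>. indicator ?R (fst (snd (snd \<omega>))) \<partial>theta_base \<mu>) = 0"
    by (subst nn_integral_theta_base[OF m]) simp
  then have "AE \<omega> in theta_base \<mu>. fst (snd (snd \<omega>)) \<notin> ?R"
    using m sets_theta_base by (subst (asm) nn_integral_0_iff_AE) (auto simp: indicator_def cong: measurable_cong_sets)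
  then show ?thesis by simp
qed

end

locale haar_qr = haar_unitary \<mu> for \<mu> :: "(complex ^ 'm ^ 'm) measure" +
  fixes Q :: "complex ^ ('m option) ^ 'm \<Rightarrow> complex ^ 'm ^ ('m option)" and N
  assumes Q_measurable [measurable]: "Q \<in> borel_measurable borel"
    and N_null: "N \<in> null_sets lborel"
    and gram: "\<And>M. M \<notin> N \<Longrightarrow> M ** cadj M = (M ** Q M) ** cadj (M ** Q M)"
begin

lemma MQ_measurable [measurable]: "(\<lambda>M. M ** Q M) \<in> borel_measurable borel"
proof -
  have "(\<lambda>p :: (complex ^ ('m option) ^ 'm) \<times> (complex ^ 'm ^ ('m option)). fst p ** snd p) \<in> borel_measurable borel"
    by (intro borel_measurable_continuous_onI continuous_intros)
  then have "(\<lambda>M. fst (M, Q M) ** snd (M, Q M)) \<in> borel_measurable borel"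
    by (rule measurable_compose[rotated]) (intro borel_measurable_Pair measurable_ident_sets Q_measurable, simp)
  then show ?thesis by simp
qed

text \<open>Test the integral identity on the indicator of singular matrices: the weight |det B|^2
  annihilates the right side, while the average equals 1 wherever M Q is singular.\<close>

lemma AE_det_MQ: "\<exists>R \<in> null_sets lborel. \<forall>M. M \<notin> R \<longrightarrow> det (M ** Q M) \<noteq> 0"
proof
  let ?R = "{M. det (M ** Q M) = 0}"
  have detm [measurable]: "(\<lambda>B :: complex ^ 'm ^ 'm. det B) \<in> borel_measurable borel"
    by (intro borel_measurable_continuous_onI continuous_intros)
  let ?F = "indicator {B :: complex ^ 'm ^ 'm. det B = 0} :: _ \<Rightarrow> ennreal"
  have Rm: "?R \<in> sets borel" by measurable
  have Fm: "?F \<in> borel_measurable borel" by measurable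
  have "(\<integral>\<^sup>+M. avg ?F (M ** Q M) * gauss M \<partial>lborel)
      = chart_mass TYPE('m) * (\<integral>\<^sup>+B. ?F B * ennreal ((cmod (det B))\<^sup>2) * gauss B \<partial>lborel)"
    by (rule nn_integral_rect_haar[OF Fm Q_measurable N_null gram])
  also have "(\<lambda>B. ?F B * ennreal ((cmod (det B))\<^sup>2) * gauss B) = (\<lambda>_. 0)"
    by (auto simp: indicator_def fun_eq_iff)
  finally have "(\<integral>\<^sup>+M. avg ?F (M ** Q M) * gauss M \<partial>lborel) = 0" by simp
  moreover have "(\<lambda>M. avg ?F (M ** Q M) * gauss M) \<in> borel_measurable lborel"
    using measurable_compose[OF MQ_measurable avg_measurable[OF Fm]] by measurable
  ultimately have "AE M in lborel. avg ?F (M ** Q M) * gauss M = 0"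
    by (simp add: nn_integral_0_iff_AE)
  moreover have "avg ?F C = 1" if "det C = 0" for C
    using that by (simp add: avg_def det_mul emeasure_space_1[simplified])
  ultimately have "AE M in lborel. M \<notin> ?R" by (auto elim!: eventually_mono)
  then show "?R \<in> null_sets lborel" using Rm by (simp add: AE_iff_null_sets)
qed simp

text \<open>For fixed z, integrating w first leaves a function of M Q U alone; its Haar average is
  covered by \<open>nn_integral_rect_haar\<close>, which replaces M Q U by a square matrix with
  weight |det B|^2.\<close>

lemma theta_expect:
  fixes \<Psi> :: "complex \<Rightarrow> complex ^ 'm \<Rightarrow> complex ^ 'm ^ 'm \<Rightarrow> ennreal"
  assumes \<Psi>: "(\<lambda>p. \<Psi> (fst p) (fst (snd p)) (snd (snd p))) \<in> borel_measurable borel"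
  shows "(\<lambda>(z, M, U, w). \<Psi> z w (M ** Q M ** U) * gauss M) \<in> borel_measurable borel"
    and "(\<integral>\<^sup>+\<omega>. (case \<omega> of (z, M, U, w) \<Rightarrow> \<Psi> z w (M ** Q M ** U) * gauss M) \<partial>theta_base \<mu>)
      = chart_mass TYPE('m) * (\<integral>\<^sup>+z. \<integral>\<^sup>+w. \<integral>\<^sup>+B. \<Psi> z w B * ennreal ((cmod (det B))\<^sup>2) * gauss B \<partial>lborel \<partial>lborel \<partial>lborel)"
    and "(\<lambda>(z, M, U, w). \<Psi> z w (M ** Q M ** U)) \<in> borel_measurable borel"
proof -
  let ?T = "borel :: (complex \<times> (complex ^ ('m option) ^ 'm) \<times> (complex ^ 'm ^ 'm) \<times> (complex ^ 'm)) measure"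
  have pm [measurable]: "(\<lambda>\<omega>. fst \<omega>) \<in> borel_measurable ?T" "(\<lambda>\<omega>. fst (snd \<omega>)) \<in> borel_measurable ?T"
    "(\<lambda>\<omega>. fst (snd (snd \<omega>))) \<in> borel_measurable ?T" "(\<lambda>\<omega>. snd (snd (snd \<omega>))) \<in> borel_measurable ?T"
    by (intro borel_measurable_continuous_onI continuous_intros)+
  have mm: "(\<lambda>p :: (complex ^ 'm ^ 'm) \<times> (complex ^ 'm ^ 'm). fst p ** snd p) \<in> borel_measurable borel"
    by (intro borel_measurable_continuous_onI continuous_intros)
  have 1: "(\<lambda>\<omega>. (fst (snd \<omega>) ** Q (fst (snd \<omega>)), fst (snd (snd \<omega>)))) \<in> borel_measurable ?T"
    by (intro borel_measurable_Pair measurable_compose[OF pm(2) MQ_measurable] pm)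
  have 2: "(\<lambda>\<omega>. fst (snd \<omega>) ** Q (fst (snd \<omega>)) ** fst (snd (snd \<omega>))) \<in> borel_measurable ?T"
    using measurable_compose[OF 1 mm] by simp
  have 3: "(\<lambda>\<omega>. (fst \<omega>, snd (snd (snd \<omega>)), fst (snd \<omega>) ** Q (fst (snd \<omega>)) ** fst (snd (snd \<omega>)))) \<in> borel_measurable ?T"
    by (intro borel_measurable_Pair pm 2)
  have 4: "(\<lambda>\<omega>. \<Psi> (fst \<omega>) (snd (snd (snd \<omega>))) (fst (snd \<omega>) ** Q (fst (snd \<omega>)) ** fst (snd (snd \<omega>)))) \<in> borel_measurable ?T"
    using measurable_compose[OF 3 \<Psi>] by simp
  show meas: "(\<lambda>(z, M, U, w). \<Psi> z w (M ** Q M ** U) * gauss M) \<in> borel_measurable borel"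
    unfolding case_prod_unfold using 4 by measurable
  show "(\<lambda>(z, M, U, w). \<Psi> z w (M ** Q M ** U)) \<in> borel_measurable borel"
    unfolding case_prod_unfold by (rule 4)
  have \<Psi>c: "(\<lambda>x. \<Psi> (f x) (g x) (h x)) \<in> borel_measurable borel"
    if "continuous_on UNIV f" "continuous_on UNIV g" "continuous_on UNIV h"
    for f :: "'x::euclidean_space \<Rightarrow> complex" and g :: "'x \<Rightarrow> complex ^ 'm" and h
  proof -
    have "(\<lambda>x. (f x, g x, h x)) \<in> borel_measurable borel"
      by (intro borel_measurable_continuous_onI continuous_intros that)
    from measurable_compose[OF this \<Psi>] show ?thesis by simp
  qed
  define F where "F z B = (\<integral>\<^sup>+w. \<Psi> z w B \<partial>lborel)" for z B
  have Fm: "F z \<in> borel_measurable borel" for z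
  proof -
    have "(\<lambda>q. \<Psi> z (snd q) (fst q)) \<in> borel_measurable (lborel \<Otimes>\<^sub>M lborel)"
      unfolding lborel_prod by simp (intro \<Psi>c continuous_intros)
    from lborel.borel_measurable_nn_integral_fst[OF this] show ?thesis by (simp add: F_def[abs_def])
  qed
  have swap: "(\<integral>\<^sup>+B. F z B * ennreal ((cmod (det B))\<^sup>2) * gauss B \<partial>lborel)
      = (\<integral>\<^sup>+w. \<integral>\<^sup>+B. \<Psi> z w B * ennreal ((cmod (det B))\<^sup>2) * gauss B \<partial>lborel \<partial>lborel)" for z
  proof -
    have m1: "(\<lambda>q. \<Psi> z (fst q) (snd q)) \<in> borel_measurable borel" by (intro \<Psi>c continuous_intros)
    have m2: "(\<lambda>q :: (complex ^ 'm) \<times> (complex ^ 'm ^ 'm). det (snd q)) \<in> borel_measurable borel"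
      "(\<lambda>q :: (complex ^ 'm) \<times> (complex ^ 'm ^ 'm). snd q) \<in> borel_measurable borel"
      by (intro borel_measurable_continuous_onI continuous_intros)+
    have m: "(\<lambda>q. \<Psi> z (fst q) (snd q) * ennreal ((cmod (det (snd q)))\<^sup>2) * gauss (snd q)) \<in> borel_measurable borel"
      using m1 m2 by measurable
    have mw: "(\<lambda>w. \<Psi> z w B) \<in> borel_measurable borel" for B by (intro \<Psi>c continuous_intros)
    have "(\<integral>\<^sup>+B. F z B * ennreal ((cmod (det B))\<^sup>2) * gauss B \<partial>lborel)
        = (\<integral>\<^sup>+B. \<integral>\<^sup>+w. \<Psi> z w B * ennreal ((cmod (det B))\<^sup>2) * gauss B \<partial>lborel \<partial>lborel)"
      unfolding F_def using mw by (intro nn_integral_cong) (simp add: nn_integral_multc mult.assoc)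
    then show ?thesis using nn_integral_lborel_prod_iter[OF m] by simp
  qed
  have "(\<integral>\<^sup>+\<omega>. (case \<omega> of (z, M, U, w) \<Rightarrow> \<Psi> z w (M ** Q M ** U) * gauss M) \<partial>theta_base \<mu>)
      = (\<integral>\<^sup>+z. \<integral>\<^sup>+M. avg (F z) (M ** Q M) * gauss M \<partial>lborel \<partial>lborel)"
  proof (subst nn_integral_theta_base[OF meas], intro nn_integral_cong)
    fix z :: complex and M
    have mw: "(\<lambda>w. \<Psi> z w B) \<in> borel_measurable borel" for B by (intro \<Psi>c continuous_intros)
    have "(\<lambda>U. M ** Q M ** U) \<in> borel_measurable borel" by (intro borel_measurable_continuous_onI continuous_intros)
    then have mU: "(\<lambda>U. F z (M ** Q M ** U)) \<in> borel_measurable \<mu>"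
      using measurable_compose[OF _ Fm] by (simp cong: measurable_cong_sets)
    show "(\<integral>\<^sup>+U. \<integral>\<^sup>+w. (case (z, M, U, w) of (z, M, U, w) \<Rightarrow> \<Psi> z w (M ** Q M ** U) * gauss M) \<partial>lborel \<partial>\<mu>) = avg (F z) (M ** Q M) * gauss M"
      using mw mU by (simp add: nn_integral_multc avg_def F_def[symmetric])
  qed
  also have "\<dots> = (\<integral>\<^sup>+z. chart_mass TYPE('m) * (\<integral>\<^sup>+w. \<integral>\<^sup>+B. \<Psi> z w B * ennreal ((cmod (det B))\<^sup>2) * gauss B \<partial>lborel \<partial>lborel) \<partial>lborel)"
  proof (rule nn_integral_cong)
    fix z
    show "(\<integral>\<^sup>+M. avg (F z) (M ** Q M) * gauss M \<partial>lborel) = chart_mass TYPE('m) *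
        (\<integral>\<^sup>+w. \<integral>\<^sup>+B. \<Psi> z w B * ennreal ((cmod (det B))\<^sup>2) * gauss B \<partial>lborel \<partial>lborel)"
      unfolding swap[symmetric] by (rule nn_integral_rect_haar[OF Fm Q_measurable N_null gram])
  qed
  also have "\<dots> = chart_mass TYPE('m) * (\<integral>\<^sup>+z. \<integral>\<^sup>+w. \<integral>\<^sup>+B. \<Psi> z w B * ennreal ((cmod (det B))\<^sup>2) * gauss B \<partial>lborel \<partial>lborel \<partial>lborel)"
  proof (rule nn_integral_cmult)
    have m2: "(\<lambda>q :: complex \<times> (complex ^ 'm) \<times> (complex ^ 'm ^ 'm). det (snd (snd q))) \<in> borel_measurable borel"
      "(\<lambda>q :: complex \<times> (complex ^ 'm) \<times> (complex ^ 'm ^ 'm). snd (snd q)) \<in> borel_measurable borel"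
      by (intro borel_measurable_continuous_onI continuous_intros)+
    have "(\<lambda>q. \<Psi> (fst q) (fst (snd q)) (snd (snd q)) * ennreal ((cmod (det (snd (snd q))))\<^sup>2) * gauss (snd (snd q))) \<in> borel_measurable (lborel \<Otimes>\<^sub>M lborel)"
      unfolding lborel_prod using \<Psi> m2 by measurable
    from lborel.borel_measurable_nn_integral_fst[OF this]
    have "(\<lambda>z. \<integral>\<^sup>+q. \<Psi> z (fst q) (snd q) * ennreal ((cmod (det (snd q)))\<^sup>2) * gauss (snd q) \<partial>lborel) \<in> borel_measurable borel"
      by simp
    moreover have "(\<integral>\<^sup>+q. \<Psi> z (fst q) (snd q) * ennreal ((cmod (det (snd q)))\<^sup>2) * gauss (snd q) \<partial>lborel)
        = (\<integral>\<^sup>+w. \<integral>\<^sup>+B. \<Psi> z w B * ennreal ((cmod (det B))\<^sup>2) * gauss B \<partial>lborel \<partial>lborel)" for z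
    proof -
      have m1: "(\<lambda>q. \<Psi> z (fst q) (snd q)) \<in> borel_measurable borel" by (intro \<Psi>c continuous_intros)
      have m2: "(\<lambda>q :: (complex ^ 'm) \<times> (complex ^ 'm ^ 'm). det (snd q)) \<in> borel_measurable borel"
        "(\<lambda>q :: (complex ^ 'm) \<times> (complex ^ 'm ^ 'm). snd q) \<in> borel_measurable borel"
        by (intro borel_measurable_continuous_onI continuous_intros)+
      have m: "(\<lambda>q. \<Psi> z (fst q) (snd q) * ennreal ((cmod (det (snd q)))\<^sup>2) * gauss (snd q)) \<in> borel_measurable borel"
        using m1 m2 by measurable
      show ?thesis using nn_integral_lborel_prod_iter(2)[OF m] by simp
    qed
    ultimately show "(\<lambda>z. \<integral>\<^sup>+w. \<integral>\<^sup>+B. \<Psi> z w B * ennreal ((cmod (det B))\<^sup>2) * gauss B \<partial>lborel \<partial>lborel) \<in> borel_measurable lborel" by simp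
  qed
  finally show "(\<integral>\<^sup>+\<omega>. (case \<omega> of (z, M, U, w) \<Rightarrow> \<Psi> z w (M ** Q M ** U) * gauss M) \<partial>theta_base \<mu>)
      = chart_mass TYPE('m) * (\<integral>\<^sup>+z. \<integral>\<^sup>+w. \<integral>\<^sup>+B. \<Psi> z w B * ennreal ((cmod (det B))\<^sup>2) * gauss B \<partial>lborel \<partial>lborel \<partial>lborel)" .
qed

end

text \<open>\<open>theta_dens\<close> contains \<open>mp_pinv\<close>, whose measurability is not
  established here. A density measure sees its function through nonnegative integrals, for which
  equality almost everywhere is enough.\<close>

lemma density_cong_AE_nonmeasurable:
  assumes "AE x in M. f x = g x"
  shows "density M f = density M g"
proof -
  have "(\<integral>\<^sup>+x. f x * indicator A x \<partial>M) = (\<integral>\<^sup>+x. g x * indicator A x \<partial>M)" for A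
    using assms by (intro nn_integral_cong_AE) (auto elim!: eventually_mono)
  then show ?thesis by (simp add: density_def)
qed

text \<open>The unnormalised density as a function of z, w and B = M Q U, apart from the factor exp
  (-|M|^2), which stays with M.\<close>

definition near_weight :: "complex \<Rightarrow> complex ^ 'm \<Rightarrow> complex ^ 'm ^ 'm \<Rightarrow> ennreal" where
  "near_weight z w B = ennreal (2 * (real CARD('m) + 1) ^ 3 / pi ^ ((CARD('m) + 1) * (CARD('m) + 1))
     * exp (- (2 * (real CARD('m) + 1) ^ 3 * (cmod z)\<^sup>2))) * gauss w * (if near z B then 1 else 0)"

lemma near_weight_measurable:
  "(\<lambda>p :: complex \<times> (complex ^ 'm) \<times> (complex ^ 'm ^ 'm). near_weight (fst p) (fst (snd p)) (snd (snd p))) \<in> borel_measurable borel"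
proof -
  let ?T = "borel :: (complex \<times> (complex ^ 'm) \<times> (complex ^ 'm ^ 'm)) measure"
  have p: "(\<lambda>p. fst p) \<in> borel_measurable ?T" "(\<lambda>p. fst (snd p)) \<in> borel_measurable ?T"
    by (intro borel_measurable_continuous_onI continuous_intros)+
  have "closed {p :: complex \<times> (complex ^ 'm) \<times> (complex ^ 'm ^ 'm). near (fst p) (snd (snd p))}"
    unfolding near_def by (intro closed_Collect_le continuous_intros)
  then have [measurable]: "Measurable.pred ?T (\<lambda>p. near (fst p) (snd (snd p)))"
    unfolding pred_def by (simp add: borel_closed)
  show ?thesis unfolding near_weight_def using p by measurable
qed

text \<open>Without the cut-off the total mass is 1. Off the support |det B|^2 is at most n^2 |z|^2
  times \<open>cofsum B\<close>. The mean of |z|^2 is 1 / (2 n^3) and the cofactor sum brings a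
  factor n - 1, so the part cut away is at most (n - 1) / (2 n), below 1/2. This is what the
  coefficient 2 n^3 in the Gaussian for z achieves.\<close>

lemma near_weight_mass:
  "ennreal (1 / 2) \<le> chart_mass TYPE('m::finite) * (\<integral>\<^sup>+z. \<integral>\<^sup>+w. \<integral>\<^sup>+B.
     near_weight z (w :: complex ^ 'm) B * ennreal ((cmod (det B))\<^sup>2) * gauss B \<partial>lborel \<partial>lborel \<partial>lborel)" (is "_ \<le> ?T")
proof -
  let ?m = "CARD('m)"
  define n where "n = real ?m + 1"
  define a where "a = 2 * n ^ 3"
  define c where "c = a / pi ^ ((?m + 1) * (?m + 1))"
  define \<kappa> where "\<kappa> = chart_mass TYPE('m)"
  define D where "D = (\<integral>\<^sup>+B. ennreal ((cmod (det B))\<^sup>2) * gauss B \<partial>(lborel :: (complex ^ 'm ^ 'm) measure))"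
  have n: "n \<ge> 1" and a: "a > 0" and c: "c > 0" by (auto simp: n_def a_def c_def)
  have \<kappa>D: "\<kappa> * D = ennreal (pi ^ (?m * (?m + 1)))" unfolding \<kappa>_def D_def by (rule chart_mass_det)
  let ?e = "\<lambda>z. ennreal (c * exp (- (a * (cmod z)\<^sup>2)))"
  have nw: "near_weight z w B = ?e z * gauss w * (if near z B then 1 else 0)" for z and w :: "complex ^ 'm" and B
    by (simp add: near_weight_def c_def a_def n_def)
  have detm [measurable]: "(\<lambda>B :: complex ^ 'm ^ 'm. det B) \<in> borel_measurable borel"
    "(\<lambda>B :: complex ^ 'm ^ 'm. cofsum B) \<in> borel_measurable borel"
    by (intro borel_measurable_continuous_onI continuous_intros)+
  have nearm [measurable]: "Measurable.pred borel (\<lambda>B :: complex ^ 'm ^ 'm. near z B)" for z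
  proof -
    have "closed {B :: complex ^ 'm ^ 'm. near z B}"
      unfolding near_def by (intro closed_Collect_le continuous_intros)
    then show ?thesis unfolding pred_def by (simp add: borel_closed)
  qed
  have iter: "(\<integral>\<^sup>+z. \<integral>\<^sup>+(w :: complex ^ 'm). \<integral>\<^sup>+B. f z * gauss w * g B \<partial>lborel \<partial>lborel \<partial>lborel)
      = (\<integral>\<^sup>+z. f z \<partial>lborel) * ennreal (pi ^ ?m) * (\<integral>\<^sup>+B. g B \<partial>lborel)"
    if [measurable]: "f \<in> borel_measurable borel" "g \<in> borel_measurable borel"
    for f :: "complex \<Rightarrow> ennreal" and g :: "complex ^ 'm ^ 'm \<Rightarrow> ennreal"
    by (simp add: nn_integral_cmult nn_integral_multc nn_integral_gauss_vec mult.assoc)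
  let ?N = "\<lambda>z w (B :: complex ^ 'm ^ 'm). near_weight z w B * ennreal ((cmod (det B))\<^sup>2) * gauss B"
  let ?R = "\<lambda>z w (B :: complex ^ 'm ^ 'm). (?e z * ennreal ((n * cmod z)\<^sup>2)) * gauss w * (ennreal (cofsum B) * gauss B)"
  have "1 = ennreal (c * (pi / a)) * ennreal (pi ^ ?m) * (\<kappa> * D)"
  proof -
    have "c * (pi / a) * pi ^ ?m * pi ^ (?m * (?m + 1)) = 1"
      using a by (simp add: c_def power_add[symmetric] field_simps)
    then show ?thesis unfolding \<kappa>D using a c by (simp add: ennreal_mult[symmetric])
  qed
  also have "ennreal (c * (pi / a)) = (\<integral>\<^sup>+z. ?e z \<partial>lborel)"
  proof -
    have "(\<integral>\<^sup>+z. ?e z \<partial>lborel) = (\<integral>\<^sup>+z. ennreal c * ennreal (exp (- (a * (cmod z)\<^sup>2))) \<partial>lborel)"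
      using c by (simp add: ennreal_mult)
    also have "\<dots> = ennreal c * ennreal (pi / a)"
      by (subst nn_integral_cmult) (auto simp: gaussian_complex[OF a])
    finally show ?thesis using c a by (simp add: ennreal_mult[symmetric])
  qed
  also have "\<dots> * ennreal (pi ^ ?m) * (\<kappa> * D)
      = \<kappa> * (\<integral>\<^sup>+z. \<integral>\<^sup>+(w :: complex ^ 'm). \<integral>\<^sup>+(B :: complex ^ 'm ^ 'm). ?e z * gauss w * (ennreal ((cmod (det B))\<^sup>2) * gauss B) \<partial>lborel \<partial>lborel \<partial>lborel)"
    by (subst iter) (auto simp: D_def mult_ac)
  also have "\<dots> \<le> \<kappa> * (\<integral>\<^sup>+z. \<integral>\<^sup>+(w :: complex ^ 'm). \<integral>\<^sup>+B. ?N z w B + ?R z w B \<partial>lborel \<partial>lborel \<partial>lborel)"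
  proof (intro mult_left_mono nn_integral_mono)
    fix z and w :: "complex ^ 'm" and B :: "complex ^ 'm ^ 'm"
    show "?e z * gauss w * (ennreal ((cmod (det B))\<^sup>2) * gauss B) \<le> ?N z w B + ?R z w B"
    proof (cases "near z B")
      case True
      then show ?thesis by (simp add: nw mult.assoc)
    next
      case False
      then have "(cmod (det B))\<^sup>2 \<le> (n * cmod z)\<^sup>2 * cofsum B" by (simp add: near_def n_def)
      then have le: "ennreal ((cmod (det B))\<^sup>2) \<le> ennreal ((n * cmod z)\<^sup>2) * ennreal (cofsum B)"
        by (subst ennreal_mult[symmetric]) (auto intro!: ennreal_leI sum_nonneg simp: cofsum_def)
      have "?e z * gauss w * (ennreal ((cmod (det B))\<^sup>2) * gauss B)
          \<le> ?e z * gauss w * ((ennreal ((n * cmod z)\<^sup>2) * ennreal (cofsum B)) * gauss B)"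
        by (intro mult_left_mono mult_right_mono le) auto
      also have "\<dots> = ?R z w B" by (simp only: mult_ac)
      finally show ?thesis by (simp add: add_increasing)
    qed
  qed simp
  also have "\<dots> = ?T + \<kappa> * (\<integral>\<^sup>+z. \<integral>\<^sup>+(w :: complex ^ 'm). \<integral>\<^sup>+B. ?R z w B \<partial>lborel \<partial>lborel \<partial>lborel)"
  proof -
    \<comment> \<open>Splitting the iterated integral of a sum needs inner integrals that are
      measurable in z; \<open>G\<close> isolates the one in which the cut-off depends on z.\<close>
    define G where "G z = (\<integral>\<^sup>+(B :: complex ^ 'm ^ 'm). (if near z B then 1 else 0) * (ennreal ((cmod (det B))\<^sup>2) * gauss B) \<partial>lborel)" for z
    have Nz: "(\<integral>\<^sup>+(w :: complex ^ 'm). \<integral>\<^sup>+B. ?N z w B \<partial>lborel \<partial>lborel) = ?e z * ennreal (pi ^ ?m) * G z" for z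
      by (simp add: nw G_def mult.assoc nn_integral_cmult nn_integral_multc nn_integral_gauss_vec)
    have Gm [measurable]: "G \<in> borel_measurable borel"
    proof -
      have "closed {p :: complex \<times> (complex ^ 'm ^ 'm). near (fst p) (snd p)}"
        unfolding near_def by (intro closed_Collect_le continuous_intros)
      then have [measurable]: "Measurable.pred borel (\<lambda>p :: complex \<times> (complex ^ 'm ^ 'm). near (fst p) (snd p))"
        unfolding pred_def by (simp add: borel_closed)
      have d: "(\<lambda>p :: complex \<times> (complex ^ 'm ^ 'm). det (snd p)) \<in> borel_measurable borel"
        "(\<lambda>p :: complex \<times> (complex ^ 'm ^ 'm). snd p) \<in> borel_measurable borel"
        by (intro borel_measurable_continuous_onI continuous_intros)+
      have "(\<lambda>p :: complex \<times> (complex ^ 'm ^ 'm). (if near (fst p) (snd p) then 1 else 0) * (ennreal ((cmod (det (snd p)))\<^sup>2) * gauss (snd p)))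
          \<in> borel_measurable (lborel \<Otimes>\<^sub>M lborel)"
        unfolding lborel_prod using d by measurable
      from lborel.borel_measurable_nn_integral_fst[OF this] show ?thesis by (simp add: G_def[abs_def])
    qed
    have inner: "(\<integral>\<^sup>+(w :: complex ^ 'm). \<integral>\<^sup>+B. ?N z w B + ?R z w B \<partial>lborel \<partial>lborel)
        = ?e z * ennreal (pi ^ ?m) * G z + (?e z * ennreal ((n * cmod z)\<^sup>2)) * (ennreal (pi ^ ?m) * (\<integral>\<^sup>+B. ennreal (cofsum B) * gauss B \<partial>(lborel :: (complex ^ 'm ^ 'm) measure)))" for z
    proof -
      have "(\<integral>\<^sup>+B. ?N z w B + ?R z w B \<partial>lborel) = ?e z * gauss w * G z + (?e z * ennreal ((n * cmod z)\<^sup>2)) * gauss w * (\<integral>\<^sup>+B. ennreal (cofsum B) * gauss B \<partial>(lborel :: (complex ^ 'm ^ 'm) measure))" for w :: "complex ^ 'm"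
        unfolding nw mult.assoc[of "_ * _" "if _ then _ else _"] G_def
        by (subst nn_integral_add) (auto simp: nn_integral_cmult mult.assoc)
      then show ?thesis
        by (simp add: nn_integral_add nn_integral_cmult nn_integral_multc nn_integral_gauss_vec mult.assoc)
    qed
    have "(\<integral>\<^sup>+z. \<integral>\<^sup>+(w :: complex ^ 'm). \<integral>\<^sup>+B. ?N z w B + ?R z w B \<partial>lborel \<partial>lborel \<partial>lborel)
       = (\<integral>\<^sup>+z. \<integral>\<^sup>+(w :: complex ^ 'm). \<integral>\<^sup>+B. ?N z w B \<partial>lborel \<partial>lborel \<partial>lborel)
        + (\<integral>\<^sup>+z. (?e z * ennreal ((n * cmod z)\<^sup>2)) * (ennreal (pi ^ ?m) * (\<integral>\<^sup>+B. ennreal (cofsum B) * gauss B \<partial>(lborel :: (complex ^ 'm ^ 'm) measure))) \<partial>lborel)"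
      unfolding inner Nz by (subst nn_integral_add) auto
    also have "(\<integral>\<^sup>+z. (?e z * ennreal ((n * cmod z)\<^sup>2)) * (ennreal (pi ^ ?m) * (\<integral>\<^sup>+B. ennreal (cofsum B) * gauss B \<partial>(lborel :: (complex ^ 'm ^ 'm) measure))) \<partial>lborel)
        = (\<integral>\<^sup>+z. \<integral>\<^sup>+(w :: complex ^ 'm). \<integral>\<^sup>+B. ?R z w B \<partial>lborel \<partial>lborel \<partial>lborel)"
    proof -
      have "(\<integral>\<^sup>+z. \<integral>\<^sup>+(w :: complex ^ 'm). \<integral>\<^sup>+B. ?R z w B \<partial>lborel \<partial>lborel \<partial>lborel)
          = (\<integral>\<^sup>+z. ?e z * ennreal ((n * cmod z)\<^sup>2) \<partial>lborel) * ennreal (pi ^ ?m) * (\<integral>\<^sup>+B. ennreal (cofsum B) * gauss B \<partial>(lborel :: (complex ^ 'm ^ 'm) measure))"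
        by (rule iter) measurable
      moreover have "(\<integral>\<^sup>+z. (?e z * ennreal ((n * cmod z)\<^sup>2)) * k \<partial>lborel) = (\<integral>\<^sup>+z. ?e z * ennreal ((n * cmod z)\<^sup>2) \<partial>lborel) * k" for k
        by (rule nn_integral_multc) measurable
      ultimately show ?thesis by (simp only: mult.assoc)
    qed
    finally show ?thesis by (simp add: \<kappa>_def distrib_left)
  qed
  also have "\<kappa> * (\<integral>\<^sup>+z. \<integral>\<^sup>+(w :: complex ^ 'm). \<integral>\<^sup>+B. ?R z w B \<partial>lborel \<partial>lborel \<partial>lborel) \<le> ennreal (1 / 2)"
  proof -
    have z: "(\<integral>\<^sup>+z. ?e z * ennreal ((n * cmod z)\<^sup>2) \<partial>lborel) = ennreal (c * n\<^sup>2 * (pi / a\<^sup>2))"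
    proof -
      have "(\<integral>\<^sup>+z. ?e z * ennreal ((n * cmod z)\<^sup>2) \<partial>lborel)
          = (\<integral>\<^sup>+z. ennreal (c * n\<^sup>2) * (ennreal ((cmod z)\<^sup>2) * ennreal (exp (- (a * (cmod z)\<^sup>2)))) \<partial>lborel)"
        using c by (intro nn_integral_cong) (simp add: ennreal_mult[symmetric] power_mult_distrib mult_ac)
      also have "\<dots> = ennreal (c * n\<^sup>2) * ennreal (pi / a\<^sup>2)"
        by (subst nn_integral_cmult) (auto simp: gaussian_complex_moment[OF a])
      finally show ?thesis using c by (simp add: ennreal_mult[symmetric])
    qed
    have "\<kappa> * (\<integral>\<^sup>+z. \<integral>\<^sup>+(w :: complex ^ 'm). \<integral>\<^sup>+B. ?R z w B \<partial>lborel \<partial>lborel \<partial>lborel)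
        = ennreal (c * n\<^sup>2 * (pi / a\<^sup>2)) * ennreal (pi ^ ?m) * (ennreal (real ?m) * (\<kappa> * D))"
    proof -
      have "(\<integral>\<^sup>+z. \<integral>\<^sup>+(w :: complex ^ 'm). \<integral>\<^sup>+B. ?R z w B \<partial>lborel \<partial>lborel \<partial>lborel)
          = (\<integral>\<^sup>+z. ?e z * ennreal ((n * cmod z)\<^sup>2) \<partial>lborel) * ennreal (pi ^ ?m) * (\<integral>\<^sup>+B. ennreal (cofsum B) * gauss B \<partial>(lborel :: (complex ^ 'm ^ 'm) measure))"
        by (rule iter) measurable
      then show ?thesis
        unfolding z nn_integral_cofsum D_def[symmetric] ennreal_of_nat_eq_real_of_nat by (simp only: mult_ac)
    qed
    also have "\<dots> = ennreal (c * n\<^sup>2 * (pi / a\<^sup>2) * pi ^ ?m * (real ?m * pi ^ (?m * (?m + 1))))"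
      unfolding \<kappa>D using c a by (simp add: ennreal_mult[symmetric])
    also have "c * n\<^sup>2 * (pi / a\<^sup>2) * pi ^ ?m * (real ?m * pi ^ (?m * (?m + 1))) = n\<^sup>2 * real ?m / a"
    proof -
      have "pi * pi ^ ?m * pi ^ (?m * (?m + 1)) = pi ^ ((?m + 1) * (?m + 1))"
        by (simp add: power_add[symmetric] algebra_simps)
      then have "c * (pi * pi ^ ?m * pi ^ (?m * (?m + 1))) = a" by (simp add: c_def)
      moreover have "c * n\<^sup>2 * (pi / a\<^sup>2) * pi ^ ?m * (real ?m * pi ^ (?m * (?m + 1)))
          = c * (pi * pi ^ ?m * pi ^ (?m * (?m + 1))) * (n\<^sup>2 * real ?m / a\<^sup>2)" by simp
      ultimately show ?thesis using a by (simp add: power2_eq_square)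
    qed
    also have "ennreal (n\<^sup>2 * real ?m / a) \<le> ennreal (1 / 2)"
    proof -
      have "n\<^sup>2 * real ?m \<le> n\<^sup>2 * n" by (intro mult_left_mono) (auto simp: n_def)
      then have "n\<^sup>2 * real ?m \<le> a / 2" by (simp add: a_def power3_eq_cube power2_eq_square)
      then show ?thesis using a by (intro ennreal_leI) (simp add: field_simps)
    qed
    finally show ?thesis .
  qed
  finally have 1: "1 \<le> ?T + ennreal (1 / 2)" by (simp add: add_left_mono)
  show ?thesis
  proof (cases ?T)
    case (real t)
    have h: "?T + ennreal (1 / 2) = ennreal (t + 1 / 2)"
      unfolding real(2) using real(1) by (subst ennreal_plus) auto
    have "ennreal 1 \<le> ennreal (t + 1 / 2)" using 1 unfolding h by (simp only: ennreal_1)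
    then have "1 \<le> t + 1 / 2" using real(1) by (subst (asm) ennreal_le_iff) auto
    then have "1 / 2 \<le> t" by simp
    then have "ennreal (1 / 2) \<le> ennreal t" by (rule ennreal_leI)
    then show ?thesis using real(2) by simp
  qed simp
qed

section \<open>Comparison of the two expectations\<close>

lemma nn_integral_lborel_triple:
  fixes h :: "'a::euclidean_space \<times> 'b::euclidean_space \<times> 'c::euclidean_space \<Rightarrow> ennreal"
  assumes h: "h \<in> borel_measurable borel"
  shows "(\<integral>\<^sup>+p. h p \<partial>lborel) = (\<integral>\<^sup>+x. \<integral>\<^sup>+y. \<integral>\<^sup>+z. h (x, y, z) \<partial>lborel \<partial>lborel \<partial>lborel)"
proof -
  have "(\<lambda>q. h (x, q)) \<in> borel_measurable borel" for x
    by (rule measurable_compose[OF _ h]) (intro borel_measurable_continuous_onI continuous_intros)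
  then show ?thesis
    by (simp add: nn_integral_lborel_prod_iter(2)[OF h] nn_integral_lborel_prod_iter(2))
qed

text \<open>Both sides are brought to an integral over (z, w, B) with prefactor
  \<open>chart_mass\<close>, one by \<open>theta_expect\<close>, the other by
  \<open>chart_integral_eq\<close>, and the integrands are compared pointwise. The QR decomposition
  enters through \<open>QQ\<close> and \<open>MQ\<close>.\<close>

lemma theta_expectation_le:
  fixes Q :: "complex ^ ('m option) ^ 'm \<Rightarrow> complex ^ 'm ^ ('m option)"
    and \<mu> :: "(complex ^ 'm ^ 'm) measure"
    and \<phi> :: "complex ^ ('m option) ^ ('m option) \<Rightarrow> complex \<Rightarrow> complex ^ ('m option) \<Rightarrow> ennreal"
  assumes haar: "is_haar_unitary \<mu>"
    and N: "N \<in> null_sets lborel" and Qc: "continuous_on (- N) Q"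
    and QQ: "\<And>M. M \<notin> N \<Longrightarrow> cadj (Q M) ** Q M = mat 1"
    and MQ: "\<And>M. M \<notin> N \<Longrightarrow> M = (M ** Q M) ** cadj (Q M)"
    and meas: "(\<lambda>(A, l, v). \<phi> A l v) \<in> borel_measurable (restrict_space borel Vn)"
    and proj: "\<And>A l v c. (A, l, v) \<in> Vn \<Longrightarrow> c \<noteq> 0 \<Longrightarrow> \<phi> A l (c *s v) = \<phi> A l v"
    and unitary: "\<And>A l v U. (A, l, v) \<in> Vn \<Longrightarrow> U \<in> unitary_mats \<Longrightarrow>
      \<phi> (U ** A ** matrix_inv U) l (U *v v) = \<phi> A l v"
  shows "(\<integral>\<^sup>+ \<omega>. (case phi_n Q \<omega> of (A, l, v) \<Rightarrow> \<phi> A l v) \<partial>theta_n \<mu>)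
           \<le> ennreal (22 * real CARD('m option) ^ 3) *
             (\<integral>\<^sup>+ A. ennreal (gauss_density A) * eig_sum \<phi> A \<partial>lborel)"
proof -
  \<comment> \<open>\<open>Q\<close> is continuous off \<open>N\<close>; the value 0 on
    \<open>N\<close> turns it into a Borel function on the whole space.\<close>
  define Q' where "Q' M = (if M \<in> N then 0 else Q M)" for M
  interpret eig_observable \<phi>
    using meas proj unitary by unfold_locales
  interpret haar_qr \<mu> Q' N
  proof
    show "is_haar_unitary \<mu>" by (rule haar)
    show "Q' \<in> borel_measurable borel"
      unfolding Q'_def using N Qc by (intro borel_measurable_continuous_on_if) auto
    show "N \<in> null_sets lborel" by (rule N)
    show "M ** cadj M = M ** Q' M ** cadj (M ** Q' M)" if "M \<notin> N" for M
      using gram_of_isometry[OF QQ[OF that] MQ[OF that]] that by (simp add: Q'_def)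
  qed
  let ?m = "CARD('m)"
  define n where "n = real ?m + 1"
  have n: "real CARD('m option) = n" "n \<ge> 1" by (auto simp: n_def)
  have cardo: "CARD('m option) = ?m + 1" and cardn: "real (?m + 1) = n" by (simp_all add: n_def)
  define k where "k = 2 * n ^ 3 / pi ^ ((?m + 1) * (?m + 1))"
  have k: "k \<ge> 0" using n by (simp add: k_def)
  let ?base = "theta_base \<mu>"
  define dens where "dens \<omega> = (case \<omega> of (z, M, U, w) \<Rightarrow> near_weight z w (M ** Q' M ** U) * gauss M)" for \<omega>
  define val where "val \<omega> = (case \<omega> of (z, M, U, w) \<Rightarrow> schur_val z w (M ** Q' M ** U))" for \<omega>
  have borelM: "borel_measurable ?base = borel_measurable borel"
    using sets_theta_base by (rule measurable_cong_sets) simp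
  have dens_meas: "dens \<in> borel_measurable ?base"
    unfolding dens_def[abs_def] borelM by (rule theta_expect(1)[OF near_weight_measurable])
  obtain R where R: "R \<in> null_sets lborel" and detR: "\<And>M. M \<notin> R \<Longrightarrow> det (M ** Q' M) \<noteq> 0"
    using AE_det_MQ by blast
  \<comment> \<open>Three exceptional sets are discarded: where the decomposition fails, where M Q
    is singular, and where U is not unitary. Elsewhere the pseudoinverse condition is
    \<open>near\<close>.\<close>
  have ae: "AE \<omega> in ?base. ennreal (theta_dens \<omega>) = dens \<omega> \<and> (case phi_n Q \<omega> of (A, l, v) \<Rightarrow> \<phi> A l v) = val \<omega>"
    using AE_theta_base_M[OF N] AE_theta_base_M[OF R] AE_theta_base_U
  proof eventually_elim
    fix \<omega> :: "complex \<times> (complex^('m option)^'m) \<times> (complex^'m^'m) \<times> (complex^'m)"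
    assume 1: "fst (snd \<omega>) \<notin> N" "fst (snd \<omega>) \<notin> R" "fst (snd (snd \<omega>)) \<in> unitary_mats"
    obtain z M U w where w: "\<omega> = (z, M, U, w)" by (metis surj_pair)
    have Q: "Q M = Q' M" using 1 by (simp add: w Q'_def)
    have "near z (M ** Q' M ** U) \<longleftrightarrow> n * cmod z * norm (mp_pinv M) \<le> 1"
      unfolding n_def using near_mp_pinv[of "Q M" M U z] QQ[of M] MQ[of M] detR[of M] 1 Q by (simp add: w)
    moreover have "theta_dens \<omega> = k * exp (- 2 * n ^ 3 * (cmod z)\<^sup>2 - (norm M)\<^sup>2 - (norm w)\<^sup>2)
        * (if n * cmod z * norm (mp_pinv M) \<le> 1 then 1 else 0)"
      unfolding w theta_dens_def Let_def prod.case k_def cardo cardn ..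
    moreover have "exp (- 2 * n ^ 3 * (cmod z)\<^sup>2 - (norm M)\<^sup>2 - (norm w)\<^sup>2)
        = exp (- (2 * n ^ 3 * (cmod z)\<^sup>2)) * exp (- (norm w)\<^sup>2) * exp (- (norm M)\<^sup>2)"
      by (simp add: exp_add[symmetric])
    moreover have "dens \<omega> = ennreal (k * exp (- (2 * n ^ 3 * (cmod z)\<^sup>2))) * gauss w
        * (if near z (M ** Q' M ** U) then 1 else 0) * gauss M"
      by (simp add: dens_def w near_weight_def k_def n_def)
    ultimately have d1: "ennreal (theta_dens \<omega>) = dens \<omega>"
      using k by (simp add: ennreal_mult mult.assoc)
    have e1: "axis None 1 = ext 1 (0 :: complex ^ 'm)"
      by (auto simp: axis_def ext_def vec_eq_iff split: option.splits)
    have "(case phi_n Q \<omega> of (A, l, v) \<Rightarrow> \<phi> A l v) = val \<omega>"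
      by (simp add: w phi_n_def val_def schur_val_def block_mat_eq_blk Q e1)
    with d1 show "ennreal (theta_dens \<omega>) = dens \<omega> \<and> (case phi_n Q \<omega> of (A, l, v) \<Rightarrow> \<phi> A l v) = val \<omega>" by (rule conjI)
  qed
  define T where "T = (\<integral>\<^sup>+\<omega>. dens \<omega> \<partial>?base)"
  have T: "ennreal (1 / 2) \<le> T"
    unfolding T_def dens_def[abs_def] theta_expect(2)[OF near_weight_measurable] by (rule near_weight_mass)
  have theta: "theta_n \<mu> = density ?base (\<lambda>\<omega>. inverse T * dens \<omega>)"
  proof -
    have "(\<integral>\<^sup>+\<omega>. ennreal (theta_dens \<omega>) \<partial>?base) = T"
      unfolding T_def using ae by (intro nn_integral_cong_AE) (auto elim!: eventually_mono)
    moreover have "AE \<omega> in ?base. inverse T * ennreal (theta_dens \<omega>) = inverse T * dens \<omega>"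
      using ae by (auto elim!: eventually_mono)
    ultimately show ?thesis
      unfolding theta_n_def Let_def by (simp add: density_cong_AE_nonmeasurable)
  qed
  have invT: "inverse T \<le> 2"
  proof (cases T)
    case (real t)
    then have t: "1 / 2 \<le> t" using T by (subst (asm) real(2), subst (asm) ennreal_le_iff) auto
    then have "inverse T = ennreal (inverse t)" using real by (simp add: inverse_ennreal)
    also have "\<dots> \<le> ennreal 2" using t by (intro ennreal_leI) (simp add: field_simps)
    finally show ?thesis by simp
  qed simp
  obtain g where g [measurable]: "g \<in> borel_measurable borel" and g_le: "\<And>A. g A \<le> gauss A * eig_sum \<phi> A"
    and chart: "(\<integral>\<^sup>+p. chart_val p * ennreal ((cmod (eig_det p))\<^sup>2) \<partial>lborel) \<le> (\<integral>\<^sup>+A. g A \<partial>lborel)"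
    using chart_integral_le by blast
  let ?\<Psi> = "\<lambda>z w B. schur_val z w B * near_weight z w B"
  have \<Psi>m: "(\<lambda>p. ?\<Psi> (fst p) (fst (snd p)) (snd (snd p))) \<in> borel_measurable borel"
    by (intro borel_measurable_times_ennreal near_weight_measurable schur_val_measurable continuous_intros)
  have val_m: "val \<in> borel_measurable ?base"
  proof -
    have "(\<lambda>p :: complex \<times> (complex ^ 'm) \<times> (complex ^ 'm ^ 'm). schur_val (fst p) (fst (snd p)) (snd (snd p))) \<in> borel_measurable borel"
      by (intro schur_val_measurable continuous_intros)
    from theta_expect(3)[OF this] show ?thesis unfolding borelM val_def[abs_def] .
  qed
  have val_meas: "(\<lambda>\<omega>. val \<omega> * dens \<omega>) \<in> borel_measurable ?base"
    using val_m dens_meas by measurable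
  have main: "(\<integral>\<^sup>+\<omega>. val \<omega> * dens \<omega> \<partial>?base) \<le> ennreal (k * (11 / 2)) * (\<integral>\<^sup>+A. g A \<partial>lborel)"
  proof -
    have "(\<integral>\<^sup>+\<omega>. val \<omega> * dens \<omega> \<partial>?base)
        = (\<integral>\<^sup>+\<omega>. (case \<omega> of (z, M, U, w) \<Rightarrow> ?\<Psi> z w (M ** Q' M ** U) * gauss M) \<partial>?base)"
      by (intro nn_integral_cong) (simp add: val_def dens_def mult.assoc split: prod.splits)
    also have "\<dots> = chart_mass TYPE('m) * (\<integral>\<^sup>+z. \<integral>\<^sup>+w. \<integral>\<^sup>+B. ?\<Psi> z w B * ennreal ((cmod (det B))\<^sup>2) * gauss B \<partial>lborel \<partial>lborel \<partial>lborel)"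
      by (rule theta_expect(2)[OF \<Psi>m])
    also have "\<dots> \<le> chart_mass TYPE('m) * (\<integral>\<^sup>+z. \<integral>\<^sup>+w. \<integral>\<^sup>+B. ennreal (k * (11 / 2)) *
       (schur_val z w B * gauss (blk z w 0 B) * ennreal ((cmod (det (cscale z (mat 1) - B)))\<^sup>2)) \<partial>lborel \<partial>lborel \<partial>lborel)"
    proof (intro mult_left_mono nn_integral_mono)
      fix z w and B :: "complex ^ 'm ^ 'm"
      show "?\<Psi> z w B * ennreal ((cmod (det B))\<^sup>2) * gauss B \<le> ennreal (k * (11 / 2)) *
       (schur_val z w B * gauss (blk z w 0 B) * ennreal ((cmod (det (cscale z (mat 1) - B)))\<^sup>2))"
      proof (cases "near z B")
        case True
        let ?d = "(cmod (det B))\<^sup>2" and ?d' = "(cmod (det (cscale z (mat 1) - B)))\<^sup>2"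
        let ?e = "exp (- (2 * n ^ 3 * (cmod z)\<^sup>2))"
        \<comment> \<open>The sharper Gaussian in z is relaxed to exp (-|z|^2), the weight of the
          corner entry in the Schur form.\<close>
        have "1 \<le> 2 * n ^ 3" using n(2) one_le_power[of n 3] by linarith
        then have "(cmod z)\<^sup>2 \<le> 2 * n ^ 3 * (cmod z)\<^sup>2" using mult_right_mono[of 1 "2 * n ^ 3" "(cmod z)\<^sup>2"] by simp
        then have "?e \<le> exp (- (cmod z)\<^sup>2)" by simp
        then have "k * ?e * ?d * (exp (- (norm w)\<^sup>2) * exp (- (norm B)\<^sup>2))
            \<le> k * exp (- (cmod z)\<^sup>2) * (11 / 2 * ?d') * (exp (- (norm w)\<^sup>2) * exp (- (norm B)\<^sup>2))"
          using k near_det_bound[OF True] by (intro mult_right_mono mult_mono mult_left_mono) auto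
        also have "\<dots> = k * (11 / 2) * (exp (- (norm (blk z w 0 B))\<^sup>2) * ?d')"
          by (simp add: norm_blk exp_add[symmetric] exp_diff[symmetric] mult_ac)
        finally have "ennreal (k * ?e * ?d * (exp (- (norm w)\<^sup>2) * exp (- (norm B)\<^sup>2)))
            \<le> ennreal (k * (11 / 2) * (exp (- (norm (blk z w 0 B))\<^sup>2) * ?d'))" by (rule ennreal_leI)
        then have "schur_val z w B * (ennreal (k * ?e) * gauss w * ennreal ?d * gauss B)
            \<le> schur_val z w B * (ennreal (k * (11 / 2)) * (gauss (blk z w 0 B) * ennreal ?d'))"
          using k by (intro mult_left_mono) (auto simp: ennreal_mult[symmetric] mult_ac)
        moreover have "near_weight z w B = ennreal (k * ?e) * gauss w"
          using True by (simp add: near_weight_def k_def n_def)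
        ultimately show ?thesis by (simp only: mult_ac)
      qed (simp add: near_weight_def)
    qed simp
    also have "\<dots> = ennreal (k * (11 / 2)) * (\<integral>\<^sup>+p. chart_val p * ennreal ((cmod (eig_det p))\<^sup>2) \<partial>lborel)"
    proof -
      let ?H = "\<lambda>p :: complex \<times> (complex ^ 'm) \<times> (complex ^ 'm ^ 'm). schur_val (fst p) (fst (snd p)) (snd (snd p))
          * gauss (blk (fst p) (fst (snd p)) 0 (snd (snd p))) * ennreal ((cmod (det (cscale (fst p) (mat 1) - snd (snd p))))\<^sup>2)"
      have "(\<lambda>p :: complex \<times> (complex ^ 'm) \<times> (complex ^ 'm ^ 'm). blk (fst p) (fst (snd p)) 0 (snd (snd p))) \<in> borel_measurable borel"
        "(\<lambda>p :: complex \<times> (complex ^ 'm) \<times> (complex ^ 'm ^ 'm). det (cscale (fst p) (mat 1) - snd (snd p))) \<in> borel_measurable borel"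
        by (intro borel_measurable_continuous_onI continuous_intros)+
      moreover have "(\<lambda>p :: complex \<times> (complex ^ 'm) \<times> (complex ^ 'm ^ 'm). schur_val (fst p) (fst (snd p)) (snd (snd p))) \<in> borel_measurable borel"
        by (intro schur_val_measurable continuous_intros)
      ultimately have H: "?H \<in> borel_measurable borel" by measurable
      then have KH: "(\<lambda>p. ennreal (k * (11 / 2)) * ?H p) \<in> borel_measurable borel" by measurable
      have "(\<integral>\<^sup>+p. ennreal (k * (11 / 2)) * ?H p \<partial>lborel) = ennreal (k * (11 / 2)) * (\<integral>\<^sup>+p. ?H p \<partial>lborel)"
        using H by (intro nn_integral_cmult) simp
      then show ?thesis
        unfolding chart_integral_eq nn_integral_lborel_triple[OF H] nn_integral_lborel_triple[OF KH]
        by (simp add: mult.left_commute)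
    qed
    also have "\<dots> \<le> ennreal (k * (11 / 2)) * (\<integral>\<^sup>+A. g A \<partial>lborel)"
      by (intro mult_left_mono chart) simp
    finally show ?thesis .
  qed
  have "(\<integral>\<^sup>+ \<omega>. (case phi_n Q \<omega> of (A, l, v) \<Rightarrow> \<phi> A l v) \<partial>theta_n \<mu>) = (\<integral>\<^sup>+\<omega>. inverse T * (val \<omega> * dens \<omega>) \<partial>?base)"
  proof -
    have fm: "(\<lambda>\<omega>. inverse T * dens \<omega>) \<in> borel_measurable ?base" using dens_meas by measurable
    have "AE \<omega> in ?base. (case phi_n Q \<omega> of (A, l, v) \<Rightarrow> \<phi> A l v) = val \<omega>"
      using ae by (auto elim!: eventually_mono)
    then have "AE \<omega> in theta_n \<mu>. (case phi_n Q \<omega> of (A, l, v) \<Rightarrow> \<phi> A l v) = val \<omega>"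
      unfolding theta AE_density[OF fm] by (auto elim!: eventually_mono)
    then have "(\<integral>\<^sup>+ \<omega>. (case phi_n Q \<omega> of (A, l, v) \<Rightarrow> \<phi> A l v) \<partial>theta_n \<mu>) = (\<integral>\<^sup>+\<omega>. val \<omega> \<partial>theta_n \<mu>)"
      by (rule nn_integral_cong_AE)
    also have "\<dots> = (\<integral>\<^sup>+\<omega>. inverse T * dens \<omega> * val \<omega> \<partial>?base)"
      unfolding theta by (rule nn_integral_density[OF fm val_m])
    finally show ?thesis by (simp add: mult_ac)
  qed
  also have "\<dots> = inverse T * (\<integral>\<^sup>+\<omega>. val \<omega> * dens \<omega> \<partial>?base)"
    by (rule nn_integral_cmult[OF val_meas])
  also have "\<dots> \<le> 2 * (ennreal (k * (11 / 2)) * (\<integral>\<^sup>+A. g A \<partial>lborel))"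
    by (intro mult_mono invT main) auto
  also have "\<dots> = ennreal (22 * n ^ 3) * (\<integral>\<^sup>+A. ennreal (1 / pi ^ ((?m + 1) * (?m + 1))) * g A \<partial>lborel)"
  proof -
    \<comment> \<open>The factor 2 bounds the inverse normalisation and \<open>k\<close> contains 2
      n^3, so the product is 22 n^3; the power of pi left over belongs to
      \<open>gauss_density\<close>.\<close>
    have "2 * ennreal (k * (11 / 2)) = ennreal (22 * n ^ 3) * ennreal (1 / pi ^ ((?m + 1) * (?m + 1)))"
      using n(2) by (simp add: k_def ennreal_mult[symmetric] flip: ennreal_numeral)
    then show ?thesis by (simp add: nn_integral_cmult mult.assoc[symmetric])
  qed
  also have "\<dots> \<le> ennreal (22 * n ^ 3) * (\<integral>\<^sup>+ A. ennreal (gauss_density A) * eig_sum \<phi> A \<partial>lborel)"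
  proof (intro mult_left_mono nn_integral_mono)
    fix A :: "complex^('m option)^('m option)"
    have "ennreal (1 / pi ^ ((?m + 1) * (?m + 1))) * g A \<le> ennreal (1 / pi ^ ((?m + 1) * (?m + 1))) * (gauss A * eig_sum \<phi> A)"
      by (intro mult_left_mono g_le) simp
    also have "\<dots> = ennreal (gauss_density A) * eig_sum \<phi> A"
      by (simp add: gauss_density_def ennreal_mult[symmetric] mult.assoc[symmetric])
    finally show "ennreal (1 / pi ^ ((?m + 1) * (?m + 1))) * g A \<le> ennreal (gauss_density A) * eig_sum \<phi> A" .
  qed simp
  finally show ?thesis by (simp only: n)
qed

theorem mainTheorem6:
  fixes Q :: "complex^(('m::{finite,linorder}) option)^(('m::{finite,linorder})) \<Rightarrow> complex^(('m::{finite,linorder}))^(('m::{finite,linorder}) option)"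
    and \<mu> :: "(complex^('m::{finite,linorder})^('m::{finite,linorder})) measure"
    and \<phi> :: "complex^(('m::{finite,linorder}) option)^(('m::{finite,linorder}) option) \<Rightarrow> complex \<Rightarrow> complex^(('m::{finite,linorder}) option) \<Rightarrow> ennreal"
  assumes haar: "is_haar_unitary \<mu>"
    and QR: "\<exists>N \<in> null_sets lborel. continuous_on (- N) Q \<and>
               (\<forall>M. M \<notin> N \<longrightarrow> is_reduced_QR_Q M (Q M))"
    and meas: "(\<lambda>(A, l, v). \<phi> A l v) \<in> borel_measurable (restrict_space borel Vn)"
    and ae_cont: "\<exists>N \<in> null_sets lborel.
               continuous_on (Vn - {p. fst p \<in> N}) (\<lambda>(A, l, v). \<phi> A l v)"
    and proj_pt_inv: "\<forall>(A, l, v) \<in> Vn. \<forall>c. c \<noteq> 0 \<longrightarrow> \<phi> A l (c *s v) = \<phi> A l v"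
    and unitary_inv: "\<forall>(A, l, v) \<in> Vn. \<forall>U \<in> unitary_mats.
               \<phi> (U ** A ** matrix_inv U) l (U *v v) = \<phi> A l v"
    and projective: "\<forall>(A, l, v) \<in> Vn. \<forall>s. s \<noteq> 0 \<longrightarrow> \<phi> (cscale s A) (s * l) v = \<phi> A l v"
  shows "(\<integral>\<^sup>+ \<omega>. (case phi_n Q \<omega> of (A, l, v) \<Rightarrow> \<phi> A l v) \<partial>theta_n \<mu>)
           \<le> ennreal (22 * real CARD(('m::{finite,linorder}) option) ^ 3) *
             (\<integral>\<^sup>+ A. ennreal (gauss_density A) * eig_sum \<phi> A \<partial>lborel)"
proof -
  obtain N where N: "N \<in> null_sets lborel" "continuous_on (- N) Q"
    and QR: "\<And>M. M \<notin> N \<Longrightarrow> is_reduced_QR_Q M (Q M)" using QR by blast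
  show ?thesis
    using proj_pt_inv unitary_inv
    by (intro theta_expectation_le[OF haar N reduced_QR(1)[OF QR] reduced_QR(2)[OF QR] meas]) fastforce+
qed

end
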